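(* There exists a set $\mathcal{G}$ of cardinality $2^{\aleph_0}$ consisting of finitely generated, residually finite groups such that for every $G\in\mathcal{G}$ the outer automorphism group $\operatorname{Out}(G)$ is finitely generated and not recursively presentable, and such that for all distinct $G_1,G_2\in\mathcal{G}$ the groups $\operatorname{Out}(G_1)$ and $\operatorname{Out}(G_2)$ are not isomorphic.
   Context: A group $G$ is residually finite if for every $g\in G\setminus\{1\}$ there is a homomorphism $\phi_g:G\to F_g$ with $F_g$ finite and $\phi_g(g)\neq 1$. $\operatorname{Out}(G)=\operatorname{Aut}(G)/\operatorname{Inn}(G)$. A finitely generated group is recursively presentable if it admits a presentation with finitely many generators and a recursively enumerable set of relators. *)

theory Defs
  imports
    "HOL-Algebra.Generated_Groups"
    "HOL-Algebra.Bij"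
    "HOL-Library.Nat_Bijection"
    "HOL-Library.Equipollence"
begin

section \<open>Finitely generated and residually finite groups\<close>

definition finitely_generated :: "('a, 'b) monoid_scheme \<Rightarrow> bool" where
  "finitely_generated G \<longleftrightarrow> (\<exists>S. finite S \<and> S \<subseteq> carrier G \<and> generate G S = carrier G)"

text \<open>Every finite group is isomorphic to one whose carrier is a set of natural numbers, so
  restricting the type of the finite quotients loses no generality.\<close>

definition residually_finite :: "('a, 'b) monoid_scheme \<Rightarrow> bool" where
  "residually_finite G \<longleftrightarrow>
     (\<forall>g \<in> carrier G - {\<one>\<^bsub>G\<^esub>}. \<exists>(F :: nat monoid) \<phi>.
        group F \<and> finite (carrier F) \<and> \<phi> \<in> hom G F \<and> \<phi> g \<noteq> \<one>\<^bsub>F\<^esub>)"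


section \<open>Outer automorphisms\<close>

text \<open>Elements of \<^const>\<open>AutoGroup\<close> are extensional functions on the carrier, hence the
  \<^const>\<open>restrict\<close>.\<close>

definition inner_auto :: "('a, 'b) monoid_scheme \<Rightarrow> ('a \<Rightarrow> 'a) set" where
  "inner_auto G = (\<lambda>g. \<lambda>x \<in> carrier G. g \<otimes>\<^bsub>G\<^esub> x \<otimes>\<^bsub>G\<^esub> inv\<^bsub>G\<^esub> g) ` carrier G"

definition Out :: "('a, 'b) monoid_scheme \<Rightarrow> ('a \<Rightarrow> 'a) set monoid" where
  "Out G = AutoGroup G Mod inner_auto G"

context group
begin

lemma carrier_AutoGroup: "carrier (AutoGroup G) = auto G"
  by (simp add: AutoGroup_def)

lemma mult_AutoGroup:
  "f \<in> auto G \<Longrightarrow> h \<in> auto G \<Longrightarrow> f \<otimes>\<^bsub>AutoGroup G\<^esub> h = compose (carrier G) f h"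
  by (simp add: AutoGroup_def BijGroup_def auto_def)

lemma one_AutoGroup: "\<one>\<^bsub>AutoGroup G\<^esub> = (\<lambda>x \<in> carrier G. x)"
  by (simp add: AutoGroup_def BijGroup_def)

lemma conj_in_auto:
  assumes "g \<in> carrier G"
  shows "(\<lambda>x \<in> carrier G. g \<otimes> x \<otimes> inv g) \<in> auto G"
proof -
  let ?c = "\<lambda>x \<in> carrier G. g \<otimes> x \<otimes> inv g"
  have "?c \<in> hom G G"
    using assms by (auto simp: hom_def m_assoc inv_solve_left)
  moreover have "bij_betw ?c (carrier G) (carrier G)"
  proof (rule bij_betw_byWitness[where f' = "\<lambda>x. inv g \<otimes> x \<otimes> g"])
    show "\<forall>a\<in>carrier G. inv g \<otimes> ?c a \<otimes> g = a"
      using assms by (simp flip: m_assoc) (simp add: m_assoc)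
    show "\<forall>a'\<in>carrier G. ?c (inv g \<otimes> a' \<otimes> g) = a'"
      using assms by (simp flip: m_assoc) (simp add: m_assoc)
  qed (use assms in auto)
  ultimately show ?thesis
    by (simp add: auto_def Bij_def)
qed

lemma inner_auto_normal: "inner_auto G \<lhd> AutoGroup G"
proof -
  interpret A: group "AutoGroup G" by (rule AutoGroup)
  let ?c = "\<lambda>g. \<lambda>x \<in> carrier G. g \<otimes> x \<otimes> inv g"
  have c: "?c g \<in> carrier (AutoGroup G)" if "g \<in> carrier G" for g
    using conj_in_auto[OF that] by (simp add: carrier_AutoGroup)
  have mul: "?c g \<otimes>\<^bsub>AutoGroup G\<^esub> ?c h = ?c (g \<otimes> h)" if "g \<in> carrier G" "h \<in> carrier G" for g h
    using that by (auto simp: mult_AutoGroup conj_in_auto compose_def m_assoc inv_mult_group)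
  have "?c \<in> hom G (AutoGroup G)"
    using c mul by (auto simp: hom_def)
  then interpret c: group_hom G "AutoGroup G" ?c
    by unfold_locales
  have sub: "subgroup (inner_auto G) (AutoGroup G)"
    using c.img_is_subgroup by (simp add: inner_auto_def)
  show ?thesis
    unfolding A.normal_inv_iff
  proof (intro conjI ballI)
    show "subgroup (inner_auto G) (AutoGroup G)" by (rule sub)
    fix f k assume f: "f \<in> carrier (AutoGroup G)" and "k \<in> inner_auto G"
    then obtain g where g: "g \<in> carrier G" and k: "k = ?c g"
      by (auto simp: inner_auto_def)
    have fa: "f \<in> auto G" using f by (simp add: carrier_AutoGroup)
    then interpret f: group_hom G G f
      by unfold_locales (simp add: auto_def)
    have "f \<otimes>\<^bsub>AutoGroup G\<^esub> ?c g = ?c (f g) \<otimes>\<^bsub>AutoGroup G\<^esub> f"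
      using g fa conj_in_auto by (auto simp: mult_AutoGroup compose_def)
    then have "f \<otimes>\<^bsub>AutoGroup G\<^esub> k \<otimes>\<^bsub>AutoGroup G\<^esub> inv\<^bsub>AutoGroup G\<^esub> f = ?c (f g)"
      using f g c k by (simp add: A.m_assoc)
    then show "f \<otimes>\<^bsub>AutoGroup G\<^esub> k \<otimes>\<^bsub>AutoGroup G\<^esub> inv\<^bsub>AutoGroup G\<^esub> f \<in> inner_auto G"
      using g by (auto simp: inner_auto_def)
  qed
qed

lemma group_Out: "group (Out G)"
  unfolding Out_def by (rule normal.factorgroup_is_group[OF inner_auto_normal])

end


section \<open>Free groups and presentations\<close>

text \<open>A word over \<open>X\<close> is a list of pairs \<open>(x, b)\<close>, where \<open>(x, True)\<close> stands for the generator
  \<open>x\<close> and \<open>(x, False)\<close> for its formal inverse.\<close>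

type_synonym 'x word = "('x \<times> bool) list"

definition words :: "'x set \<Rightarrow> 'x word set" where
  "words X = lists (X \<times> UNIV)"

inductive cancels :: "'x set \<Rightarrow> 'x word \<Rightarrow> 'x word \<Rightarrow> bool" for X where
  "u \<in> words X \<Longrightarrow> v \<in> words X \<Longrightarrow> x \<in> X \<Longrightarrow> cancels X (u @ [(x, b), (x, \<not> b)] @ v) (u @ v)"

definition free_rel :: "'x set \<Rightarrow> ('x word \<times> 'x word) set" where
  "free_rel X = {(u, v). u \<in> words X \<and> v \<in> words X \<and> equivclp (cancels X) u v}"

definition free_class :: "'x set \<Rightarrow> 'x word \<Rightarrow> 'x word set" where
  "free_class X w = free_rel X `` {w}"

definition free_group :: "'x set \<Rightarrow> 'x word set monoid" where
  "free_group X =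
     \<lparr>carrier = words X // free_rel X,
      mult = (\<lambda>A B. \<Union>u \<in> A. \<Union>v \<in> B. free_class X (u @ v)),
      one = free_class X []\<rparr>"

definition normal_closure :: "('a, 'b) monoid_scheme \<Rightarrow> 'a set \<Rightarrow> 'a set" where
  "normal_closure G S = \<Inter>{N. N \<lhd> G \<and> S \<subseteq> N}"

definition presented_group :: "'x set \<Rightarrow> 'x word set \<Rightarrow> 'x word set set monoid" where
  "presented_group X R = free_group X Mod normal_closure (free_group X) (free_class X ` R)"

lemma words_simps [simp]:
  "[] \<in> words X" "(p # u \<in> words X) = (fst p \<in> X \<and> u \<in> words X)"
  "(u @ v \<in> words X) = (u \<in> words X \<and> v \<in> words X)"
  by (cases p; auto simp: words_def)+

lemma equiv_free_rel: "equiv (words X) (free_rel X)"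
proof (rule equivI)
  show "free_rel X \<subseteq> words X \<times> words X" by (auto simp: free_rel_def)
  show "refl_on (words X) (free_rel X)" by (auto simp: free_rel_def refl_on_def)
  show "sym (free_rel X)" unfolding free_rel_def sym_def by (blast intro: equivclp_sym)
  show "trans (free_rel X)" unfolding free_rel_def trans_def by (blast intro: equivclp_trans)
qed

lemma equivclp_map:
  assumes "equivclp r a b" and "\<And>a b. r a b \<Longrightarrow> r (f a) (f b)"
  shows "equivclp r (f a) (f b)"
  using assms(1)
proof (induction rule: equivclp_induct)
  case base
  show ?case by simp
next
  case (step y z)
  then have "r (f y) (f z) \<or> r (f z) (f y)"
    using assms(2) by blast
  then have "equivclp r (f y) (f z)"
    by (blast intro: r_into_equivclp equivclp_sym)
  with step.IH show ?case by (rule equivclp_trans)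
qed

lemma free_rel_append:
  assumes "(u, u') \<in> free_rel X" "(v, v') \<in> free_rel X"
  shows "(u @ v, u' @ v') \<in> free_rel X"
proof -
  have w: "u \<in> words X" "u' \<in> words X" "v \<in> words X" "v' \<in> words X"
    and e: "equivclp (cancels X) u u'" "equivclp (cancels X) v v'"
    using assms by (auto simp: free_rel_def)
  have l: "cancels X (a @ v) (b @ v)" if "cancels X a b" for a b
    using that
  proof cases
    case (1 p q x c)
    then show ?thesis using cancels.intros[of p X "q @ v" x c] w by simp
  qed
  have r: "cancels X (u' @ a) (u' @ b)" if "cancels X a b" for a b
    using that
  proof cases
    case (1 p q x c)
    then show ?thesis using cancels.intros[of "u' @ p" X q x c] w by simp
  qed
  have "equivclp (cancels X) (u @ v) (u' @ v)"
    by (rule equivclp_map[OF e(1) l])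
  also have "equivclp (cancels X) (u' @ v) (u' @ v')"
    by (rule equivclp_map[OF e(2) r])
  finally (equivclp_trans) show ?thesis using w by (simp add: free_rel_def)
qed

lemma free_class_eq: "(u, v) \<in> free_rel X \<Longrightarrow> free_class X u = free_class X v"
  unfolding free_class_def by (rule equiv_class_eq[OF equiv_free_rel])

lemma free_class_mult:
  assumes "u \<in> words X" "v \<in> words X"
  shows "free_class X u \<otimes>\<^bsub>free_group X\<^esub> free_class X v = free_class X (u @ v)"
proof -
  have eq: "free_class X (u' @ v') = free_class X (u @ v)"
    if "u' \<in> free_class X u" "v' \<in> free_class X v" for u' v'
    using free_class_eq[OF free_rel_append, of u u' X v v'] that by (simp add: free_class_def)
  have "u \<in> free_class X u" "v \<in> free_class X v"
    using assms by (simp_all add: free_class_def free_rel_def)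
  then have "(\<Union>u' \<in> free_class X u. \<Union>v' \<in> free_class X v. free_class X (u' @ v')) =
      free_class X (u @ v)"
    using eq by blast
  then show ?thesis by (simp add: free_group_def)
qed

lemma carrier_free_group: "carrier (free_group X) = free_class X ` words X"
  by (auto simp: free_group_def quotient_def free_class_def)

lemma free_rel_inverse:
  "u \<in> words X \<Longrightarrow> (rev (map (apsnd Not) u) @ u, []) \<in> free_rel X \<and> rev (map (apsnd Not) u) \<in> words X"
proof (induction u)
  case Nil
  show ?case by (simp add: free_rel_def)
next
  case (Cons p u)
  obtain x b where p: "p = (x, b)" by force
  let ?i = "rev (map (apsnd Not) u)"
  from Cons p have w: "?i \<in> words X" "u \<in> words X" "x \<in> X" and 1: "(?i @ u, []) \<in> free_rel X"
    by auto
  then have "cancels X (?i @ [(x, \<not> b), (x, b)] @ u) (?i @ u)"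
    using cancels.intros[of ?i X u x "\<not> b"] by simp
  then have "(?i @ [(x, \<not> b), (x, b)] @ u, ?i @ u) \<in> free_rel X"
    using w r_into_equivclp[of "cancels X"] by (simp add: free_rel_def)
  with 1 have "(?i @ [(x, \<not> b), (x, b)] @ u, []) \<in> free_rel X"
    using equiv_free_rel[of X] by (blast elim: equivE dest: transD)
  then show ?case using p w by simp
qed

lemma group_free_group: "group (free_group X)"
proof (rule groupI)
  have one: "\<one>\<^bsub>free_group X\<^esub> = free_class X []"
    by (simp add: free_group_def)
  show "\<one>\<^bsub>free_group X\<^esub> \<in> carrier (free_group X)"
    by (simp add: one carrier_free_group)
  fix a assume "a \<in> carrier (free_group X)"
  then obtain u where u: "u \<in> words X" "a = free_class X u"
    by (auto simp: carrier_free_group)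
  show "\<one>\<^bsub>free_group X\<^esub> \<otimes>\<^bsub>free_group X\<^esub> a = a"
    using u by (simp add: one free_class_mult)
  show "\<exists>b \<in> carrier (free_group X). b \<otimes>\<^bsub>free_group X\<^esub> a = \<one>\<^bsub>free_group X\<^esub>"
    using free_rel_inverse[OF u(1)] u free_class_eq
    by (intro bexI[of _ "free_class X (rev (map (apsnd Not) u))"])
      (auto simp: one carrier_free_group free_class_mult)
qed (auto simp: carrier_free_group free_class_mult)

lemma (in group) normal_closure_normal:
  assumes "S \<subseteq> carrier G"
  shows "normal_closure G S \<lhd> G"
proof -
  let ?\<N> = "{N. N \<lhd> G \<and> S \<subseteq> N}"
  have "carrier G \<lhd> G"
    by (simp add: normal_inv_iff subgroup_self)
  then have ne: "?\<N> \<noteq> {}" using assms by blast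
  have "subgroup (\<Inter>?\<N>) G"
    by (rule subgroups_Inter) (use ne in \<open>auto simp: normal_imp_subgroup\<close>)
  then show ?thesis
    unfolding normal_inv_iff normal_closure_def
    by (auto intro: normal.inv_op_closed2)
qed

lemma group_presented_group:
  assumes "R \<subseteq> words X"
  shows "group (presented_group X R)"
  unfolding presented_group_def
  by (intro normal.factorgroup_is_group group.normal_closure_normal group_free_group)
    (use assms in \<open>auto simp: carrier_free_group\<close>)


section \<open>Recursively enumerable sets\<close>

text \<open>Partial recursive functions on tuples of natural numbers. \<open>PrimRec\<close> recurses on the first
  argument and receives the previous value as the second argument of the step function;
  \<open>Mu\<close> minimises over the first argument.\<close>

datatype recfun =
    Zero
  | Succ
  | Proj nat
  | Comp recfun "recfun list"
  | PrimRec recfun recfun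
  | Mu recfun

inductive computes :: "recfun \<Rightarrow> nat list \<Rightarrow> nat \<Rightarrow> bool" where
  Zero: "computes Zero xs 0"
| Succ: "computes Succ [x] (Suc x)"
| Proj: "i < length xs \<Longrightarrow> computes (Proj i) xs (xs ! i)"
| Comp: "list_all2 (\<lambda>g y. computes g xs y) gs ys \<Longrightarrow> computes f ys z \<Longrightarrow>
    computes (Comp f gs) xs z"
| PrimRec_0: "computes f xs y \<Longrightarrow> computes (PrimRec f g) (0 # xs) y"
| PrimRec_Suc: "computes (PrimRec f g) (n # xs) r \<Longrightarrow> computes g (n # r # xs) y \<Longrightarrow>
    computes (PrimRec f g) (Suc n # xs) y"
| Mu: "computes f (n # xs) 0 \<Longrightarrow> (\<forall>m < n. \<exists>y. computes f (m # xs) (Suc y)) \<Longrightarrow>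
    computes (Mu f) xs n"

definition recursively_enumerable :: "nat set \<Rightarrow> bool" where
  "recursively_enumerable A \<longleftrightarrow> (\<exists>f. A = {x. \<exists>y. computes f [x] y})"

inductive_cases computes_ZeroE: "computes Zero xs z"
inductive_cases computes_SuccE: "computes Succ xs z"
inductive_cases computes_ProjE: "computes (Proj i) xs z"
inductive_cases computes_CompE: "computes (Comp f gs) xs z"
inductive_cases computes_PrimRec_0E: "computes (PrimRec f g) (0 # xs) z"
inductive_cases computes_PrimRec_SucE: "computes (PrimRec f g) (Suc n # xs) z"
inductive_cases computes_MuE: "computes (Mu f) xs z"

lemma computes_functional: "computes f xs y \<Longrightarrow> computes f xs z \<Longrightarrow> y = z"
proof (induction f xs y arbitrary: z rule: computes.induct)
  case (Zero xs)
  then show ?case by (rule computes_ZeroE) simp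
next
  case (Succ x)
  then show ?case by (rule computes_SuccE) simp
next
  case (Proj i xs)
  from Proj.prems show ?case by (rule computes_ProjE) simp
next
  case (Comp xs gs ys f y)
  from Comp.prems obtain ys' where
    ys': "list_all2 (\<lambda>g y. computes g xs y) gs ys'" "computes f ys' z"
    by (rule computes_CompE)
  have len: "length gs = length ys" "length gs = length ys'"
    by (rule list_all2_lengthD[OF Comp.IH(1)], rule list_all2_lengthD[OF ys'(1)])
  have "ys = ys'"
  proof (rule nth_equalityI)
    show "length ys = length ys'" using len by simp
    fix i assume "i < length ys"
    then have i: "i < length gs" using len by simp
    have "\<forall>z. computes (gs ! i) xs z \<longrightarrow> ys ! i = z"
      using list_all2_nthD[OF Comp.IH(1) i] by (rule conjunct2)
    then show "ys ! i = ys' ! i"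
      using list_all2_nthD[OF ys'(1) i] by blast
  qed
  with ys'(2) have "computes f ys z" by simp
  then show ?case by (rule Comp.IH(2))
next
  case (PrimRec_0 f xs y g)
  from PrimRec_0.prems have "computes f xs z"
    by (rule computes_PrimRec_0E)
  then show ?case by (rule PrimRec_0.IH)
next
  case (PrimRec_Suc f g n xs r y)
  from PrimRec_Suc.prems obtain r' where
    r': "computes (PrimRec f g) (n # xs) r'" "computes g (n # r' # xs) z"
    by (rule computes_PrimRec_SucE)
  from r'(1) have "r = r'" by (rule PrimRec_Suc.IH(1))
  with r'(2) have "computes g (n # r # xs) z" by simp
  then show ?case by (rule PrimRec_Suc.IH(2))
next
  case (Mu f n xs)
  from Mu.prems have z0: "computes f (z # xs) 0"
    by (rule computes_MuE)
  from Mu.prems have zS: "\<forall>m < z. \<exists>y. computes f (m # xs) (Suc y)"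
    by (rule computes_MuE)
  show ?case
  proof (rule linorder_cases[of n z])
    assume "n < z"
    with zS obtain y where "computes f (n # xs) (Suc y)" by blast
    then have "0 = Suc y" by (rule Mu.IH(1))
    then show ?thesis by simp
  next
    assume "z < n"
    with Mu.IH(2) obtain y where "computes f (z # xs) 0 \<longrightarrow> Suc y = 0" by blast
    with z0 show ?thesis by simp
  qed
qed


section \<open>Recursive presentability\<close>

text \<open>An explicit computable bijection between words over \<^typ>\<open>nat\<close> and \<^typ>\<open>nat\<close>; a
  merely existing injection would not do, as it need not be computable.\<close>

definition word_code :: "nat word \<Rightarrow> nat" where
  "word_code w = list_encode (map (\<lambda>(i, b). 2 * i + of_bool b) w)"

definition recursively_presentable :: "('a, 'b) monoid_scheme \<Rightarrow> bool" where
  "recursively_presentable G \<longleftrightarrow>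
     (\<exists>n R. R \<subseteq> words {..<n} \<and> recursively_enumerable (word_code ` R) \<and>
        G \<cong> presented_group {..<n} R)"

end

theory Submission
  imports Defs "HOL-Library.Countable_Set" "HOL-Library.Poly_Mapping"
begin

text \<open>Let \<open>C\<close> be a residually finite left-ordered group generated by \<open>a\<close> and \<open>t\<close>. The free product
  \<open>\<Lambda> = \<langle>u\<rangle> * \<langle>v\<rangle>\<close> of two cyclic groups of order 3 acts on three copies of \<open>C\<close>: both generators
  permute the copies cyclically, \<open>v\<close> by the identity and \<open>u\<close> by left multiplication with \<open>a\<close>, \<open>t\<close>,
  \<open>(t a)\<^sup>-\<^sup>1\<close>. This commutes with right multiplication by \<open>C\<close>. Let \<open>G\<close> be the semidirect product of the
  \<open>\<int>/2\<close>-vector space \<open>M\<close> on these points (finite sets under symmetric difference) with \<open>\<Lambda>\<close>. Then: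
  \<open>M\<close> consists of the solutions of \<open>g\<^sup>2 = 1\<close>, so it is characteristic; \<open>Out \<Lambda>\<close> is finite, because
  elements of order 3 are conjugate to \<open>u\<^sup>\<plusminus>\<^sup>1\<close> or \<open>v\<^sup>\<plusminus>\<^sup>1\<close>; a \<open>\<Lambda>\<close>-automorphism of \<open>M\<close> is a right
  multiplication by an element of \<open>C\<close>, because the group ring of a left-ordered group has only trivial
  units and the action is asymmetric in the three copies; and an automorphism that is trivial on \<open>M\<close> and
  modulo \<open>M\<close> is, up to inner ones, the conjugation of \<open>v\<close> by an element of \<open>M\<close>. Hence \<open>Out G\<close> is
  finitely generated, and it contains \<open>C\<close>.

  For \<open>C\<close> take P. Hall's centre-by-metabelian groups, in which the commutator of \<open>a\<close> and
  \<open>t\<^sup>k a t\<^sup>-\<^sup>k\<close>, \<open>k = 3\<^sup>j\<^sup>+\<^sup>1\<close>, vanishes iff \<open>j \<notin> T\<close>, for an arbitrary set \<open>T\<close> of natural numbers. A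
  countable group contains such pairs for only countably many \<open>T\<close>, and there are only countably many
  recursive presentations.\<close>

section \<open>The free product of two cyclic groups of order 3\<close>

text \<open>The order 3 of the two factors is played against the characteristic 2 of
  \<open>M\<close>. The free product has no involutions, so the equation \<open>g^2 = 1\<close>
  isolates \<open>M\<close>; and every crossed homomorphism from a group of order 3 to
  \<open>M\<close> is inner. The automorphisms trivial on \<open>M\<close> and modulo
  \<open>M\<close> are thereby parametrised by \<open>M\<close>, up to inner ones. As
  \<open>C\<close> moves the points of each copy transitively, three of these automorphisms, one for
  each copy, yield all of them together with \<open>C\<close>. The obstacle is to keep the module
  endomorphisms of \<open>M\<close> from mixing the three copies. The gains are such that the
  commutator of \<open>x\<close> and \<open>z x z^-1\<close> is trivial for \<open>x = a\<close>,
  \<open>z = t\<close>, but not for the two pairs that belong to the other copies. A word realising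
  it fixes copy 0 pointwise and has only infinite orbits elsewhere, while the image of a point is a
  finite set. In Hall's groups \<open>a\<close> must therefore commute with \<open>t a t^-1\<close>,
  whence the exponent \<open>j + 1\<close>; and the base 3 makes a residue class differ from its
  negative, so that a commutator can detect it.\<close>

text \<open>The letter \<open>(s, e)\<close> is the generator \<open>u\<close> (\<open>s = False\<close>) or \<open>v\<close> (\<open>s = True\<close>), squared if \<open>e = True\<close>.\<close>

type_synonym fword = "(bool \<times> bool) list"

definition letter_act :: "(bool \<Rightarrow> 'x \<Rightarrow> 'x) \<Rightarrow> bool \<times> bool \<Rightarrow> 'x \<Rightarrow> 'x" where
  "letter_act g l y = (if snd l then g (fst l) (g (fst l) y) else g (fst l) y)"

definition word_act :: "(bool \<Rightarrow> 'x \<Rightarrow> 'x) \<Rightarrow> fword \<Rightarrow> 'x \<Rightarrow> 'x" where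
  "word_act g w y = foldr (letter_act g) w y"

lemma word_act_simps [simp]:
  "word_act g [] y = y"
  "word_act g (l # w) y = letter_act g l (word_act g w y)"
  "word_act g (v @ w) y = word_act g v (word_act g w y)"
  by (simp_all add: word_act_def)

abbreviation reduced :: "fword \<Rightarrow> bool" where
  "reduced w \<equiv> distinct_adj (map fst w)"

text \<open>Left multiplication of a normal form by the generator \<open>s\<close>. As in van der
  Waerden's trick, the group laws of the free product come from this operation on normal forms
  having cube 1, and not from confluence of a rewriting system.\<close>

fun step :: "bool \<Rightarrow> fword \<Rightarrow> fword" where
  "step s [] = [(s, False)]"
| "step s ((r, e) # w) =
     (if r = s then if e then w else (s, True) # w else (s, False) # (r, e) # w)"

text \<open>Two maps of cube 1 amount to an action of the free product. Instances:
  \<open>step\<close> on normal forms, left multiplication in a group by two elements of cube 1, the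
  truncated \<open>tstep\<close>, and \<open>move\<close>.\<close>

locale order3_action =
  fixes g :: "bool \<Rightarrow> 'x \<Rightarrow> 'x" and X :: "'x set"
  assumes closed: "x \<in> X \<Longrightarrow> g s x \<in> X"
    and cube: "x \<in> X \<Longrightarrow> g s (g s (g s x)) = x"
begin

lemma letter_act_closed: "x \<in> X \<Longrightarrow> letter_act g l x \<in> X"
  by (simp add: letter_act_def closed)

lemma word_act_closed: "x \<in> X \<Longrightarrow> word_act g w x \<in> X"
  by (induction w) (simp_all add: letter_act_closed)

lemma word_act_step: "x \<in> X \<Longrightarrow> word_act g (step s w) x = g s (word_act g w x)"
  by (induction s w rule: step.induct) (auto simp: letter_act_def cube word_act_closed)

lemma word_act_letter_act:
  "x \<in> X \<Longrightarrow> word_act g (letter_act step l w) x = letter_act g l (word_act g w x)"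
  by (simp add: letter_act_def word_act_step)

text \<open>For \<open>g = step\<close> this is the associativity of
  \<open>freeprod\<close>.\<close>

lemma word_act_mult:
  "x \<in> X \<Longrightarrow> word_act g (word_act step v w) x = word_act g v (word_act g w x)"
  by (induction v) (simp_all add: word_act_letter_act)

end

lemma step_order3: "order3_action step {w. reduced w}"
proof
  fix w s
  assume "w \<in> {w. reduced w}"
  then show "step s w \<in> {w. reduced w}"
    by (induction s w rule: step.induct) (auto simp: distinct_adj_Cons)
next
  fix w s
  assume "w \<in> {w. reduced w}"
  then show "step s (step s (step s w)) = w"
    proof (cases w)
    case (Cons l v)
    obtain r e where l: "l = (r, e)" by force
    show ?thesis using \<open>w \<in> _\<close> Cons l
      by (cases v) (auto simp: distinct_adj_Cons)
  qed simp
qed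

interpretation step: order3_action step "{w. reduced w}"
  by (rule step_order3)

definition freeprod :: "fword monoid" where
  "freeprod = \<lparr>carrier = {w. reduced w}, mult = word_act step, one = []\<rparr>"

abbreviation freeprod_mult :: "fword \<Rightarrow> fword \<Rightarrow> fword" (infixl \<open>\<cdot>\<close> 70) where
  "v \<cdot> w \<equiv> v \<otimes>\<^bsub>freeprod\<^esub> w"

abbreviation finv :: "fword \<Rightarrow> fword" where
  "finv w \<equiv> inv\<^bsub>freeprod\<^esub> w"

lemma freeprod_simps [simp]:
  "w \<in> carrier freeprod \<longleftrightarrow> reduced w" "v \<cdot> w = word_act step v w"
  "\<one>\<^bsub>freeprod\<^esub> = []"
  by (simp_all add: freeprod_def)

lemma letter_act_step_append:
  "w = [] \<or> fst (hd w) \<noteq> s \<Longrightarrow> letter_act step (s, e) w = (s, e) # w"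
  by (cases w) (auto simp: letter_act_def)

lemma word_act_step_append: "reduced (v @ w) \<Longrightarrow> word_act step v w = v @ w"
proof (induction v)
  case (Cons l v)
  then have "word_act step v w = v @ w"
    by (auto simp: distinct_adj_Cons)
  moreover have "v @ w = [] \<or> fst (hd (v @ w)) \<noteq> fst l"
    using Cons.prems by (auto simp: distinct_adj_Cons hd_append hd_map)
  ultimately show ?case
    using letter_act_step_append[of "v @ w" "fst l" "snd l"] by simp
qed simp

text \<open>The inverse of a generator is its square, so inversion flips the exponent bit.\<close>

definition winv :: "fword \<Rightarrow> fword" where
  "winv w = rev (map (apsnd Not) w)"

lemma winv_simps [simp]: "winv [] = []" "winv (l # w) = winv w @ [apsnd Not l]"
  "winv (v @ w) = winv w @ winv v" "winv (winv w) = w" "winv w = [] \<longleftrightarrow> w = []"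
  "length (winv w) = length w"
  by (simp_all add: winv_def rev_map comp_def apsnd_def map_prod_def case_prod_beta)

lemma reduced_winv [simp]: "reduced (winv w) \<longleftrightarrow> reduced w"
  by (simp add: winv_def rev_map[symmetric] comp_def)

lemma fst_hd_winv: "w \<noteq> [] \<Longrightarrow> fst (hd (winv w)) = fst (last w)"
  and fst_last_winv: "w \<noteq> [] \<Longrightarrow> fst (last (winv w)) = fst (hd w)"
  by (simp_all add: winv_def hd_rev last_rev last_map hd_map)

lemma winv_left: "reduced w \<Longrightarrow> word_act step (winv w) w = []"
proof (induction w)
  case (Cons l w)
  obtain s e where l: "l = (s, e)" by force
  have "w = [] \<or> fst (hd w) \<noteq> s"
    using Cons.prems l by (auto simp: distinct_adj_Cons hd_map)
  then have "letter_act step (apsnd Not l) (l # w) = w"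
    using l by (cases w) (auto simp: letter_act_def)
  then show ?case using Cons by (auto simp: distinct_adj_Cons)
qed simp

lemma group_freeprod: "group freeprod"
proof (rule groupI)
  fix x assume "x \<in> carrier freeprod"
  then show "\<exists>y\<in>carrier freeprod. y \<cdot> x = \<one>\<^bsub>freeprod\<^esub>"
    by (intro bexI[of _ "winv x"]) (auto simp: winv_left)
next
  fix x y assume "x \<in> carrier freeprod" "y \<in> carrier freeprod"
  then show "x \<cdot> y \<in> carrier freeprod"
    using step.word_act_closed[of y x] by simp
qed (auto simp: step.word_act_mult)

interpretation F: group freeprod by (rule group_freeprod)

lemma inv_freeprod: "reduced w \<Longrightarrow> finv w = winv w"
  by (rule F.inv_equality) (auto simp: winv_left)

lemma winv_right: "reduced w \<Longrightarrow> word_act step w (winv w) = []"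
  using F.r_inv[of w] by (simp add: inv_freeprod)

section \<open>The universal property of the free product\<close>

definition freeprod_lift :: "('a, 'b) monoid_scheme \<Rightarrow> (bool \<Rightarrow> 'a) \<Rightarrow> fword \<Rightarrow> 'a" where
  "freeprod_lift K h w = word_act (\<lambda>s x. h s \<otimes>\<^bsub>K\<^esub> x) w \<one>\<^bsub>K\<^esub>"

context group
begin

lemma lift_order3:
  assumes "\<And>s. h s \<in> carrier G" "\<And>s. h s \<otimes> h s \<otimes> h s = \<one>"
  shows "order3_action (\<lambda>s x. h s \<otimes> x) (carrier G)"
  by unfold_locales (use assms in \<open>simp_all flip: m_assoc\<close>)

lemma freeprod_lift_mult:
  assumes "\<And>s. h s \<in> carrier G" "\<And>s. h s \<otimes> h s \<otimes> h s = \<one>" "y \<in> carrier G"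
  shows "word_act (\<lambda>s x. h s \<otimes> x) w y = freeprod_lift G h w \<otimes> y"
proof -
  interpret order3_action "\<lambda>s x. h s \<otimes> x" "carrier G"
    by (rule lift_order3) (use assms in auto)
  show ?thesis unfolding freeprod_lift_def
    by (induction w) (use assms word_act_closed in \<open>auto simp: letter_act_def m_assoc\<close>)
qed

lemma freeprod_lift_hom:
  assumes "\<And>s. h s \<in> carrier G" "\<And>s. h s \<otimes> h s \<otimes> h s = \<one>"
  shows "freeprod_lift G h \<in> hom freeprod G"
proof -
  interpret order3_action "\<lambda>s x. h s \<otimes> x" "carrier G"
    by (rule lift_order3) (use assms in auto)
  show ?thesis
  proof (rule homI)
    fix x y
    show "freeprod_lift G h x \<in> carrier G"
      by (simp add: freeprod_lift_def word_act_closed)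
    show "freeprod_lift G h (x \<cdot> y) = freeprod_lift G h x \<otimes> freeprod_lift G h y"
    proof -
      let ?g = "\<lambda>s x. h s \<otimes> x"
      have "freeprod_lift G h (x \<cdot> y) = word_act ?g x (freeprod_lift G h y)"
        by (simp add: freeprod_lift_def word_act_mult)
      also have "\<dots> = freeprod_lift G h x \<otimes> freeprod_lift G h y"
        by (rule freeprod_lift_mult) (use assms in \<open>auto simp: freeprod_lift_def word_act_closed\<close>)
      finally show ?thesis .
    qed
  qed
qed

lemma freeprod_lift_gen:
  "h s \<in> carrier G \<Longrightarrow> freeprod_lift G h [(s, False)] = h s"
  by (simp add: freeprod_lift_def letter_act_def)

end

lemma hom_freeprod_eq:
  assumes "group K" "\<phi> \<in> hom freeprod K" "\<psi> \<in> hom freeprod K"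
    and eq: "\<And>s. \<phi> [(s, False)] = \<psi> [(s, False)]" and "reduced w"
  shows "\<phi> w = \<psi> w"
  using \<open>reduced w\<close>
proof (induction w)
  case Nil
  show ?case using hom_one[OF assms(2) group_freeprod assms(1)] hom_one[OF assms(3) group_freeprod assms(1)] by simp
next
  case (Cons l w)
  obtain s e where l: "l = (s, e)" by force
  have r: "reduced w" using Cons.prems by (auto simp: distinct_adj_Cons)
  have "w = [] \<or> fst (hd w) \<noteq> s"
    using Cons.prems l by (auto simp: distinct_adj_Cons hd_map)
  then have lw: "l # w = [l] \<cdot> w"
    using l by (simp add: letter_act_step_append)
  have "[(s, True)] = [(s, False)] \<cdot> [(s, False)]"
    by (simp add: letter_act_def)
  then have "\<phi> [(s, True)] = \<psi> [(s, True)]"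
    using hom_mult[OF assms(2), of "[(s, False)]" "[(s, False)]"]
      hom_mult[OF assms(3), of "[(s, False)]" "[(s, False)]"] eq by simp
  then have "\<phi> [l] = \<psi> [l]" using eq l by (cases e) auto
  then show ?case
    unfolding lw using hom_mult[OF assms(2), of "[l]" w] hom_mult[OF assms(3), of "[l]" w] Cons.IH r
    by simp
qed

section \<open>Conjugacy, torsion and centre of the free product\<close>

lemma (in group) conj_one_iff:
  assumes "g \<in> carrier G" "c \<in> carrier G"
  shows "g \<otimes> c \<otimes> inv g = \<one> \<longleftrightarrow> c = \<one>"
proof
  assume "g \<otimes> c \<otimes> inv g = \<one>"
  then have "inv (inv g) = g \<otimes> c" using assms by (intro inv_equality) auto
  then have "g \<otimes> c = g" using assms by (metis inv_inv)
  then show "c = \<one>" using assms l_cancel_one by blast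
qed (use assms in simp)

lemma (in group) conj_mult:
  assumes "g \<in> carrier G" "c \<in> carrier G" "d \<in> carrier G"
  shows "(g \<otimes> c \<otimes> inv g) \<otimes> (g \<otimes> d \<otimes> inv g) = g \<otimes> (c \<otimes> d) \<otimes> inv g"
proof -
  have "inv g \<otimes> (g \<otimes> (d \<otimes> inv g)) = d \<otimes> inv g"
    using assms by (simp flip: m_assoc)
  then show ?thesis using assms by (simp add: m_assoc)
qed

lemma (in group) conj_conj:
  assumes "g \<in> carrier G" "c \<in> carrier G" "d \<in> carrier G"
  shows "g \<otimes> (d \<otimes> c \<otimes> inv d) \<otimes> inv g = (g \<otimes> d) \<otimes> c \<otimes> inv (g \<otimes> d)"
  using assms by (simp add: m_assoc inv_mult_group)

lemma (in group) conj_rotate: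
  assumes "a \<in> carrier G" "b \<in> carrier G" "v \<in> carrier G"
  shows "a \<otimes> (v \<otimes> b) = a \<otimes> (v \<otimes> (b \<otimes> a)) \<otimes> inv a"
  using assms by (simp add: m_assoc)

text \<open>Cyclic reduction: as long as both ends of a longer word lie in the same factor,
  conjugation by the first letter merges them and shortens the word.\<close>

lemma freeprod_conj_cases:
  assumes "reduced w"
  shows "\<exists>g c. reduced g \<and> reduced c \<and> (length c \<le> 1 \<or> fst (hd c) \<noteq> fst (last c)) \<and>
       w = g \<cdot> c \<cdot> finv g"
  using assms
proof (induction w rule: length_induct)
  case (1 w)
  consider "length w \<le> 1 \<or> fst (hd w) \<noteq> fst (last w)" | s e v e' where "w = (s, e) # v @ [(s, e')]"
  proof (cases w)
    case (Cons l v)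
    obtain s e where l: "l = (s, e)" by force
    show ?thesis
    proof (cases v rule: rev_cases)
      case Nil
      then show ?thesis using that(1) Cons by simp
    next
      case (snoc v' l')
      obtain s' e' where l': "l' = (s', e')" by force
      show ?thesis using that(1) that(2)[of s e v' e'] Cons snoc l l' by (cases "s = s'") simp_all
    qed
  qed (use that(1) in simp)
  then show ?case
  proof cases
    case 1
    have eq: "w = [] \<cdot> w \<cdot> finv []"
      using \<open>reduced w\<close> F.r_one[of w] by (simp add: inv_freeprod)
    show ?thesis
      by (rule exI[of _ "[]"], rule exI[of _ w], intro conjI, simp, fact, fact, fact eq)
  next
    case 2
    let ?a = "[(s, e)]" and ?b = "[(s, e')]"
    let ?w' = "v \<cdot> (?b \<cdot> ?a)"
    have v: "reduced (v @ ?b)" "reduced v" using \<open>reduced w\<close> 2 by (auto simp: distinct_adj_Cons)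
    \<comment> \<open>The first letter, moved to the end, meets the last one in the same factor, and
      at most one letter is left of the two.\<close>
    have "?w' = v @ word_act step ?b ?a"
      using word_act_step_append[of v "word_act step ?b ?a"] v
      by (auto simp: letter_act_def distinct_adj_append_iff)
    then have len: "length ?w' < length w"
      using 2 by (auto simp: letter_act_def)
    have "?w' \<in> carrier freeprod" by (intro F.m_closed) (use v in auto)
    then have r': "reduced ?w'" by (rule freeprod_simps(1)[THEN iffD1])
    have eq: "?a \<cdot> (v \<cdot> ?b) = w"
      using \<open>reduced w\<close> 2 word_act_step_append[of ?a "v @ ?b"] word_act_step_append[OF v(1)] by simp
    have conj: "w = ?a \<cdot> ?w' \<cdot> finv ?a"
      unfolding eq[symmetric] by (rule F.conj_rotate) (use v in auto)
    obtain g c where gc: "reduced g" "reduced c"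
      "length c \<le> 1 \<or> fst (hd c) \<noteq> fst (last c)"
      "?w' = g \<cdot> c \<cdot> finv g"
      using 1(1)[rule_format, OF len r'] by (elim exE conjE)
    have "w = (?a \<cdot> g) \<cdot> c \<cdot> finv (?a \<cdot> g)"
      unfolding conj gc(4) by (rule F.conj_conj) (use gc(1,2) in auto)
    moreover have "reduced (?a \<cdot> g)"
      using F.m_closed[of ?a g] gc(1) by simp
    ultimately show ?thesis using gc(2,3) by (intro exI[of _ "?a \<cdot> g"] exI[of _ c] conjI)
  qed
qed

text \<open>With its ends in different factors, copies of \<open>c\<close> concatenate without
  cancellation. Such a \<open>c\<close> has neither square nor cube 1, so torsion of order 2 or 3
  can only come from single letters.\<close>

lemma freeprod_pow_cyc_reduced:
  assumes "reduced c" "c \<noteq> []" "fst (hd c) \<noteq> fst (last c)"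
  shows "c \<cdot> c = c @ c" "c \<cdot> c \<cdot> c = c @ c @ c"
proof -
  have r2: "reduced (c @ c)" and r3: "reduced (c @ c @ c)"
    using assms by (auto simp: distinct_adj_append_iff hd_map last_map hd_append)
  show "c \<cdot> c = c @ c" using word_act_step_append[OF r2] by simp
  show "c \<cdot> c \<cdot> c = c @ c @ c"
    using word_act_step_append[OF r2] word_act_step_append[OF r3] F.m_assoc[of c c c] assms by simp
qed

lemma freeprod_no_involution:
  assumes "reduced w" "w \<cdot> w = []"
  shows "w = []"
proof -
  obtain g c where gc: "reduced g" "reduced c" "length c \<le> 1 \<or> fst (hd c) \<noteq> fst (last c)"
    and w: "w = g \<cdot> c \<cdot> finv g"
    using freeprod_conj_cases[OF assms(1)] by blast
  have "w \<cdot> w = g \<cdot> (c \<cdot> c) \<cdot> finv g"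
    unfolding w by (rule F.conj_mult) (use gc in auto)
  then have cc: "c \<cdot> c = []"
    using assms(2) F.conj_one_iff[of g "c \<cdot> c"] F.m_closed[of c c] gc by simp
  have "c = []"
  proof (rule ccontr)
    assume "c \<noteq> []"
    show False
    proof (cases "length c \<le> 1")
      case True
      with \<open>c \<noteq> []\<close> obtain s e where "c = [(s, e)]" by (cases c) auto
      then show False using cc by (auto simp: letter_act_def split: if_splits)
    next
      case False
      then show False using freeprod_pow_cyc_reduced[of c] gc \<open>c \<noteq> []\<close> cc by auto
    qed
  qed
  then show ?thesis using w gc(1) F.conj_one_iff[of g c] by simp
qed

lemma freeprod_order3:
  assumes "reduced w" "w \<noteq> []" "w \<cdot> w \<cdot> w = []"
  shows "\<exists>g l. reduced g \<and> w = g \<cdot> [l] \<cdot> finv g"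
proof -
  obtain g c where gc: "reduced g" "reduced c" "length c \<le> 1 \<or> fst (hd c) \<noteq> fst (last c)"
    and w: "w = g \<cdot> c \<cdot> finv g"
    using freeprod_conj_cases[OF assms(1)] by blast
  have "w \<cdot> w \<cdot> w = g \<cdot> (c \<cdot> c \<cdot> c) \<cdot> finv g"
    unfolding w using gc F.conj_mult[of g c c] F.conj_mult[of g "c \<cdot> c" c] F.m_closed[of c c]
    by (simp del: freeprod_simps(2))
  then have ccc: "c \<cdot> c \<cdot> c = []"
    using assms(3) F.conj_one_iff[of g "c \<cdot> c \<cdot> c"] F.m_closed[of c c]
      F.m_closed[of "c \<cdot> c" c] gc by simp
  have "c \<noteq> []" using assms(2) w gc(1) F.conj_one_iff[of g c] by auto
  moreover have "length c \<le> 1"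
    using freeprod_pow_cyc_reduced[of c] gc \<open>c \<noteq> []\<close> ccc by auto
  ultimately obtain l where "c = [l]" by (cases c) auto
  then show ?thesis using gc(1) w by blast
qed

text \<open>The product \<open>[s] w\<close> is longer than \<open>w\<close> and begins with
  \<open>s\<close>. If \<open>w\<close> ends in the factor of \<open>s\<close>, then
  \<open>w [s]\<close> is no longer than \<open>w\<close>; otherwise \<open>w [s]\<close> begins
  like \<open>w\<close>.\<close>

lemma freeprod_commute_letter:
  assumes "reduced w" "w \<noteq> []" "fst (hd w) \<noteq> s"
  shows "w \<cdot> [(s, False)] \<noteq> [(s, False)] \<cdot> w"
proof
  let ?l = "[(s, False)]"
  assume "w \<cdot> ?l = ?l \<cdot> w"
  moreover have "?l \<cdot> w = (s, False) # w"
    using assms by (simp add: letter_act_step_append)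
  ultimately have eq: "w \<cdot> ?l = (s, False) # w" by simp
  show False
  proof (cases "fst (last w) = s")
    case False
    then have "word_act step w ?l = w @ ?l"
      using assms by (intro word_act_step_append) (auto simp: distinct_adj_append_iff last_map)
    then have "hd (w @ ?l) = (s, False)" using eq by simp
    then show False using assms by simp
  next
    case True
    then obtain v e where w: "w = v @ [(s, e)]"
      using assms(2) by (cases w rule: rev_cases) force+
    have red: "reduced (v @ [(s, e)])" using assms(1) w by simp
    have "word_act step w ?l = word_act step v (word_act step [(s, e)] ?l)"
      unfolding w by simp
    also have "\<dots> = v @ word_act step [(s, e)] ?l"
      using red by (intro word_act_step_append) (auto simp: letter_act_def distinct_adj_append_iff)
    finally have "length (word_act step w ?l) \<le> length w"
      using w by (simp add: letter_act_def)
    then show False using eq by simp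
  qed
qed

lemma freeprod_centre:
  assumes "reduced w"
    and "\<And>s. w \<cdot> [(s, False)] = [(s, False)] \<cdot> w"
  shows "w = []"
proof (rule ccontr)
  assume "w \<noteq> []"
  moreover have "fst (hd w) \<noteq> (\<not> fst (hd w))" by simp
  ultimately show False
    using freeprod_commute_letter[OF assms(1)] assms(2) by blast
qed

text \<open>A nonempty \<open>q\<close> begins with a power of \<open>v\<close> and ends with a
  power of \<open>u\<close>, so \<open>q v^e q^-1\<close> is reduced as written and has both ends in
  the factor of \<open>v\<close>. The images of the letters of a reduced word therefore concatenate
  without cancellation.\<close>

lemma freeprod_block_hom:
  assumes q: "reduced q" "q = [] \<or> fst (hd q) \<and> \<not> fst (last q)"
    and hom: "\<psi> \<in> hom freeprod freeprod"
    and u: "\<psi> [(False, False)] = [(False, False)]"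
    and v: "\<psi> [(True, False)] = q \<cdot> [(True, False)] \<cdot> finv q"
    and w: "reduced w"
  defines "blk \<equiv> \<lambda>l. if fst l then q @ [l] @ winv q else [l]"
  shows "\<psi> w = concat (map blk w)"
proof -
  have blk_red: "reduced (blk l)" for l
    using q by (auto simp: blk_def distinct_adj_append_iff last_map hd_map fst_hd_winv fst_last_winv distinct_adj_Cons)
  have blk_hd: "blk l \<noteq> []" "fst (hd (blk l)) = fst l" "fst (last (blk l)) = fst l" for l
    using q by (auto simp: blk_def hd_append last_append fst_last_winv)
  have conj_q: "q \<cdot> [(True, e)] \<cdot> finv q = blk (True, e)" for e
  proof -
    have r: "reduced (q @ [(True, e)] @ winv q)" using blk_red[of "(True, e)"] by (simp add: blk_def)
    then have "reduced ([(True, e)] @ winv q)" by (auto simp: distinct_adj_append_iff)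
    then have 1: "[(True, e)] \<cdot> winv q = [(True, e)] @ winv q"
      using word_act_step_append[of "[(True, e)]" "winv q"] by simp
    have "q \<cdot> ([(True, e)] \<cdot> winv q) = q @ [(True, e)] @ winv q"
      unfolding 1 using word_act_step_append[OF r] by simp
    then show ?thesis
      using F.m_assoc[of q "[(True, e)]" "winv q"] q(1) by (simp add: blk_def inv_freeprod)
  qed
  have sq: "[(s, True)] = [(s, False)] \<cdot> [(s, False)]" for s
    by (simp add: letter_act_def)
  have sq': "\<psi> [(s, True)] = \<psi> [(s, False)] \<cdot> \<psi> [(s, False)]" for s
    unfolding sq by (rule hom_mult[OF hom]) auto
  have letter: "\<psi> [l] = blk l" for l
  proof -
    obtain s e where l: "l = (s, e)" by force
    have "\<psi> [(True, True)] = q \<cdot> ([(True, False)] \<cdot> [(True, False)]) \<cdot> finv q"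
      unfolding sq' v by (rule F.conj_mult) (use q in auto)
    then have "\<psi> [(True, True)] = blk (True, True)"
      unfolding sq[symmetric] conj_q .
    moreover have "\<psi> [(False, True)] = [(False, True)]"
      by (simp add: sq' u letter_act_def)
    ultimately show ?thesis using u v conj_q[of False] l by (cases s; cases e) (auto simp: blk_def)
  qed
  have "\<psi> w = concat (map blk w) \<and> reduced (concat (map blk w)) \<and>
    (w = [] \<or> concat (map blk w) \<noteq> [] \<and> fst (hd (concat (map blk w))) = fst (hd w))"
    using w
  proof (induction w)
    case Nil
    show ?case using hom_one[OF hom group_freeprod group_freeprod] by simp
  next
    case (Cons l w)
    have r: "reduced w" using Cons.prems by (auto simp: distinct_adj_Cons)
    have ne: "w = [] \<or> fst (hd w) \<noteq> fst l"
      using Cons.prems by (auto simp: distinct_adj_Cons hd_map)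
    then have lw: "[l] \<cdot> w = l # w"
      using letter_act_step_append[of w "fst l" "snd l"] by simp
    have IH: "\<psi> w = concat (map blk w)" "reduced (concat (map blk w))"
      "w = [] \<or> concat (map blk w) \<noteq> [] \<and> fst (hd (concat (map blk w))) = fst (hd w)"
      using Cons.IH r by blast+
    define z where "z = concat (map blk w)"
    have zw: "z = []" if "w = []" using that by (simp add: z_def)
    have "reduced (blk l @ z)"
      using IH(2,3)[folded z_def] ne blk_red[of l] blk_hd[of l]
      by (cases "w = []") (auto simp: distinct_adj_append_iff last_map hd_map zw)
    then have red: "reduced (blk l @ concat (map blk w))" by (simp add: z_def)
    have "\<psi> (l # w) = \<psi> [l] \<cdot> \<psi> w"
      unfolding lw[symmetric] by (rule hom_mult[OF hom]) (use r in auto)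
    also have "\<dots> = blk l @ concat (map blk w)"
      unfolding letter IH(1) using word_act_step_append[OF red] by simp
    finally show ?case using red blk_hd[of l] by simp
  qed
  then show ?thesis by blast
qed

text \<open>Conjugation by a power of \<open>u\<close> fixes \<open>u\<close>, and powers of
  \<open>v\<close> commute with \<open>v\<close>; so both can be stripped off \<open>p\<close>. For
  the remaining middle part \<open>q\<close>, the block form of the images shows that
  \<open>v\<close> is missed unless \<open>q\<close> is empty.\<close>

lemma freeprod_conj_surj:
  assumes p: "reduced p" and hom: "\<phi> \<in> hom freeprod freeprod"
    and u: "\<phi> [(False, False)] = [(False, False)]"
    and v: "\<phi> [(True, False)] = p \<cdot> [(True, False)] \<cdot> finv p"
    and surj: "carrier freeprod \<subseteq> \<phi> ` carrier freeprod"
  shows "\<exists>a. reduced a \<and> a \<cdot> [(False, False)] = [(False, False)] \<cdot> a \<and>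
    \<phi> [(True, False)] = a \<cdot> [(True, False)] \<cdot> finv a"
proof -
  \<comment> \<open>The splitting \<open>p = a q b\<close>, where \<open>a\<close> is a power of
    \<open>u\<close> and \<open>b\<close> a power of \<open>v\<close>.\<close>
  define a where "a = takeWhile (\<lambda>l. \<not> fst l) p"
  define p' where "p' = dropWhile (\<lambda>l. \<not> fst l) p"
  define b where "b = rev (takeWhile fst (rev p'))"
  define q where "q = rev (dropWhile fst (rev p'))"
  have pa: "p = a @ p'" by (simp add: a_def p'_def)
  have pq: "p' = q @ b"
    unfolding q_def b_def rev_append[symmetric] takeWhile_dropWhile_id by simp
  have red: "reduced a" "reduced b" "reduced q" "reduced (a @ q @ b)" "reduced (q @ b)"
    using p pa pq by auto
  have single: "length x \<le> 1" if "reduced x" "\<forall>l\<in>set x. fst l = s" for x :: fword and s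
    using that by (cases x; cases "tl x") auto
  have a: "a = [] \<or> (\<exists>e. a = [(False, e)])"
  proof -
    have "\<forall>l\<in>set a. fst l = False" by (auto simp: a_def dest: set_takeWhileD)
    then show ?thesis using single[of a False] red(1) by (cases a) auto
  qed
  have b: "b = [] \<or> (\<exists>e. b = [(True, e)])"
  proof -
    have "\<forall>l\<in>set b. fst l = True" by (auto simp: b_def dest: set_takeWhileD)
    then show ?thesis using single[of b True] red(2) by (cases b) auto
  qed
  have q: "q = [] \<or> fst (hd q) \<and> \<not> fst (last q)"
  proof (cases "q = []")
    case False
    then have "p' \<noteq> []" using pq by simp
    then have "fst (hd p')" using hd_dropWhile[of "\<lambda>l. \<not> fst l" p] by (simp add: p'_def)
    moreover have "\<not> fst (hd (dropWhile fst (rev p')))"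
      using False hd_dropWhile[of fst "rev p'"] by (simp add: q_def)
    moreover have "hd p' = hd q" unfolding pq by (rule hd_append2) (rule False)
    moreover have "last q = hd (dropWhile fst (rev p'))"
      unfolding q_def by (rule last_rev)
    ultimately show ?thesis by simp
  qed simp
  have acomm: "a \<cdot> [(False, False)] = [(False, False)] \<cdot> a"
    using a by (auto simp: letter_act_def)
  have bcomm: "b \<cdot> [(True, False)] = [(True, False)] \<cdot> b"
    using b by (auto simp: letter_act_def)
  have bconj: "b \<cdot> [(True, False)] \<cdot> finv b = [(True, False)]"
    unfolding bcomm by (rule F.inv_solve_right'[THEN iffD2]) (use red F.m_closed[of "[(True, False)]" b] in auto)
  have qb: "q \<cdot> b = q @ b" using word_act_step_append[OF red(5)] by simp
  have "p = a \<cdot> (q \<cdot> b)"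
    unfolding qb using word_act_step_append[OF red(4)] pa pq by simp
  then have "\<phi> [(True, False)] = (a \<cdot> (q \<cdot> b)) \<cdot> [(True, False)] \<cdot>
      finv (a \<cdot> (q \<cdot> b))"
    using v by simp
  also have "\<dots> = a \<cdot> ((q \<cdot> b) \<cdot> [(True, False)] \<cdot> finv (q \<cdot> b)) \<cdot> finv a"
    by (rule F.conj_conj[symmetric]) (use red qb in auto)
  also have "(q \<cdot> b) \<cdot> [(True, False)] \<cdot> finv (q \<cdot> b) =
      q \<cdot> (b \<cdot> [(True, False)] \<cdot> finv b) \<cdot> finv q"
    by (rule F.conj_conj[symmetric]) (use red in auto)
  also note bconj
  finally have v': "\<phi> [(True, False)] = a \<cdot> (q \<cdot> [(True, False)] \<cdot> finv q) \<cdot> finv a" .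
  \<comment> \<open>Undoing the conjugation by \<open>a\<close> keeps \<open>u\<close> fixed and
    sends \<open>v\<close> to its conjugate by \<open>q\<close>, the situation of
    \<open>freeprod_block_hom\<close>.\<close>
  define \<psi> where "\<psi> w = finv a \<cdot> \<phi> w \<cdot> finv (finv a)" for w
  have ac: "a \<in> carrier freeprod" "finv a \<in> carrier freeprod"
    using red(1) F.inv_closed[of a] by auto
  have \<phi>c: "\<phi> w \<in> carrier freeprod" if "w \<in> carrier freeprod" for w
    using hom_in_carrier[OF hom that] .
  have \<psi>: "\<psi> \<in> hom freeprod freeprod"
  proof (rule homI)
    fix x y assume xy: "x \<in> carrier freeprod" "y \<in> carrier freeprod"
    show "\<psi> x \<in> carrier freeprod"
      unfolding \<psi>_def by (intro F.m_closed F.inv_closed ac \<phi>c xy)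
    show "\<psi> (x \<cdot> y) = \<psi> x \<cdot> \<psi> y"
      unfolding \<psi>_def hom_mult[OF hom xy] by (rule F.conj_mult[symmetric]) (intro ac \<phi>c xy)+
  qed
  have unconj: "finv a \<cdot> (a \<cdot> z \<cdot> finv a) \<cdot> finv (finv a) = z"
    if "z \<in> carrier freeprod" for z
    by (subst F.conj_conj) (use ac that in \<open>auto simp del: freeprod_simps\<close>)
  have \<psi>u: "\<psi> [(False, False)] = [(False, False)]"
  proof -
    have e: "a \<cdot> [(False, False)] \<cdot> finv a = [(False, False)]"
      unfolding acomm by (rule F.inv_solve_right'[THEN iffD2]) (use red F.m_closed[of "[(False, False)]" a] in auto)
    show ?thesis unfolding \<psi>_def u by (rule unconj[of "[(False, False)]", unfolded e]) simp
  qed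
  have \<psi>v: "\<psi> [(True, False)] = q \<cdot> [(True, False)] \<cdot> finv q"
    unfolding \<psi>_def v' by (rule unconj) (intro F.m_closed F.inv_closed, use red in auto)
  have "a \<cdot> [(True, False)] \<cdot> finv a \<in> carrier freeprod"
    by (intro F.m_closed F.inv_closed ac) auto
  from subsetD[OF surj this] obtain w where w: "w \<in> carrier freeprod" "\<phi> w = a \<cdot> [(True, False)] \<cdot> finv a"
    by (elim imageE) (rule that, simp_all only:)
  have "\<psi> w = [(True, False)]"
    unfolding \<psi>_def w(2) by (rule unconj) auto
  then have eq: "concat (map (\<lambda>l. if fst l then q @ [l] @ winv q else [l]) w) = [(True, False)]"
    using freeprod_block_hom[OF red(3) q \<psi> \<psi>u \<psi>v, of w] w(1) by simp
  \<comment> \<open>A preimage of \<open>v\<close> cannot begin with a power of \<open>u\<close>,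
    and a block of \<open>v\<close> has length \<open>2 * length q + 1\<close>.\<close>
  have "q = []"
  proof (cases w)
    case (Cons l w')
    then show ?thesis using eq by (cases "fst l") (auto simp: append_eq_Cons_conv)
  qed (use eq in simp)
  then have "\<phi> [(True, False)] = a \<cdot> [(True, False)] \<cdot> finv a"
    using v' by (simp add: inv_freeprod letter_act_def)
  then show ?thesis using acomm red(1) by blast
qed

section \<open>Finite permutation actions on balls of the free product\<close>

definition tstep :: "nat \<Rightarrow> bool \<Rightarrow> fword \<Rightarrow> fword" where
  "tstep n s w = (if length w = n \<and> (w = [] \<or> fst (hd w) \<noteq> s) then w else step s w)"

text \<open>A coset \<open><s> w\<close> that meets the ball of radius \<open>n\<close> does so in
  all three points or, at the boundary, in exactly one. In the latter case \<open>tstep\<close>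
  fixes that point, so its cube is still the identity.\<close>

lemma tstep_order3: "order3_action (tstep n) {w. reduced w \<and> length w \<le> n}"
proof
  define P where "P s w \<longleftrightarrow> \<not> (length w = n \<and> (w = [] \<or> fst (hd w) \<noteq> s))" for s and w :: fword
  have eq: "tstep n s w = (if P s w then step s w else w)" for s w
    by (simp only: tstep_def P_def split: if_split) blast
  have len: "length (step s w) \<le> n" if "P s w" "length w \<le> n" for s w
    using that by (cases w) (auto simp: P_def split: if_splits)
  have P: "P s (step s w)" if "P s w" "length w \<le> n" for s w
    using that by (cases w) (auto simp: P_def split: if_splits)
  fix w s
  assume w: "w \<in> {w. reduced w \<and> length w \<le> n}"
  show "tstep n s w \<in> {w. reduced w \<and> length w \<le> n}"
    using w step.closed[of w s] len[of s w] by (simp add: eq)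
  show "tstep n s (tstep n s (tstep n s w)) = w"
    using w step.cube[of w s] P[of s w] P[of s "step s w"] len[of s w] by (simp add: eq)
qed

text \<open>Building \<open>w\<close> up from the right never leaves the ball, so this finite action
  tells a nonempty \<open>w\<close> from the identity.\<close>

lemma word_act_tstep: "reduced w \<Longrightarrow> length w \<le> n \<Longrightarrow> word_act (tstep n) w [] = w"
proof (induction w)
  case (Cons l w)
  obtain s e where l: "l = (s, e)" by force
  have "w = [] \<or> fst (hd w) \<noteq> s"
    using Cons.prems l by (auto simp: distinct_adj_Cons hd_map)
  then have "letter_act (tstep n) l w = l # w"
    using Cons.prems l by (cases w) (auto simp: letter_act_def tstep_def)
  then show ?case using Cons by (auto simp: distinct_adj_Cons)
qed simp

section \<open>Finitely generated and residually finite groups, outer automorphisms\<close>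

lemma finitely_generated_iso:
  assumes "group G" "group H" "G \<cong> H" "finitely_generated G"
  shows "finitely_generated H"
proof -
  obtain h where h: "h \<in> iso G H" using assms(3) by (auto simp: is_iso_def)
  interpret h: group_hom G H h
    using h assms(1,2) by (auto simp: group_hom_def group_hom_axioms_def iso_def)
  obtain S where S: "finite S" "S \<subseteq> carrier G" "generate G S = carrier G"
    using assms(4) by (auto simp: finitely_generated_def)
  have "generate H (h ` S) = carrier H"
    using h.generate_img[OF S(2)] S(3) h by (simp add: iso_def bij_betw_def)
  then show ?thesis unfolding finitely_generated_def
    by (intro exI[of _ "h ` S"]) (use S in auto)
qed

lemma residually_finite_iso:
  assumes "group G" "group H" "G \<cong> H" "residually_finite G"
  shows "residually_finite H"
  unfolding residually_finite_def
proof
  fix x assume x: "x \<in> carrier H - {\<one>\<^bsub>H\<^esub>}"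
  have "H \<cong> G" using assms(1,3) by (simp add: group.iso_sym)
  then obtain k where k: "k \<in> iso H G" by (auto simp: is_iso_def)
  then interpret k: group_hom H G k
    using assms(1,2) by (auto simp: group_hom_def group_hom_axioms_def iso_def)
  have inj: "inj_on k (carrier H)" using k by (auto simp: iso_def bij_betw_def)
  have "k x \<noteq> \<one>\<^bsub>G\<^esub>"
    using inj_onD[OF inj, of x "\<one>\<^bsub>H\<^esub>"] x by auto
  then have "k x \<in> carrier G - {\<one>\<^bsub>G\<^esub>}" using x by simp
  then obtain F :: "nat monoid" and \<phi> where
    F: "group F" "finite (carrier F)" "\<phi> \<in> hom G F" "\<phi> (k x) \<noteq> \<one>\<^bsub>F\<^esub>"
    using bspec[OF assms(4)[unfolded residually_finite_def]] by blast
  have "\<phi> \<circ> k \<in> hom H F" using F(3) k.homh by (rule hom_compose[rotated])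
  then show "\<exists>(F :: nat monoid) \<phi>. group F \<and> finite (carrier F) \<and> \<phi> \<in> hom H F \<and> \<phi> x \<noteq> \<one>\<^bsub>F\<^esub>"
    using F by (intro exI[of _ F] exI[of _ "\<phi> \<circ> k"]) auto
qed

lemma (in group) countable_generate:
  assumes "finite S"
  shows "countable (generate G S)"
proof -
  define T where "T = rec_nat (insert \<one> (S \<union> m_inv G ` S)) (\<lambda>_ A. A \<union> (\<lambda>(x, y). x \<otimes> y) ` (A \<times> A))"
  have T: "T 0 = insert \<one> (S \<union> m_inv G ` S)" "T (Suc n) = T n \<union> (\<lambda>(x, y). x \<otimes> y) ` (T n \<times> T n)" for n
    by (simp_all add: T_def)
  have fin: "finite (T n)" for n
    by (induction n) (use assms in \<open>auto simp: T\<close>)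
  have mono: "T n \<subseteq> T m" if "n \<le> m" for n m
    using that by (induction m rule: dec_induct) (auto simp: T)
  have "x \<in> (\<Union>n. T n)" if "x \<in> generate G S" for x
    using that
  proof induction
    case (eng h1 h2)
    then obtain n m where "h1 \<in> T n" "h2 \<in> T m" by blast
    then have "h1 \<in> T (max n m)" "h2 \<in> T (max n m)"
      using mono[of n "max n m"] mono[of m "max n m"] by auto
    then have "h1 \<otimes> h2 \<in> T (Suc (max n m))" by (force simp: T)
    then show ?case by blast
  qed (use T(1) in blast)+
  moreover have "countable (\<Union>n. T n)" by (intro countable_UN) (auto simp: fin countable_finite)
  ultimately show ?thesis by (meson countable_subset subsetI)
qed

lemma finitely_generated_countable:
  "group G \<Longrightarrow> finitely_generated G \<Longrightarrow> countable (carrier G)"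
  using group.countable_generate by (metis finitely_generated_def)

lemma (in group) iso_transport:
  fixes f :: "'a \<Rightarrow> 'c"
  assumes "inj_on f (carrier G)"
  shows "\<exists>H :: 'c monoid. carrier H = f ` carrier G \<and> group H \<and> f \<in> iso G H"
proof -
  define g where "g = inv_into (carrier G) f"
  have g: "g (f x) = x" if "x \<in> carrier G" for x
    using assms that by (simp add: g_def)
  define H :: "'c monoid" where
    "H = \<lparr>carrier = f ` carrier G, mult = (\<lambda>x y. f (g x \<otimes> g y)), one = f \<one>\<rparr>"
  have "group H"
    by (rule groupI) (auto simp: H_def g m_assoc intro!: bexI[of _ "inv _"])
  moreover have "f \<in> iso G H"
    using assms by (auto simp: iso_def hom_def H_def g bij_betw_def)
  ultimately show ?thesis by (intro exI[of _ H]) (simp add: H_def)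
qed

lemma nat_monoid_iso:
  assumes "group G" "countable (carrier G)"
  shows "\<exists>H :: nat monoid. group H \<and> G \<cong> H"
proof -
  obtain f :: "'a \<Rightarrow> nat" where "inj_on f (carrier G)"
    using assms(2) by (auto simp: countable_def)
  from group.iso_transport[OF assms(1) this] show ?thesis by (auto simp: is_iso_def)
qed

text \<open>A left congruence of finite index separating \<open>g\<close> from \<open>1\<close> is as good as a finite quotient:
  \<open>G\<close> permutes its classes.\<close>

lemma (in group) finite_quotient_of_congruence:
  fixes \<Theta> :: "'a \<Rightarrow> 'k"
  assumes "finite (\<Theta> ` carrier G)" "g \<in> carrier G" "\<Theta> g \<noteq> \<Theta> \<one>\<^bsub>G\<^esub>"
    and cong: "\<And>h x y. \<lbrakk>h \<in> carrier G; x \<in> carrier G; y \<in> carrier G; \<Theta> x = \<Theta> y\<rbrakk> \<Longrightarrow>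
      \<Theta> (h \<otimes>\<^bsub>G\<^esub> x) = \<Theta> (h \<otimes>\<^bsub>G\<^esub> y)"
  shows "\<exists>(F :: nat monoid) \<phi>. group F \<and> finite (carrier F) \<and> \<phi> \<in> hom G F \<and> \<phi> g \<noteq> \<one>\<^bsub>F\<^esub>"
proof -
  define D where "D = \<Theta> ` carrier G"
  define r where "r = inv_into (carrier G) \<Theta>"
  have r: "r d \<in> carrier G" "\<Theta> (r d) = d" if "d \<in> D" for d
    using that by (auto simp: r_def D_def inv_into_into f_inv_into_f)
  define \<alpha> where "\<alpha> h = (\<lambda>d\<in>D. \<Theta> (h \<otimes> r d))" for h
  have \<alpha>\<Theta>: "\<alpha> h (\<Theta> x) = \<Theta> (h \<otimes> x)" if "h \<in> carrier G" "x \<in> carrier G" for h x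
    using that cong[of h "r (\<Theta> x)" x] r[of "\<Theta> x"] by (simp add: \<alpha>_def D_def)
  have \<alpha>D: "\<alpha> h d \<in> D" if "h \<in> carrier G" "d \<in> D" for h d
    using that \<alpha>\<Theta>[of h "r d"] r[of d] by (auto simp: D_def)
  have comp: "\<alpha> h (\<alpha> k d) = \<alpha> (h \<otimes> k) d" if "h \<in> carrier G" "k \<in> carrier G" "d \<in> D" for h k d
    using that \<alpha>\<Theta>[of k "r d"] \<alpha>\<Theta>[of h "k \<otimes> r d"] \<alpha>\<Theta>[of "h \<otimes> k" "r d"] r[of d] by (simp add: m_assoc)
  have one: "\<alpha> \<one> d = d" if "d \<in> D" for d
    using that \<alpha>\<Theta>[of \<one> "r d"] r[of d] by simp
  have Bij: "\<alpha> h \<in> Bij D" if "h \<in> carrier G" for h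
  proof -
    have "bij_betw (\<alpha> h) D D"
      by (rule bij_betw_byWitness[where f' = "\<alpha> (inv h)"]) (use that in \<open>auto simp: comp one \<alpha>D\<close>)
    then show ?thesis by (simp add: Bij_def \<alpha>_def)
  qed
  have hom: "\<alpha> \<in> hom G (BijGroup D)"
  proof (rule homI)
    fix x y assume xy: "x \<in> carrier G" "y \<in> carrier G"
    show "\<alpha> x \<in> carrier (BijGroup D)" using Bij xy by (simp add: BijGroup_def)
    have "\<alpha> (x \<otimes> y) = compose D (\<alpha> x) (\<alpha> y)"
      using xy comp by (auto simp: compose_def \<alpha>_def[of "x \<otimes> y"] restrict_def fun_eq_iff)
    then show "\<alpha> (x \<otimes> y) = \<alpha> x \<otimes>\<^bsub>BijGroup D\<^esub> \<alpha> y"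
      using Bij xy by (simp add: BijGroup_def)
  qed
  have fin: "finite (carrier (BijGroup D))"
  proof -
    have "carrier (BijGroup D) \<subseteq> D \<rightarrow>\<^sub>E D"
      by (auto simp: BijGroup_def Bij_def PiE_def bij_betw_def)
    then show ?thesis using assms(1) by (auto simp: D_def intro: finite_subset finite_PiE)
  qed
  have ne: "\<alpha> g \<noteq> \<one>\<^bsub>BijGroup D\<^esub>"
  proof
    assume "\<alpha> g = \<one>\<^bsub>BijGroup D\<^esub>"
    then have "\<alpha> g (\<Theta> \<one>) = \<Theta> \<one>" by (simp add: BijGroup_def D_def)
    then show False using \<alpha>\<Theta>[of g \<one>] assms(2,3) by simp
  qed
  obtain F :: "nat monoid" where F: "group F" "BijGroup D \<cong> F"
    using nat_monoid_iso[OF group_BijGroup countable_finite[OF fin]] by (elim exE conjE)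
  then obtain k where k: "k \<in> iso (BijGroup D) F" by (auto simp: is_iso_def)
  then interpret k: group_hom "BijGroup D" F k
    using F group_BijGroup[of D] by (auto simp: group_hom_def group_hom_axioms_def iso_def)
  have bij: "bij_betw k (carrier (BijGroup D)) (carrier F)" using k by (simp add: iso_def)
  have "k (\<alpha> g) \<noteq> \<one>\<^bsub>F\<^esub>"
  proof
    assume "k (\<alpha> g) = \<one>\<^bsub>F\<^esub>"
    then have "k (\<alpha> g) = k \<one>\<^bsub>BijGroup D\<^esub>" by simp
    then have "\<alpha> g = \<one>\<^bsub>BijGroup D\<^esub>"
      by (rule inj_onD[OF bij_betw_imp_inj_on[OF bij]])
        (rule hom_in_carrier[OF hom assms(2)], rule monoid.one_closed, rule group.is_monoid[OF group_BijGroup])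
    with ne show False ..
  qed
  moreover have "k \<circ> \<alpha> \<in> hom G F" by (rule Group.hom_compose[OF hom k.homh])
  moreover have "finite (carrier F)" using bij_betw_finite[OF bij] fin by simp
  ultimately show ?thesis using F(1) by (intro exI[of _ F] exI[of _ "k \<circ> \<alpha>"]) simp
qed

lemma (in group) finitely_generated_OutI:
  assumes "finite S" "S \<subseteq> auto G" "auto G \<subseteq> generate (AutoGroup G) (S \<union> inner_auto G)"
  shows "finitely_generated (Out G)"
proof -
  let ?A = "AutoGroup G" and ?N = "inner_auto G"
  interpret N: normal ?N ?A by (rule inner_auto_normal)
  interpret A: group ?A by (rule AutoGroup)
  let ?p = "\<lambda>x. ?N #>\<^bsub>?A\<^esub> x"
  interpret p: group_hom ?A "Out G" ?p
    using N.r_coset_hom_Mod group_Out AutoGroup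
    by (auto simp: Out_def group_hom_def group_hom_axioms_def)
  have gen: "generate ?A (S \<union> ?N) \<subseteq> carrier ?A"
    by (rule subgroup.subset[OF group.generate_is_subgroup[OF AutoGroup]])
      (use assms(2) N.subset in \<open>auto simp: carrier_AutoGroup\<close>)
  have sub: "subgroup (generate (Out G) (?p ` S)) (Out G)"
    using assms(2) by (intro group.generate_is_subgroup[OF group_Out]) (auto simp: carrier_AutoGroup)
  have "?p x \<in> generate (Out G) (?p ` S)" if "x \<in> generate ?A (S \<union> ?N)" for x
    using that
  proof induction
    case one
    then show ?case using subgroup.one_closed[OF sub] by simp
  next
    case (incl h)
    have "?p h = \<one>\<^bsub>Out G\<^esub>" if "h \<in> ?N"
      using that N.rcos_const[OF AutoGroup] by (simp add: Out_def)
    then show ?case using incl subgroup.one_closed[OF sub] by (auto intro: generate.incl)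
  next
    case (inv h)
    have hc: "h \<in> carrier ?A" using inv assms(2) N.subset by (auto simp: carrier_AutoGroup)
    have "?p h = \<one>\<^bsub>Out G\<^esub>" if "h \<in> ?N"
      using that N.rcos_const[OF AutoGroup] by (simp add: Out_def)
    then have "?p h \<in> generate (Out G) (?p ` S)"
      using inv subgroup.one_closed[OF sub] by (auto intro: generate.incl)
    then show ?case using subgroup.m_inv_closed[OF sub] hc by simp
  next
    case (eng h1 h2)
    then have "h1 \<in> carrier ?A" "h2 \<in> carrier ?A" using gen by auto
    then show ?case using subgroup.m_closed[OF sub] eng by simp
  qed
  then have "carrier (Out G) \<subseteq> generate (Out G) (?p ` S)"
    using assms(3) by (auto simp: Out_def carrier_FactGroup carrier_AutoGroup)
  moreover have "generate (Out G) (?p ` S) \<subseteq> carrier (Out G)"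
    by (rule subgroup.subset[OF sub])
  ultimately show ?thesis
    unfolding finitely_generated_def using assms(1,2)
    by (intro exI[of _ "?p ` S"]) (auto simp: carrier_AutoGroup intro!: p.hom_closed)
qed

text \<open>Transport of automorphisms along \<open>h\<close>, followed by the projection to
  \<open>Out H\<close>, is onto with kernel \<open>inner_auto G\<close>; the first isomorphism
  theorem does the rest. The lemma allows passing to an isomorphic group on another type.\<close>

lemma Out_cong:
  fixes G :: "('a, 'c) monoid_scheme" and H :: "('b, 'd) monoid_scheme"
  assumes "group G" "group H" "G \<cong> H"
  shows "Out G \<cong> Out H"
proof -
  interpret G: group G by fact
  interpret H: group H by fact
  obtain h where h: "h \<in> iso G H" using assms(3) by (auto simp: is_iso_def)
  interpret h: group_hom G H h
    using h assms(1,2) by (auto simp: group_hom_def group_hom_axioms_def iso_def)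
  have bij: "bij_betw h (carrier G) (carrier H)" using h by (simp add: iso_def)
  define k where "k = inv_into (carrier G) h"
  have k: "k y \<in> carrier G" "h (k y) = y" if "y \<in> carrier H" for y
    using bij that by (auto simp: k_def bij_betw_def inv_into_into f_inv_into_f)
  have kh: "k (h x) = x" if "x \<in> carrier G" for x
    using bij that by (auto simp: k_def bij_betw_def)
  have km: "k (x \<otimes>\<^bsub>H\<^esub> y) = k x \<otimes>\<^bsub>G\<^esub> k y" if "x \<in> carrier H" "y \<in> carrier H" for x y
    using kh[of "k x \<otimes>\<^bsub>G\<^esub> k y"] k[of x] k[of y] that by simp
  define T where "T f = (\<lambda>y\<in>carrier H. h (f (k y)))" for f
  have Tbij: "bij_betw (T f) (carrier H) (carrier H)" if "bij_betw f (carrier G) (carrier G)" for f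
  proof -
    have "bij_betw k (carrier H) (carrier G)"
      by (rule bij_betw_byWitness[where f' = h]) (use k kh in auto)
    then have "bij_betw (h \<circ> (f \<circ> k)) (carrier H) (carrier H)"
      using bij that by (intro bij_betw_trans)
    then show ?thesis by (rule bij_betw_cong[THEN iffD1, rotated]) (simp add: T_def)
  qed
  have Tauto: "T f \<in> auto H" if "f \<in> auto G" for f
  proof -
    have f: "f \<in> hom G G" "bij_betw f (carrier G) (carrier G)"
      using that by (auto simp: auto_def Bij_def)
    have "T f \<in> hom H H"
      using f(1) k km by (auto simp: hom_def T_def Pi_iff)
    then show ?thesis using Tbij[OF f(2)] by (simp add: auto_def Bij_def T_def)
  qed
  let ?A = "AutoGroup G" and ?B = "AutoGroup H"
  have fc: "f x \<in> carrier G" if "f \<in> auto G" "x \<in> carrier G" for f x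
    using that by (auto simp: auto_def hom_def)
  have Thom: "T \<in> hom ?A ?B"
  proof (rule homI)
    fix x y assume xy: "x \<in> carrier ?A" "y \<in> carrier ?A"
    then show "T x \<in> carrier ?B" using Tauto by (simp add: G.carrier_AutoGroup H.carrier_AutoGroup)
    show "T (x \<otimes>\<^bsub>?A\<^esub> y) = T x \<otimes>\<^bsub>?B\<^esub> T y"
      using xy Tauto k kh fc
      by (auto simp: G.carrier_AutoGroup G.mult_AutoGroup H.mult_AutoGroup T_def compose_def fun_eq_iff)
  qed
  let ?p = "\<lambda>x. inner_auto H #>\<^bsub>?B\<^esub> x"
  interpret NH: normal "inner_auto H" ?B by (rule H.inner_auto_normal)
  have phom: "?p \<in> hom ?B (Out H)" using NH.r_coset_hom_Mod by (simp add: Out_def)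
  interpret q: group_hom ?A "Out H" "?p \<circ> T"
    using hom_compose[OF Thom phom] G.AutoGroup H.group_Out
    by (auto simp: group_hom_def group_hom_axioms_def)
  have Tsurj: "f \<in> T ` auto G" if "f \<in> auto H" for f
  proof -
    define f' where "f' = (\<lambda>x\<in>carrier G. k (f (h x)))"
    have f: "f \<in> hom H H" "bij_betw f (carrier H) (carrier H)" "f \<in> extensional (carrier H)"
      using that by (auto simp: auto_def Bij_def)
    have fc': "f y \<in> carrier H" if "y \<in> carrier H" for y using f(1) that by (auto simp: hom_def)
    have "bij_betw k (carrier H) (carrier G)"
      by (rule bij_betw_byWitness[where f' = h]) (use k kh in auto)
    then have "bij_betw (k \<circ> (f \<circ> h)) (carrier G) (carrier G)"
      using bij f(2) by (intro bij_betw_trans)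
    then have "bij_betw f' (carrier G) (carrier G)"
      by (rule bij_betw_cong[THEN iffD1, rotated]) (simp add: f'_def)
    moreover have "f' \<in> hom G G"
      using f(1) fc' k km by (auto simp: hom_def f'_def Pi_iff)
    ultimately have "f' \<in> auto G" by (simp add: auto_def Bij_def f'_def)
    moreover have "T f' = f"
      using k fc' f(3) by (intro extensionalityI[of _ "carrier H"]) (auto simp: T_def f'_def)
    ultimately show ?thesis by blast
  qed
  have Tinner: "T (\<lambda>x\<in>carrier G. g \<otimes>\<^bsub>G\<^esub> x \<otimes>\<^bsub>G\<^esub> inv\<^bsub>G\<^esub> g) = (\<lambda>y\<in>carrier H. h g \<otimes>\<^bsub>H\<^esub> y \<otimes>\<^bsub>H\<^esub> inv\<^bsub>H\<^esub> h g)"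
    if "g \<in> carrier G" for g
    using that k by (auto simp: T_def fun_eq_iff)
  have Tinj: "f = f'" if "T f = T f'" "f \<in> auto G" "f' \<in> auto G" for f f'
  proof (rule extensionalityI[of _ "carrier G"])
    show "f \<in> extensional (carrier G)" "f' \<in> extensional (carrier G)"
      using that by (auto simp: auto_def Bij_def)
    fix x assume x: "x \<in> carrier G"
    have "T f (h x) = T f' (h x)" using that by simp
    then have "h (f x) = h (f' x)" using x kh by (simp add: T_def)
    then show "f x = f' x" using x kh fc that by metis
  qed
  have "kernel ?A (Out H) (?p \<circ> T) = inner_auto G"
  proof
    show "kernel ?A (Out H) (?p \<circ> T) \<subseteq> inner_auto G"
    proof
      fix f assume f: "f \<in> kernel ?A (Out H) (?p \<circ> T)"
      then have fa: "f \<in> auto G" and "?p (T f) = inner_auto H"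
        by (auto simp: kernel_def G.carrier_AutoGroup Out_def)
      then have "T f \<in> inner_auto H"
        using NH.rcos_self[of "T f", OF _ NH.subgroup_axioms] Tauto by (simp add: H.carrier_AutoGroup)
      then obtain y where y: "y \<in> carrier H" "T f = (\<lambda>x\<in>carrier H. y \<otimes>\<^bsub>H\<^esub> x \<otimes>\<^bsub>H\<^esub> inv\<^bsub>H\<^esub> y)"
        by (auto simp: inner_auto_def)
      then have "T f = T (\<lambda>x\<in>carrier G. k y \<otimes>\<^bsub>G\<^esub> x \<otimes>\<^bsub>G\<^esub> inv\<^bsub>G\<^esub> (k y))"
        using Tinner[of "k y"] k by simp
      then have "f = (\<lambda>x\<in>carrier G. k y \<otimes>\<^bsub>G\<^esub> x \<otimes>\<^bsub>G\<^esub> inv\<^bsub>G\<^esub> (k y))"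
        using Tinj fa G.conj_in_auto k y by blast
      then show "f \<in> inner_auto G" using k y by (auto simp: inner_auto_def)
    qed
    show "inner_auto G \<subseteq> kernel ?A (Out H) (?p \<circ> T)"
    proof
      fix f assume "f \<in> inner_auto G"
      then obtain g where g: "g \<in> carrier G" "f = (\<lambda>x\<in>carrier G. g \<otimes>\<^bsub>G\<^esub> x \<otimes>\<^bsub>G\<^esub> inv\<^bsub>G\<^esub> g)"
        by (auto simp: inner_auto_def)
      then have "T f \<in> inner_auto H" using Tinner by (auto simp: inner_auto_def)
      then have "?p (T f) = inner_auto H" by (rule NH.rcos_const[OF H.AutoGroup])
      then show "f \<in> kernel ?A (Out H) (?p \<circ> T)"
        using g G.conj_in_auto by (simp add: kernel_def G.carrier_AutoGroup Out_def)
    qed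
  qed
  moreover have "(?p \<circ> T) ` carrier ?A = carrier (Out H)"
  proof -
    have "T ` carrier ?A = carrier ?B"
      using Tauto Tsurj by (auto simp: G.carrier_AutoGroup H.carrier_AutoGroup)
    then show ?thesis unfolding image_comp[symmetric] by (simp add: Out_def carrier_FactGroup)
  qed
  ultimately show ?thesis
    using q.FactGroup_iso by (simp add: Out_def)
qed

section \<open>The semidirect product\<close>

text \<open>\<open>P\<close> is the positive cone of a left order, \<open>x < y\<close> meaning
  \<open>inv x \<otimes> y \<in> P\<close>. The conditions \<open>comm\<close>,
  \<open>noncomm1\<close> and \<open>noncomm2\<close> concern the commutator of \<open>x\<close> and
  \<open>z x z^-1\<close> for the three pairs of consecutive gains; they break the cyclic symmetry
  of the copies. \<open>separating\<close> is residual finiteness in terms of left congruences of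
  finite index, for finitely many elements at once.\<close>

locale gain_group = group C for C :: "('c, 'm) monoid_scheme" (structure) +
  fixes a t :: 'c and P :: "'c set"
  assumes at: "a \<in> carrier C" "t \<in> carrier C"
    and gen: "carrier C \<subseteq> generate C {a, t}"
    and P_mult: "x \<in> P \<Longrightarrow> y \<in> P \<Longrightarrow> x \<otimes> y \<in> P"
    and P_total: "x \<in> carrier C \<Longrightarrow> x = \<one> \<or> x \<in> P \<or> inv x \<in> P"
    and P_one: "\<one> \<notin> P"
    and comm: "a \<otimes> (t \<otimes> a \<otimes> inv t) = (t \<otimes> a \<otimes> inv t) \<otimes> a"
    and noncomm1: "t \<otimes> (inv (t \<otimes> a) \<otimes> t \<otimes> inv (inv (t \<otimes> a))) \<noteq> (inv (t \<otimes> a) \<otimes> t \<otimes> inv (inv (t \<otimes> a))) \<otimes> t"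
    and noncomm2: "inv (t \<otimes> a) \<otimes> (a \<otimes> inv (t \<otimes> a) \<otimes> inv a) \<noteq> (a \<otimes> inv (t \<otimes> a) \<otimes> inv a) \<otimes> inv (t \<otimes> a)"
    and separating: "finite E \<Longrightarrow> E \<subseteq> carrier C \<Longrightarrow> \<one> \<notin> E \<Longrightarrow>
      \<exists>\<theta> :: 'c \<Rightarrow> nat. finite (\<theta> ` carrier C) \<and> (\<forall>x\<in>E. \<theta> x \<noteq> \<theta> \<one>) \<and>
        (\<forall>g\<in>carrier C. \<forall>x\<in>carrier C. \<forall>y\<in>carrier C. \<theta> x = \<theta> y \<longrightarrow> \<theta> (g \<otimes> x) = \<theta> (g \<otimes> y))"
begin

text \<open>The third gain closes the cycle:
  \<open>inv (t \<otimes> a) \<otimes> t \<otimes> a = \<one>\<close>, which gives \<open>u\<close>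
  order 3.\<close>

definition gain :: "nat \<Rightarrow> 'c" where
  "gain i = (if i = 0 then a else if i = 1 then t else inv (t \<otimes> a))"

definition next3 :: "nat \<Rightarrow> nat" where
  "next3 i = (if i = 0 then 1 else if i = 1 then 2 else 0)"

fun move :: "bool \<Rightarrow> nat \<times> 'c \<Rightarrow> nat \<times> 'c" where
  "move s (i, c) = (next3 i, if s then c else gain i \<otimes> c)"

definition X :: "(nat \<times> 'c) set" where
  "X = {..<3} \<times> carrier C"

lemma in_X: "(i, c) \<in> X \<longleftrightarrow> (i = 0 \<or> i = 1 \<or> i = 2) \<and> c \<in> carrier C"
  by (auto simp: X_def)

lemma gain_closed [simp]: "gain i \<in> carrier C"
  using at by (simp add: gain_def)

lemma gain_cycle: "c \<in> carrier C \<Longrightarrow> inv (t \<otimes> a) \<otimes> (t \<otimes> (a \<otimes> c)) = c"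
  "c \<in> carrier C \<Longrightarrow> a \<otimes> (inv (t \<otimes> a) \<otimes> (t \<otimes> c)) = c"
  "c \<in> carrier C \<Longrightarrow> t \<otimes> (a \<otimes> (inv (t \<otimes> a) \<otimes> c)) = c"
proof -
  assume c: "c \<in> carrier C"
  show "inv (t \<otimes> a) \<otimes> (t \<otimes> (a \<otimes> c)) = c"
    using at c m_assoc[of t a c] by (metis inv_solve_left m_closed)
  have "inv t \<otimes> (t \<otimes> c) = c" using at c by (metis inv_solve_left m_closed)
  moreover have "a \<otimes> (inv a \<otimes> c) = c" using at c by (metis inv_solve_left inv_closed m_closed)
  ultimately show "a \<otimes> (inv (t \<otimes> a) \<otimes> (t \<otimes> c)) = c"
    using at c by (simp add: inv_mult_group m_assoc)
  show "t \<otimes> (a \<otimes> (inv (t \<otimes> a) \<otimes> c)) = c"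
    using at c m_assoc[of t a "inv (t \<otimes> a) \<otimes> c"] by (metis inv_solve_left inv_closed m_closed)
qed

lemma move_order3: "order3_action move X"
proof
  fix x s assume "x \<in> X"
  then obtain i c where x: "x = (i, c)" "i = 0 \<or> i = 1 \<or> i = 2" "c \<in> carrier C"
    by (cases x) (auto simp: in_X)
  then show "move s x \<in> X" by (auto simp: in_X next3_def)
  show "move s (move s (move s x)) = x"
    using x gain_cycle[of c] by (auto simp: next3_def gain_def)
qed

sublocale move: order3_action move X by (rule move_order3)

abbreviation act :: "fword \<Rightarrow> nat \<times> 'c \<Rightarrow> nat \<times> 'c" where
  "act \<equiv> word_act move"

lemma act_mult: "x \<in> X \<Longrightarrow> act (word_act step v w) x = act v (act w x)"
  by (rule move.word_act_mult)

lemma act_closed: "x \<in> X \<Longrightarrow> act w x \<in> X"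
  by (rule move.word_act_closed)

lemma act_winv: "reduced w \<Longrightarrow> x \<in> X \<Longrightarrow> act (winv w) (act w x) = x"
  using act_mult[of x "winv w" w] by (simp add: winv_left)

lemma act_inj: "reduced w \<Longrightarrow> inj_on (act w) X"
  by (rule inj_on_inverseI[of _ "act (winv w)"]) (simp add: act_winv)

lemma act_image_mult: "m \<subseteq> X \<Longrightarrow> act (word_act step v w) ` m = act v ` act w ` m"
  by (force simp: image_image act_mult subset_iff image_iff)

lemma act_image_closed: "m \<subseteq> X \<Longrightarrow> act w ` m \<subseteq> X"
  using act_closed by blast

lemma act_sym_diff:
  assumes "reduced w" "m \<subseteq> X" "n \<subseteq> X"
  shows "act w ` sym_diff m n = sym_diff (act w ` m) (act w ` n)"
  using inj_on_image_set_diff[OF act_inj[OF assms(1)], of m n]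
    inj_on_image_set_diff[OF act_inj[OF assms(1)], of n m] assms(2,3)
  by (simp add: image_Un Diff_subset[THEN subset_trans])

definition W :: "((nat \<times> 'c) set \<times> fword) monoid" where
  "W = \<lparr>carrier = {(m, w). finite m \<and> m \<subseteq> X \<and> reduced w},
     mult = (\<lambda>(m, v) (n, w). (sym_diff m (act v ` n), word_act step v w)),
     one = ({}, [])\<rparr>"

lemma carrier_W [simp]: "(m, w) \<in> carrier W \<longleftrightarrow> finite m \<and> m \<subseteq> X \<and> reduced w"
  by (simp add: W_def)

lemma mult_W [simp]: "(m, v) \<otimes>\<^bsub>W\<^esub> (n, w) = (sym_diff m (act v ` n), word_act step v w)"
  by (simp add: W_def)

lemma one_W [simp]: "\<one>\<^bsub>W\<^esub> = ({}, [])"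
  by (simp add: W_def)

lemma reduced_mult: "reduced v \<Longrightarrow> reduced w \<Longrightarrow> reduced (word_act step v w)"
  using step.word_act_closed[of w v] by simp

lemma sym_diff_assoc: "sym_diff (sym_diff A B) D = sym_diff A (sym_diff B D)"
  by blast

lemma sym_diff_simps [simp]: "sym_diff A A = {}" "sym_diff A (sym_diff A B) = B"
  by blast+

lemma group_W: "group W"
proof (rule groupI)
  fix x y assume xy: "x \<in> carrier W" "y \<in> carrier W"
  obtain m v n w where e: "x = (m, v)" "y = (n, w)" by force
  then show "x \<otimes>\<^bsub>W\<^esub> y \<in> carrier W"
    using xy act_image_closed[of n v] by (auto simp: reduced_mult)
  fix z assume z: "z \<in> carrier W"
  obtain k u where z': "z = (k, u)" by force
  have "act v ` (sym_diff n (act w ` k)) = sym_diff (act v ` n) (act v ` act w ` k)"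
    by (rule act_sym_diff) (use xy z e z' act_image_closed[of k w] in auto)
  then show "x \<otimes>\<^bsub>W\<^esub> y \<otimes>\<^bsub>W\<^esub> z = x \<otimes>\<^bsub>W\<^esub> (y \<otimes>\<^bsub>W\<^esub> z)"
    using xy z e z' by (simp add: act_image_mult sym_diff_assoc step.word_act_mult del: Un_Diff)
next
  fix x assume x: "x \<in> carrier W"
  obtain m v where e: "x = (m, v)" by force
  show "\<one>\<^bsub>W\<^esub> \<otimes>\<^bsub>W\<^esub> x = x" using e by simp
  have "(act (winv v) ` m, winv v) \<otimes>\<^bsub>W\<^esub> x = \<one>\<^bsub>W\<^esub>"
    using x e by (simp add: winv_left)
  then show "\<exists>y\<in>carrier W. y \<otimes>\<^bsub>W\<^esub> x = \<one>\<^bsub>W\<^esub>"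
    using x e act_image_closed[of m "winv v"] by (intro bexI[of _ "(act (winv v) ` m, winv v)"]) auto
qed (simp add: W_def)

sublocale W: group W by (rule group_W)

abbreviation em :: "(nat \<times> 'c) set \<Rightarrow> (nat \<times> 'c) set \<times> fword" where
  "em m \<equiv> (m, [])"

abbreviation lw :: "fword \<Rightarrow> (nat \<times> 'c) set \<times> fword" where
  "lw w \<equiv> ({}, w)"

abbreviation base :: "(nat \<times> 'c) set \<Rightarrow> bool" where
  "base m \<equiv> finite m \<and> m \<subseteq> X"

lemma inv_em: "base m \<Longrightarrow> inv\<^bsub>W\<^esub> (em m) = em m"
  by (rule W.inv_equality) auto

lemma inv_lw: "reduced w \<Longrightarrow> inv\<^bsub>W\<^esub> (lw w) = lw (winv w)"
  by (rule W.inv_equality) (auto simp: winv_left)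

lemma em_mult_lw: "em m \<otimes>\<^bsub>W\<^esub> lw w = (m, w)"
  by simp

lemma lw_conj_em:
  "reduced w \<Longrightarrow> base m \<Longrightarrow> lw w \<otimes>\<^bsub>W\<^esub> em m \<otimes>\<^bsub>W\<^esub> inv\<^bsub>W\<^esub> lw w = em (act w ` m)"
  using F.r_one[of w] by (simp add: inv_lw winv_right)

text \<open>On the three pieces of \<open>X\<close>, the word \<open>v\<^sup>-\<^sup>1 u\<close> acts by the gains \<open>(a, t, s)\<close> and \<open>v u v\<close> by
  \<open>(t, s, a)\<close>, where \<open>s = (t a)\<^sup>-\<^sup>1\<close>.\<close>

definition fixes_piece :: "fword \<Rightarrow> nat \<Rightarrow> 'c \<Rightarrow> bool" where
  "fixes_piece w i c \<longleftrightarrow> c \<in> carrier C \<and> (\<forall>y\<in>carrier C. act w (i, y) = (i, c \<otimes> y))"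

lemma fixes_piece_mult:
  assumes "fixes_piece v i c" "fixes_piece w i d" "i < 3"
  shows "fixes_piece (word_act step v w) i (c \<otimes> d)"
  using assms by (auto simp: fixes_piece_def act_mult X_def m_assoc)

lemma fixes_piece_winv:
  assumes "fixes_piece w i c" "i < 3" "reduced w"
  shows "fixes_piece (winv w) i (inv c)"
  unfolding fixes_piece_def
proof (intro conjI ballI)
  show "inv c \<in> carrier C" using assms by (simp add: fixes_piece_def)
  fix y assume y: "y \<in> carrier C"
  then have "act w (i, inv c \<otimes> y) = (i, y)"
    using assms(1) by (simp add: fixes_piece_def flip: m_assoc)
  then show "act (winv w) (i, y) = (i, inv c \<otimes> y)"
    using act_winv[OF assms(3), of "(i, inv c \<otimes> y)"] y assms by (simp add: X_def fixes_piece_def)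
qed

definition wx :: fword where "wx = [(True, True), (False, False)]"
definition wz :: fword where "wz = [(True, False), (False, False), (True, False)]"

lemma reduced_wx_wz: "reduced wx" "reduced wz"
  by (simp_all add: wx_def wz_def)

lemma fixes_wx: "i < 3 \<Longrightarrow> fixes_piece wx i (gain i)"
  and fixes_wz: "i < 3 \<Longrightarrow> fixes_piece wz i (gain (next3 i))"
  by (auto simp: fixes_piece_def wx_def wz_def letter_act_def next3_def numeral_3_eq_3 less_Suc_eq)

text \<open>On copy 0 the words \<open>wx\<close> and \<open>wz\<close> act by \<open>a\<close> and
  \<open>t\<close>, which generate \<open>C\<close>.\<close>

lemma ex_fixes_piece0:
  assumes "c \<in> carrier C"
  shows "\<exists>w. reduced w \<and> fixes_piece w 0 c"
proof -
  have "c \<in> generate C {a, t}" using assms gen by blast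
  then show ?thesis
  proof induction
    case one
    show ?case by (rule exI[of _ "[]"]) (simp add: fixes_piece_def)
  next
    case (incl h)
    then show ?case using fixes_wx[of 0] fixes_wz[of 0] reduced_wx_wz
      by (auto simp: gain_def next3_def)
  next
    case (inv h)
    have "fixes_piece (winv wx) 0 (inv a)" "fixes_piece (winv wz) 0 (inv t)"
      using fixes_piece_winv[OF fixes_wx[of 0]] fixes_piece_winv[OF fixes_wz[of 0]] reduced_wx_wz
      by (simp_all add: gain_def next3_def)
    moreover have "reduced (winv wx)" "reduced (winv wz)" using reduced_wx_wz by simp_all
    ultimately show ?case using inv by blast
  next
    case (eng h1 h2)
    then show ?case using fixes_piece_mult[of _ 0 h1 _ h2] reduced_mult by (metis zero_less_numeral)
  qed
qed

text \<open>After an arbitrary left translation, copy 0 is carried to copy \<open>i\<close> by a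
  power of \<open>v\<close>. Thus \<open>M\<close> is a cyclic module generated by the origin
  \<open>(0, \<one>)\<close>, and an equivariant map is determined there.\<close>

lemma ex_act_from_origin:
  assumes "(i, c) \<in> X"
  shows "\<exists>w. reduced w \<and> (\<forall>y\<in>carrier C. act w (0, y) = (i, c \<otimes> y))"
proof -
  obtain w where w: "reduced w" "fixes_piece w 0 c" using ex_fixes_piece0 assms by (auto simp: in_X)
  define r :: fword where "r = (if i = 0 then [] else if i = 1 then [(True, False)] else [(True, True)])"
  have "act r (0, y) = (i, y)" for y
    using assms by (auto simp: r_def in_X letter_act_def next3_def)
  then have "act (word_act step r w) (0, y) = (i, c \<otimes> y)" if "y \<in> carrier C" for y
    using that w(2) by (simp add: act_mult in_X fixes_piece_def)
  moreover have "reduced (word_act step r w)" by (rule reduced_mult) (auto simp: r_def w)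
  ultimately show ?thesis by blast
qed

text \<open>\<open>w\<close> is the commutator of \<open>wx\<close> and its conjugate by
  \<open>wz\<close>. On copy \<open>i\<close> it acts by the same commutator in
  \<open>gain i\<close> and \<open>gain (next3 i)\<close>, which by \<open>comm\<close>,
  \<open>noncomm1\<close> and \<open>noncomm2\<close> is trivial for \<open>i = 0\<close>
  only.\<close>

lemma ex_asymmetric_word:
  "\<exists>w c1 c2. reduced w \<and> fixes_piece w 0 \<one> \<and> fixes_piece w 1 c1 \<and> fixes_piece w 2 c2 \<and>
     c1 \<noteq> \<one> \<and> c2 \<noteq> \<one>"
proof -
  define k where "k x z = x \<otimes> (z \<otimes> x \<otimes> inv z) \<otimes> inv (z \<otimes> x \<otimes> inv z \<otimes> x)" for x z
  define wc where "wc = word_act step wz (word_act step wx (winv wz))"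
  define w where "w = word_act step wx (word_act step wc (winv (word_act step wc wx)))"
  have red: "reduced wc" "reduced (word_act step wc wx)" "reduced w"
    using reduced_wx_wz by (auto simp: wc_def w_def reduced_mult)
  have "fixes_piece w i (k (gain i) (gain (next3 i)))" if "i < 3" for i
  proof -
    have "fixes_piece wc i (gain (next3 i) \<otimes> (gain i \<otimes> inv (gain (next3 i))))"
      unfolding wc_def using that fixes_wx fixes_wz reduced_wx_wz
      by (intro fixes_piece_mult fixes_piece_winv) auto
    then have "fixes_piece w i (gain i \<otimes> (gain (next3 i) \<otimes> (gain i \<otimes> inv (gain (next3 i))) \<otimes>
        inv (gain (next3 i) \<otimes> (gain i \<otimes> inv (gain (next3 i))) \<otimes> gain i)))"
      unfolding w_def using that fixes_wx red
      by (intro fixes_piece_mult fixes_piece_winv) auto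
    then show ?thesis by (simp add: k_def m_assoc)
  qed
  note fix_w = this[of 0] this[of 1] this[of 2]
  have k1: "k x z = \<one> \<longleftrightarrow> x \<otimes> (z \<otimes> x \<otimes> inv z) = (z \<otimes> x \<otimes> inv z) \<otimes> x"
    if "x \<in> carrier C" "z \<in> carrier C" for x z
    unfolding k_def using that by (subst inv_solve_right') auto
  have "k a t = \<one>" "k t (inv (t \<otimes> a)) \<noteq> \<one>" "k (inv (t \<otimes> a)) a \<noteq> \<one>"
    using k1[of a t] k1[of t "inv (t \<otimes> a)"] k1[of "inv (t \<otimes> a)" a] comm noncomm1 noncomm2 at by blast+
  moreover have "fixes_piece w 0 (k a t)" "fixes_piece w 1 (k t (inv (t \<otimes> a)))"
    "fixes_piece w 2 (k (inv (t \<otimes> a)) a)"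
    using fix_w by (simp_all add: next3_def gain_def)
  ultimately show ?thesis using red(3) by metis
qed

lemma word_in_subgroup:
  assumes H: "subgroup H W" and u: "\<And>s. lw [(s, False)] \<in> H" and "reduced w"
  shows "lw w \<in> H"
  using \<open>reduced w\<close>
proof (induction w)
  case Nil
  show ?case using subgroup.one_closed[OF H] by simp
next
  case (Cons l w)
  obtain s e where l: "l = (s, e)" by force
  have r: "reduced w" using Cons.prems by (auto simp: distinct_adj_Cons)
  have "w = [] \<or> fst (hd w) \<noteq> s"
    using Cons.prems l by (auto simp: distinct_adj_Cons hd_map)
  then have lw: "lw (l # w) = lw [l] \<otimes>\<^bsub>W\<^esub> lw w"
    using l by (simp add: letter_act_step_append)
  have "lw [(s, True)] = lw [(s, False)] \<otimes>\<^bsub>W\<^esub> lw [(s, False)]"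
    by (simp add: letter_act_def)
  then have "lw [(s, True)] \<in> H" using subgroup.m_closed[OF H u u, of s s] by simp
  then have "lw [l] \<in> H" using u l by (cases e) auto
  then show ?case unfolding lw using Cons.IH[OF r] by (rule subgroup.m_closed[OF H])
qed

lemma base_in_subgroup:
  assumes H: "subgroup H W" and m: "base m" and pt: "\<And>x. x \<in> X \<Longrightarrow> em {x} \<in> H"
  shows "em m \<in> H"
proof -
  from m have "finite m" "m \<subseteq> X" by auto
  then show ?thesis
  proof (induction m rule: finite_induct)
    case empty
    show ?case using subgroup.one_closed[OF H] by simp
  next
    case (insert x m)
    then have eq: "em (insert x m) = em {x} \<otimes>\<^bsub>W\<^esub> em m" by auto
    show ?case unfolding eq by (rule subgroup.m_closed[OF H]) (use insert pt in auto)
  qed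
qed

text \<open>Besides finite generation this serves, through the subgroup on which two automorphisms
  agree, to compare automorphisms on three elements (\<open>aut_eqI\<close>).\<close>

lemma subgroup_eq_carrier:
  assumes H: "subgroup H W" and u: "\<And>s. lw [(s, False)] \<in> H" and pt: "em {(0, \<one>)} \<in> H"
  shows "carrier W \<subseteq> H"
proof
  fix x assume x: "x \<in> carrier W"
  obtain m w where e: "x = (m, w)" by force
  have "em {y} \<in> H" if y: "y \<in> X" for y
  proof -
    obtain i c where ic: "y = (i, c)" by force
    obtain v where v: "reduced v" "\<forall>y\<in>carrier C. act v (0, y) = (i, c \<otimes> y)"
      using ex_act_from_origin y ic by blast
    have "em {y} = lw v \<otimes>\<^bsub>W\<^esub> em {(0, \<one>)} \<otimes>\<^bsub>W\<^esub> inv\<^bsub>W\<^esub> lw v"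
      using lw_conj_em[OF v(1), of "{(0, \<one>)}"] v(2) y ic by (simp add: in_X)
    moreover have "lw v \<in> H" by (rule word_in_subgroup[OF H u v(1)])
    ultimately show ?thesis
      using pt by (simp only: subgroup.m_closed[OF H] subgroup.m_inv_closed[OF H])
  qed
  then have "em m \<in> H" using base_in_subgroup[OF H] x e by simp
  moreover have "lw w \<in> H" using word_in_subgroup[OF H u] x e by simp
  ultimately have "em m \<otimes>\<^bsub>W\<^esub> lw w \<in> H" by (rule subgroup.m_closed[OF H])
  then show "x \<in> H" using e by simp
qed

lemma finitely_generated_W: "finitely_generated W"
proof -
  let ?S = "{em {(0, \<one>)}, lw [(False, False)], lw [(True, False)]}"
  have S: "?S \<subseteq> carrier W" by (auto simp: in_X)
  have "lw [(s, False)] \<in> generate W ?S" for s by (cases s) (auto intro: generate.incl)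
  then have "carrier W \<subseteq> generate W ?S"
    by (intro subgroup_eq_carrier W.generate_is_subgroup S) (auto intro: generate.incl)
  moreover have "generate W ?S \<subseteq> carrier W"
    by (rule subgroup.subset[OF W.generate_is_subgroup[OF S]])
  ultimately show ?thesis unfolding finitely_generated_def using S by (intro exI[of _ ?S]) auto
qed

section \<open>Residual finiteness of the semidirect product\<close>

lemma odd_card_sym_diff:
  assumes "finite A" "finite B"
  shows "odd (card (sym_diff A B)) \<longleftrightarrow> odd (card A) \<noteq> odd (card B)"
proof -
  have "card (sym_diff A B) = card (A - B) + card (B - A)"
    using assms by (intro card_Un_disjoint) auto
  moreover have "card A = card (A - B) + card (A \<inter> B)" "card B = card (B - A) + card (A \<inter> B)"
    using card_Int_Diff[OF assms(1), of B] card_Int_Diff[OF assms(2), of A] by (simp_all add: Int_commute)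
  ultimately show ?thesis by presburger
qed

text \<open>The free product, as a quotient of \<open>W\<close>, acts on its ball of radius
  \<open>length w\<close>, and there \<open>w\<close> moves the empty word to
  \<open>w\<close>.\<close>

lemma separate_word:
  assumes "(m, w) \<in> carrier W" "w \<noteq> []"
  shows "\<exists>(F :: nat monoid) \<phi>. group F \<and> finite (carrier F) \<and> \<phi> \<in> hom W F \<and> \<phi> (m, w) \<noteq> \<one>\<^bsub>F\<^esub>"
proof -
  define n where "n = length w"
  interpret B: order3_action "tstep n" "{w. reduced w \<and> length w \<le> n}" by (rule tstep_order3)
  define \<Theta> where "\<Theta> x = word_act (tstep n) (snd x) []" for x :: "(nat \<times> 'c) set \<times> fword"
  have mult: "\<Theta> (h \<otimes>\<^bsub>W\<^esub> x) = word_act (tstep n) (snd h) (\<Theta> x)" for h x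
    using B.word_act_mult[of "[]" "snd h" "snd x"] by (cases h; cases x) (simp add: \<Theta>_def)
  show ?thesis
  proof (rule W.finite_quotient_of_congruence[of \<Theta>])
    have "\<Theta> ` carrier W \<subseteq> {w. reduced w \<and> length w \<le> n}"
      using B.word_act_closed[of "[]"] by (auto simp: \<Theta>_def)
    moreover have "finite {w :: fword. set w \<subseteq> UNIV \<and> length w \<le> n}"
      by (rule finite_lists_length_le) simp
    ultimately show "finite (\<Theta> ` carrier W)" by (elim finite_subset[OF subset_trans]) auto
    have "\<Theta> (m, w) = w" using word_act_tstep[of w n] assms(1) by (simp add: \<Theta>_def n_def)
    then show "\<Theta> (m, w) \<noteq> \<Theta> \<one>\<^bsub>W\<^esub>" using assms(2) by (simp add: \<Theta>_def)
  qed (use assms mult in auto)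
qed

text \<open>A finite left congruence on \<open>C\<close> gives a finite quotient of \<open>X\<close>
  with an action of the free product. Elements of \<open>M\<close> are pushed forward to it with
  coefficients mod 2, and the congruence is fine enough to leave some point of \<open>m\<close>
  alone in its fibre.\<close>

lemma separate_base:
  assumes m: "base m" "m \<noteq> {}"
  shows "\<exists>(F :: nat monoid) \<phi>. group F \<and> finite (carrier F) \<and> \<phi> \<in> hom W F \<and> \<phi> (em m) \<noteq> \<one>\<^bsub>F\<^esub>"
proof -
  obtain i c where ic: "(i, c) \<in> m" using m(2) by auto
  then have c: "(i, c) \<in> X" "c \<in> carrier C" using m(1) by (auto simp: X_def)
  \<comment> \<open>By left invariance, a congruence that separates \<open>E\<close> from
    \<open>\<one>\<close> separates \<open>c\<close> from every other group coordinate that occurs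
    in \<open>m\<close>.\<close>
  define E where "E = (\<lambda>x. inv c \<otimes> snd x) ` m - {\<one>}"
  have mC: "snd x \<in> carrier C" if "x \<in> m" for x using that m(1) by (auto simp: X_def)
  have "finite E" "E \<subseteq> carrier C" "\<one> \<notin> E" using m(1) mC c by (auto simp: E_def)
  from separating[OF this] obtain \<theta> :: "'c \<Rightarrow> nat" where
    \<theta>0: "finite (\<theta> ` carrier C) \<and> (\<forall>x\<in>E. \<theta> x \<noteq> \<theta> \<one>) \<and>
      (\<forall>g\<in>carrier C. \<forall>x\<in>carrier C. \<forall>y\<in>carrier C. \<theta> x = \<theta> y \<longrightarrow> \<theta> (g \<otimes> x) = \<theta> (g \<otimes> y))" ..
  note \<theta> = \<theta>0[THEN conjunct1] \<theta>0[THEN conjunct2, THEN conjunct1]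
  have cong: "\<theta> (g \<otimes> x) = \<theta> (g \<otimes> y)"
    if "g \<in> carrier C" "x \<in> carrier C" "y \<in> carrier C" "\<theta> x = \<theta> y" for g x y
    by (rule \<theta>0[THEN conjunct2, THEN conjunct2, rule_format, OF that])
  define q where "q x = (fst x, \<theta> (snd x))" for x :: "nat \<times> 'c"
  have q_move: "q (move s x) = q (move s y)" if "x \<in> X" "y \<in> X" "q x = q y" for s x y
    using that by (cases x; cases y) (auto simp: q_def X_def intro!: cong)
  have q_letter: "q (letter_act move l x) = q (letter_act move l y)"
    if "x \<in> X" "y \<in> X" "q x = q y" for l x y
    using that q_move[OF that] by (auto simp: letter_act_def intro!: q_move move.closed)
  have q_act: "q (act w x) = q (act w y)" if "x \<in> X" "y \<in> X" "q x = q y" for w x y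
    by (induction w) (use that in \<open>auto intro!: q_letter act_closed\<close>)
  have q_act_iff: "q (act w x) = q (act w y) \<longleftrightarrow> q x = q y"
    if "x \<in> X" "y \<in> X" "reduced w" for w x y
    using q_act[of "act w x" "act w y" "winv w"] q_act[of x y w] act_closed that
    by (auto simp: act_winv)
  \<comment> \<open>The image of \<open>m\<close> in the vector space over Z/2 on the quotient of
    \<open>X\<close>: coefficients are parities of fibres.\<close>
  define push where "push m = {z. odd (card {x \<in> m. q x = z})}" for m
  \<comment> \<open>Forgetting the word still gives a left congruence, because the base part of
    \<open>(k, w) \<otimes> (n, v)\<close>, namely \<open>k + w n\<close>, does not involve
    \<open>v\<close>.\<close>
  define \<Theta> where "\<Theta> x = push (fst x)" for x :: "(nat \<times> 'c) set \<times> fword"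
  have push_diff: "z \<in> push (sym_diff k n) \<longleftrightarrow> (z \<in> push k) \<noteq> (z \<in> push n)"
    if "finite k" "finite n" for k n z
  proof -
    have "{x \<in> sym_diff k n. q x = z} = sym_diff {x \<in> k. q x = z} {x \<in> n. q x = z}" by auto
    then show ?thesis using odd_card_sym_diff[of "{x \<in> k. q x = z}" "{x \<in> n. q x = z}"] that
      by (simp add: push_def)
  qed
  have push_act: "z \<in> push (act w ` k) \<longleftrightarrow> (\<exists>x\<in>X. q (act w x) = z \<and> q x \<in> push k)"
    if k: "base k" and w: "reduced w" for k w z
  proof -
    have "{y \<in> act w ` k. q y = z} = act w ` {x \<in> k. q (act w x) = z}" by auto
    moreover have "inj_on (act w) {x \<in> k. q (act w x) = z}"
      by (rule inj_on_subset[OF act_inj[OF w]]) (use k in auto)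
    ultimately have eq: "z \<in> push (act w ` k) \<longleftrightarrow> odd (card {x \<in> k. q (act w x) = z})"
      by (simp add: push_def card_image)
    have fib: "{x \<in> k. q (act w x) = z} = {x \<in> k. q x = q y}" if "y \<in> X" "q (act w y) = z" for y
      using q_act_iff[of _ y w] k w that by (auto simp: subset_iff)
    show ?thesis
    proof
      assume "z \<in> push (act w ` k)"
      then have o: "odd (card {x \<in> k. q (act w x) = z})" using eq by simp
      then have "{x \<in> k. q (act w x) = z} \<noteq> {}" by (metis card.empty even_zero)
      then obtain y where y: "y \<in> k" "q (act w y) = z" by blast
      then have "y \<in> X" using k by auto
      then show "\<exists>x\<in>X. q (act w x) = z \<and> q x \<in> push k"
        using o fib[of y] y by (auto simp: push_def)
    qed (use eq fib in \<open>auto simp: push_def\<close>)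
  qed
  show ?thesis
  proof (rule W.finite_quotient_of_congruence[of \<Theta>])
    have "push k \<subseteq> {..<3} \<times> \<theta> ` carrier C" if "base k" for k
    proof
      fix z assume "z \<in> push k"
      then have "odd (card {x \<in> k. q x = z})" by (simp add: push_def)
      then have "{x \<in> k. q x = z} \<noteq> {}" by (metis card.empty even_zero)
      then obtain x where "x \<in> k" "q x = z" by blast
      then show "z \<in> {..<3} \<times> \<theta> ` carrier C" using that by (auto simp: q_def X_def)
    qed
    then have "\<Theta> x \<in> Pow ({..<3} \<times> \<theta> ` carrier C)" if "x \<in> carrier W" for x
      using that by (cases x) (simp add: \<Theta>_def)
    then have "\<Theta> ` carrier W \<subseteq> Pow ({..<3} \<times> \<theta> ` carrier C)" by (rule image_subsetI)
    then show "finite (\<Theta> ` carrier W)"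
      using \<theta>(1) by (auto intro: finite_subset)
    show "em m \<in> carrier W" using m by simp
    have "{x \<in> m. q x = q (i, c)} = {(i, c)}"
    proof -
      have "x = (i, c)" if x: "x \<in> m" "q x = q (i, c)" for x
      proof (rule ccontr)
        assume ne: "x \<noteq> (i, c)"
        have "fst x = i" using x(2) by (simp add: q_def)
        then have "snd x \<noteq> c" using ne by (cases x) auto
        then have "inv c \<otimes> snd x \<noteq> \<one>"
          using mC[OF x(1)] c by (metis inv_closed inv_equality inv_inv)
        then have "inv c \<otimes> snd x \<in> E" using x by (auto simp: E_def)
        moreover have "\<theta> (inv c \<otimes> snd x) = \<theta> (inv c \<otimes> c)"
          using x(2) mC[OF x(1)] c by (intro cong) (auto simp: q_def)
        ultimately show False using \<theta>(2) c by simp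
      qed
      then show ?thesis using ic by blast
    qed
    then have "q (i, c) \<in> push m" by (simp add: push_def)
    moreover have "push {} = {}" by (simp add: push_def)
    ultimately have "push m \<noteq> push {}" by blast
    then show "\<Theta> (em m) \<noteq> \<Theta> \<one>\<^bsub>W\<^esub>" by (simp add: \<Theta>_def)
    fix h x y assume h: "h \<in> carrier W" "x \<in> carrier W" "y \<in> carrier W" and eq: "\<Theta> x = \<Theta> y"
    obtain k w n v n' v' where e: "h = (k, w)" "x = (n, v)" "y = (n', v')" by force
    have b: "base k" "base n" "base n'" "reduced w" using h e by auto
    have "push (act w ` n) = push (act w ` n')"
      using push_act[OF b(2,4)] push_act[OF b(3,4)] eq e by (auto simp: \<Theta>_def)
    then show "\<Theta> (h \<otimes>\<^bsub>W\<^esub> x) = \<Theta> (h \<otimes>\<^bsub>W\<^esub> y)"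
      using push_diff[of k "act w ` n"] push_diff[of k "act w ` n'"] b e by (auto simp: \<Theta>_def)
  qed
qed

lemma residually_finite_W: "residually_finite W"
  unfolding residually_finite_def
proof
  fix g assume g: "g \<in> carrier W - {\<one>\<^bsub>W\<^esub>}"
  obtain m w where e: "g = (m, w)" by force
  show "\<exists>(F :: nat monoid) \<phi>. group F \<and> finite (carrier F) \<and> \<phi> \<in> hom W F \<and> \<phi> g \<noteq> \<one>\<^bsub>F\<^esub>"
    using separate_word[of m w] separate_base[of m] g e by (cases "w = []") auto
qed

section \<open>Automorphisms of the semidirect product\<close>

lemma word_act_Nil [simp]: "word_act g [] = (\<lambda>y. y)"
  by (simp add: fun_eq_iff)

lemma autoD:
  assumes "\<phi> \<in> auto W"
  shows "\<phi> \<in> hom W W" "inj_on \<phi> (carrier W)" "\<phi> ` carrier W = carrier W" "\<phi> \<in> extensional (carrier W)"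
  using assms by (auto simp: auto_def Bij_def bij_betw_def)

lemma auto_closed: "\<phi> \<in> auto W \<Longrightarrow> x \<in> carrier W \<Longrightarrow> \<phi> x \<in> carrier W"
  using hom_in_carrier[OF autoD(1)] .

lemma auto_mult:
  "\<phi> \<in> auto W \<Longrightarrow> x \<in> carrier W \<Longrightarrow> y \<in> carrier W \<Longrightarrow> \<phi> (x \<otimes>\<^bsub>W\<^esub> y) = \<phi> x \<otimes>\<^bsub>W\<^esub> \<phi> y"
  using hom_mult[OF autoD(1)] .

lemma auto_one: "\<phi> \<in> auto W \<Longrightarrow> \<phi> \<one>\<^bsub>W\<^esub> = \<one>\<^bsub>W\<^esub>"
  using hom_one[OF autoD(1) group_W group_W] .

lemma auto_inv:
  "\<phi> \<in> auto W \<Longrightarrow> x \<in> carrier W \<Longrightarrow> \<phi> (inv\<^bsub>W\<^esub> x) = inv\<^bsub>W\<^esub> \<phi> x"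
  using group_hom.hom_inv[of W W \<phi> x] autoD(1)[of \<phi>] group_W
  by (simp add: group_hom_def group_hom_axioms_def)

interpretation A: group "AutoGroup W" by (rule W.AutoGroup)

abbreviation auto_mult_op (infixl \<open>\<bullet>\<close> 70) where
  "\<phi> \<bullet> \<psi> \<equiv> \<phi> \<otimes>\<^bsub>AutoGroup W\<^esub> \<psi>"

lemma A_apply:
  "\<phi> \<in> auto W \<Longrightarrow> \<psi> \<in> auto W \<Longrightarrow> x \<in> carrier W \<Longrightarrow> (\<phi> \<bullet> \<psi>) x = \<phi> (\<psi> x)"
  by (simp add: W.mult_AutoGroup compose_def)

lemma A_closed: "\<phi> \<in> auto W \<Longrightarrow> \<psi> \<in> auto W \<Longrightarrow> \<phi> \<bullet> \<psi> \<in> auto W"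
  using A.m_closed by (simp add: W.carrier_AutoGroup)

lemma A_inv_closed: "\<phi> \<in> auto W \<Longrightarrow> inv\<^bsub>AutoGroup W\<^esub> \<phi> \<in> auto W"
  using A.inv_closed by (simp add: W.carrier_AutoGroup)

lemma A_inv_apply:
  assumes "\<phi> \<in> auto W" "x \<in> carrier W"
  shows "(inv\<^bsub>AutoGroup W\<^esub> \<phi>) (\<phi> x) = x"
proof -
  have "(inv\<^bsub>AutoGroup W\<^esub> \<phi> \<bullet> \<phi>) x = x"
    using A.l_inv[of \<phi>] assms by (simp add: W.carrier_AutoGroup W.one_AutoGroup)
  then show ?thesis using A_apply A_inv_closed assms by simp
qed

lemma aut_eqI:
  assumes "\<phi> \<in> auto W" "\<psi> \<in> auto W" "\<phi> (em {(0, \<one>)}) = \<psi> (em {(0, \<one>)})"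
    and "\<And>s. \<phi> (lw [(s, False)]) = \<psi> (lw [(s, False)])"
  shows "\<phi> = \<psi>"
proof -
  let ?H = "{x \<in> carrier W. \<phi> x = \<psi> x}"
  have "subgroup ?H W"
  proof (rule W.subgroupI)
    have "\<one>\<^bsub>W\<^esub> \<in> ?H" unfolding mem_Collect_eq auto_one[OF assms(1)] auto_one[OF assms(2)] by (rule conjI[OF W.one_closed refl])
    then show "?H \<noteq> {}" by blast
    fix x assume "x \<in> ?H"
    then have x: "x \<in> carrier W" "\<phi> x = \<psi> x" by auto
    show "inv\<^bsub>W\<^esub> x \<in> ?H"
      unfolding mem_Collect_eq auto_inv[OF assms(1) x(1)] auto_inv[OF assms(2) x(1)] x(2)
      by (rule conjI[OF W.inv_closed[OF x(1)] refl])
    fix y assume "y \<in> ?H"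
    then have y: "y \<in> carrier W" "\<phi> y = \<psi> y" by auto
    show "x \<otimes>\<^bsub>W\<^esub> y \<in> ?H"
      unfolding mem_Collect_eq auto_mult[OF assms(1) x(1) y(1)] auto_mult[OF assms(2) x(1) y(1)] x(2) y(2)
      by (rule conjI[OF W.m_closed[OF x(1) y(1)] refl])
  qed blast
  then have "carrier W \<subseteq> ?H"
    by (rule subgroup_eq_carrier) (use assms in \<open>auto simp: in_X\<close>)
  then show ?thesis
    by (intro extensionalityI[OF autoD(4)[OF assms(1)] autoD(4)[OF assms(2)]]) auto
qed

lemma involution_iff:
  assumes "x \<in> carrier W"
  shows "x \<otimes>\<^bsub>W\<^esub> x = \<one>\<^bsub>W\<^esub> \<longleftrightarrow> snd x = []"
proof -
  obtain m w where x: "x = (m, w)" by force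
  show ?thesis using assms x freeprod_no_involution[of w] by auto
qed

text \<open>The restriction of an automorphism to \<open>M\<close>; \<open>pr\<close> below is the
  induced map on the quotient by \<open>M\<close>. Both make sense because \<open>M\<close> is
  characteristic, see \<open>auto_em\<close> and \<open>snd_auto\<close>.\<close>

definition fm :: "((nat \<times> 'c) set \<times> fword \<Rightarrow> (nat \<times> 'c) set \<times> fword) \<Rightarrow> (nat \<times> 'c) set \<Rightarrow> (nat \<times> 'c) set" where
  "fm \<phi> m = fst (\<phi> (em m))"

definition pr :: "((nat \<times> 'c) set \<times> fword \<Rightarrow> (nat \<times> 'c) set \<times> fword) \<Rightarrow> fword \<Rightarrow> fword" where
  "pr \<phi> w = snd (\<phi> (lw w))"

lemma auto_em:
  assumes "\<phi> \<in> auto W" "base m"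
  shows "\<phi> (em m) = em (fm \<phi> m)" "base (fm \<phi> m)"
proof -
  have c: "em m \<in> carrier W" using assms by simp
  have "em m \<otimes>\<^bsub>W\<^esub> em m = \<one>\<^bsub>W\<^esub>" by simp
  then have "\<phi> (em m) \<otimes>\<^bsub>W\<^esub> \<phi> (em m) = \<one>\<^bsub>W\<^esub>"
    using auto_mult[OF assms(1) c c] auto_one[OF assms(1)] by simp
  then have "snd (\<phi> (em m)) = []" using involution_iff auto_closed[OF assms(1) c] by blast
  then show "\<phi> (em m) = em (fm \<phi> m)" by (simp add: fm_def prod_eq_iff)
  then show "base (fm \<phi> m)" using auto_closed[OF assms(1) c] by simp
qed

lemma auto_lw:
  assumes "\<phi> \<in> auto W" "reduced w"
  shows "\<exists>m. \<phi> (lw w) = (m, pr \<phi> w) \<and> base m" "reduced (pr \<phi> w)"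
  using auto_closed[OF assms(1), of "lw w"] assms(2) by (cases "\<phi> (lw w)"; simp add: pr_def)+

lemma snd_auto:
  assumes "\<phi> \<in> auto W" "(m, w) \<in> carrier W"
  shows "snd (\<phi> (m, w)) = pr \<phi> w"
proof -
  have c: "em m \<in> carrier W" "lw w \<in> carrier W" using assms(2) by auto
  have "\<phi> (m, w) = \<phi> (em m) \<otimes>\<^bsub>W\<^esub> \<phi> (lw w)"
    using auto_mult[OF assms(1) c] by simp
  then show ?thesis using auto_em(1)[OF assms(1), of m] assms auto_lw(1)[OF assms(1), of w] by auto
qed

lemma pr_hom:
  assumes "\<phi> \<in> auto W"
  shows "pr \<phi> \<in> hom freeprod freeprod"
proof (rule homI)
  fix v w assume vw: "v \<in> carrier freeprod" "w \<in> carrier freeprod"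
  show "pr \<phi> v \<in> carrier freeprod" using auto_lw(2)[OF assms] vw by simp
  obtain m n where "\<phi> (lw v) = (m, pr \<phi> v)" "\<phi> (lw w) = (n, pr \<phi> w)"
    using auto_lw(1)[OF assms] vw by (metis freeprod_simps(1))
  moreover have "\<phi> (lw (word_act step v w)) = \<phi> (lw v) \<otimes>\<^bsub>W\<^esub> \<phi> (lw w)"
    using auto_mult[OF assms, of "lw v" "lw w"] vw by simp
  ultimately show "pr \<phi> (v \<cdot> w) = pr \<phi> v \<cdot> pr \<phi> w"
    by (simp add: pr_def[of _ "word_act step v w"])
qed

lemma pr_surj:
  assumes "\<phi> \<in> auto W"
  shows "carrier freeprod \<subseteq> pr \<phi> ` carrier freeprod"
proof
  fix w assume "w \<in> carrier freeprod"
  then have "lw w \<in> \<phi> ` carrier W" using autoD(3)[OF assms] by simp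
  then obtain n v where nv: "(n, v) \<in> carrier W" "\<phi> (n, v) = lw w" by force
  then have "pr \<phi> v = w" using snd_auto[OF assms nv(1)] by simp
  then show "w \<in> pr \<phi> ` carrier freeprod" using nv(1) by force
qed

lemma pr_mult:
  assumes "\<phi> \<in> auto W" "\<psi> \<in> auto W" "reduced w"
  shows "pr (\<phi> \<bullet> \<psi>) w = pr \<phi> (pr \<psi> w)"
proof -
  obtain m where m: "\<psi> (lw w) = (m, pr \<psi> w)" "base m" using auto_lw(1)[OF assms(2,3)] by blast
  have c: "(m, pr \<psi> w) \<in> carrier W" using m(2) auto_lw(2)[OF assms(2,3)] by simp
  have "pr (\<phi> \<bullet> \<psi>) w = snd ((\<phi> \<bullet> \<psi>) (lw w))" by (rule pr_def)
  also have "(\<phi> \<bullet> \<psi>) (lw w) = \<phi> (m, pr \<psi> w)"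
    unfolding m(1)[symmetric] by (rule A_apply[OF assms(1,2)]) (use assms(3) in simp)
  also have "snd (\<phi> (m, pr \<psi> w)) = pr \<phi> (pr \<psi> w)" by (rule snd_auto[OF assms(1) c])
  finally show ?thesis .
qed

lemma pr_inv:
  assumes "\<phi> \<in> auto W" "reduced w"
  shows "pr (inv\<^bsub>AutoGroup W\<^esub> \<phi>) (pr \<phi> w) = w"
proof -
  have "pr (inv\<^bsub>AutoGroup W\<^esub> \<phi> \<bullet> \<phi>) w = w"
    using A.l_inv[of \<phi>] assms by (simp add: W.carrier_AutoGroup W.one_AutoGroup pr_def)
  then show ?thesis using pr_mult[OF A_inv_closed[OF assms(1)] assms] by simp
qed

lemma conj_em:
  assumes "(k, w) \<in> carrier W" "base n"
  shows "(k, w) \<otimes>\<^bsub>W\<^esub> em n \<otimes>\<^bsub>W\<^esub> inv\<^bsub>W\<^esub> (k, w) = em (act w ` n)"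
proof -
  have b: "base (act w ` n)" using assms act_image_closed by simp
  have "(k, w) \<otimes>\<^bsub>W\<^esub> em n \<otimes>\<^bsub>W\<^esub> inv\<^bsub>W\<^esub> (k, w) =
      em k \<otimes>\<^bsub>W\<^esub> (lw w \<otimes>\<^bsub>W\<^esub> em n \<otimes>\<^bsub>W\<^esub> inv\<^bsub>W\<^esub> (lw w)) \<otimes>\<^bsub>W\<^esub> inv\<^bsub>W\<^esub> (em k)"
    using W.conj_conj[of "em k" "em n" "lw w"] assms by (simp add: em_mult_lw)
  also have "lw w \<otimes>\<^bsub>W\<^esub> em n \<otimes>\<^bsub>W\<^esub> inv\<^bsub>W\<^esub> (lw w) = em (act w ` n)"
    by (rule lw_conj_em) (use assms in auto)
  also have "em k \<otimes>\<^bsub>W\<^esub> em (act w ` n) \<otimes>\<^bsub>W\<^esub> inv\<^bsub>W\<^esub> (em k) = em (act w ` n)"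
  proof -
    have "sym_diff (sym_diff k N) k = N" for N by blast
    then show ?thesis using assms by (subst inv_em) (auto simp del: Un_iff Diff_iff)
  qed
  finally show ?thesis .
qed

section \<open>Right multiplications as automorphisms\<close>

definition R :: "'c \<Rightarrow> nat \<times> 'c \<Rightarrow> nat \<times> 'c" where
  "R c x = (fst x, snd x \<otimes> inv c)"

lemma R_X: "c \<in> carrier C \<Longrightarrow> x \<in> X \<Longrightarrow> R c x \<in> X"
  by (cases x) (auto simp: R_def X_def)

lemma R_inj: "c \<in> carrier C \<Longrightarrow> inj_on (R c) X"
  by (auto simp: inj_on_def R_def X_def)

lemma R_move: "c \<in> carrier C \<Longrightarrow> x \<in> X \<Longrightarrow> R c (move s x) = move s (R c x)"
  by (cases x) (auto simp: R_def X_def m_assoc)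

lemma R_act: "c \<in> carrier C \<Longrightarrow> x \<in> X \<Longrightarrow> R c (act w x) = act w (R c x)"
proof (induction w)
  case (Cons l w)
  then show ?case using act_closed[of x w]
    by (simp add: letter_act_def R_move move.closed)
qed simp

lemma R_act_image: "c \<in> carrier C \<Longrightarrow> m \<subseteq> X \<Longrightarrow> R c ` act w ` m = act w ` R c ` m"
  by (force simp: image_image R_act subset_iff image_iff)

lemma R_sym_diff:
  assumes "c \<in> carrier C" "m \<subseteq> X" "n \<subseteq> X"
  shows "R c ` sym_diff m n = sym_diff (R c ` m) (R c ` n)"
  using inj_on_image_set_diff[OF R_inj[OF assms(1)], of m n]
    inj_on_image_set_diff[OF R_inj[OF assms(1)], of n m] assms(2,3)
  by (simp add: image_Un Diff_subset[THEN subset_trans])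

definition rho :: "'c \<Rightarrow> (nat \<times> 'c) set \<times> fword \<Rightarrow> (nat \<times> 'c) set \<times> fword" where
  "rho c = (\<lambda>x\<in>carrier W. (R c ` fst x, snd x))"

lemma rho_apply: "(m, w) \<in> carrier W \<Longrightarrow> rho c (m, w) = (R c ` m, w)"
  by (simp add: rho_def)

lemma rho_closed: "c \<in> carrier C \<Longrightarrow> x \<in> carrier W \<Longrightarrow> rho c x \<in> carrier W"
  using R_X by (cases x) (auto simp: rho_def)

lemma rho_inverse:
  assumes "c \<in> carrier C" "x \<in> carrier W"
  shows "rho (inv c) (rho c x) = x"
proof -
  obtain m w where e: "x = (m, w)" by force
  have "R (inv c) (R c y) = y" if "y \<in> m" for y
    using that assms e by (cases y) (auto simp: R_def X_def m_assoc)
  then have "R (inv c) ` R c ` m = m" by (force simp: image_image)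
  moreover have "rho c x \<in> carrier W" by (rule rho_closed[OF assms])
  ultimately show ?thesis using assms e by (simp add: rho_apply)
qed

lemma rho_auto:
  assumes c: "c \<in> carrier C"
  shows "rho c \<in> auto W"
proof -
  have "rho c \<in> hom W W"
  proof (rule homI)
    fix x y assume xy: "x \<in> carrier W" "y \<in> carrier W"
    show "rho c x \<in> carrier W" by (rule rho_closed[OF c xy(1)])
    obtain m v n w where e: "x = (m, v)" "y = (n, w)" by force
    have "act v ` n \<subseteq> X" using xy e act_image_closed by auto
    moreover have "x \<otimes>\<^bsub>W\<^esub> y \<in> carrier W" by (rule W.m_closed[OF xy])
    ultimately show "rho c (x \<otimes>\<^bsub>W\<^esub> y) = rho c x \<otimes>\<^bsub>W\<^esub> rho c y"
      using xy e R_sym_diff[OF c, of m "act v ` n"] R_act_image[OF c, of n v] by (simp add: rho_apply)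
  qed
  moreover have "bij_betw (rho c) (carrier W) (carrier W)"
  proof (rule bij_betw_byWitness[where f' = "rho (inv c)"])
    show "\<forall>x\<in>carrier W. rho (inv c) (rho c x) = x" using rho_inverse[OF c] by blast
    show "\<forall>x\<in>carrier W. rho c (rho (inv c) x) = x" using rho_inverse[of "inv c"] c by simp
    show "rho c ` carrier W \<subseteq> carrier W" using rho_closed[OF c] by blast
    show "rho (inv c) ` carrier W \<subseteq> carrier W" using rho_closed[of "inv c"] c by blast
  qed
  ultimately show ?thesis by (simp add: auto_def Bij_def rho_def)
qed

lemma rho_origin: "c \<in> carrier C \<Longrightarrow> rho c (em {(0, \<one>)}) = em {(0, inv c)}"
  by (subst rho_apply) (auto simp: in_X R_def)

lemma rho_lw: "reduced w \<Longrightarrow> rho c (lw w) = lw w"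
  by (simp add: rho_apply)

text \<open>The inverse in \<open>R\<close> compensates the reversal of order in right
  multiplication.\<close>

lemma rho_hom: "rho \<in> hom C (AutoGroup W)"
proof (rule homI)
  fix c d assume cd: "c \<in> carrier C" "d \<in> carrier C"
  show "rho c \<in> carrier (AutoGroup W)" using rho_auto cd by (simp add: W.carrier_AutoGroup)
  show "rho (c \<otimes> d) = rho c \<bullet> rho d"
  proof (rule aut_eqI)
    have "rho c (em {(0, inv d)}) = em {(0, inv d \<otimes> inv c)}"
      using cd by (subst rho_apply) (auto simp: in_X R_def)
    then show "rho (c \<otimes> d) (em {(0, \<one>)}) = (rho c \<bullet> rho d) (em {(0, \<one>)})"
      using cd by (subst A_apply) (auto simp: rho_auto rho_origin in_X inv_mult_group)
  qed (use cd in \<open>auto simp: rho_auto A_closed A_apply rho_lw\<close>)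
qed

text \<open>\<open>rho c\<close> fixes every \<open>lw w\<close>, so the free product part of a
  conjugating element is central, hence trivial. Conjugation by an element of the abelian group
  \<open>M\<close> fixes the origin, and \<open>rho c\<close> does so only for
  \<open>c = \<one>\<close>.\<close>

lemma rho_inner:
  assumes c: "c \<in> carrier C" and inner: "rho c \<in> inner_auto W"
  shows "c = \<one>"
proof -
  obtain g where g: "g \<in> carrier W" "rho c = (\<lambda>x\<in>carrier W. g \<otimes>\<^bsub>W\<^esub> x \<otimes>\<^bsub>W\<^esub> inv\<^bsub>W\<^esub> g)"
    using inner by (auto simp: inner_auto_def)
  obtain m w where e: "g = (m, w)" by force
  have "w = []"
  proof (rule freeprod_centre)
    show "reduced w" using g e by simp
    fix s
    have l: "lw [(s, False)] \<in> carrier W" by simp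
    have "g \<otimes>\<^bsub>W\<^esub> lw [(s, False)] \<otimes>\<^bsub>W\<^esub> inv\<^bsub>W\<^esub> g = lw [(s, False)]"
      using rho_lw[of "[(s, False)]" c] unfolding g(2) restrict_apply'[OF l] by simp
    then have "g \<otimes>\<^bsub>W\<^esub> lw [(s, False)] = lw [(s, False)] \<otimes>\<^bsub>W\<^esub> g"
      by (rule W.inv_solve_right'[THEN iffD1, rotated 3]) (intro W.m_closed g(1) l)+
    then show "w \<cdot> [(s, False)] = [(s, False)] \<cdot> w"
      using e by simp
  qed
  have o: "em {(0, \<one>)} \<in> carrier W" by (simp add: in_X)
  have "em {(0, inv c)} = g \<otimes>\<^bsub>W\<^esub> em {(0, \<one>)} \<otimes>\<^bsub>W\<^esub> inv\<^bsub>W\<^esub> g"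
    unfolding rho_origin[OF c, symmetric] g(2) by (rule restrict_apply'[OF o])
  also have "\<dots> = em {(0, \<one>)}"
    using conj_em[of m w "{(0, \<one>)}"] g(1) e \<open>w = []\<close> by (simp add: in_X)
  finally show ?thesis using c by simp
qed

section \<open>Automorphisms trivial on the base and modulo it\<close>

definition dgen :: "(nat \<times> 'c) set \<Rightarrow> bool \<Rightarrow> (nat \<times> 'c) set \<times> fword" where
  "dgen m s = (if s then em m \<otimes>\<^bsub>W\<^esub> lw [(True, False)] \<otimes>\<^bsub>W\<^esub> inv\<^bsub>W\<^esub> em m else lw [(False, False)])"

text \<open>The crossed homomorphism into \<open>M\<close> that vanishes on \<open>u\<close> and
  takes the value \<open>m + v m\<close> on \<open>v\<close>. It comes from lifting the generators
  to \<open>u\<close> and a conjugate of \<open>v\<close> in \<open>W\<close>; both have cube 1, so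
  the universal property applies.\<close>

definition D :: "(nat \<times> 'c) set \<Rightarrow> fword \<Rightarrow> (nat \<times> 'c) set" where
  "D m w = fst (freeprod_lift W (dgen m) w)"

lemma dgen_True: "base m \<Longrightarrow> dgen m True = (sym_diff m (act [(True, False)] ` m), [(True, False)])"
  using F.r_one[of "[(True, False)]"] by (simp add: dgen_def inv_em del: word_act_simps(2))

lemma dgen_closed: "base m \<Longrightarrow> dgen m s \<in> carrier W"
  unfolding dgen_def by (auto simp del: mult_W intro!: W.m_closed W.inv_closed)

lemma dgen_cube:
  assumes "base m"
  shows "dgen m s \<otimes>\<^bsub>W\<^esub> dgen m s \<otimes>\<^bsub>W\<^esub> dgen m s = \<one>\<^bsub>W\<^esub>"
proof -
  have l: "lw [(r, False)] \<otimes>\<^bsub>W\<^esub> lw [(r, False)] \<otimes>\<^bsub>W\<^esub> lw [(r, False)] = \<one>\<^bsub>W\<^esub>" for r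
    by (simp add: letter_act_def)
  have c: "em m \<in> carrier W" "lw [(True, False)] \<in> carrier W" using assms by auto
  let ?v = "lw [(True, False)]"
  have "dgen m True \<otimes>\<^bsub>W\<^esub> dgen m True \<otimes>\<^bsub>W\<^esub> dgen m True =
     em m \<otimes>\<^bsub>W\<^esub> (?v \<otimes>\<^bsub>W\<^esub> ?v \<otimes>\<^bsub>W\<^esub> ?v) \<otimes>\<^bsub>W\<^esub> inv\<^bsub>W\<^esub> em m"
    unfolding dgen_def if_True W.conj_mult[OF c c(2)] W.conj_mult[OF c(1) W.m_closed[OF c(2) c(2)] c(2)] ..
  also have "\<dots> = \<one>\<^bsub>W\<^esub>" unfolding l W.r_one[OF c(1)] by (rule W.r_inv[OF c(1)])
  finally show ?thesis using l[of False] by (cases s) (auto simp: dgen_def)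
qed

lemma lift_dgen:
  assumes m: "base m"
  shows "freeprod_lift W (dgen m) \<in> hom freeprod W"
    and "reduced w \<Longrightarrow> freeprod_lift W (dgen m) w = (D m w, w)"
proof -
  show h: "freeprod_lift W (dgen m) \<in> hom freeprod W"
    by (rule W.freeprod_lift_hom) (rule dgen_closed[OF m], rule dgen_cube[OF m])
  have sh: "snd \<in> hom W freeprod"
    by (rule homI) auto
  assume w: "reduced w"
  have "(snd \<circ> freeprod_lift W (dgen m)) w = id w"
  proof (rule hom_freeprod_eq[OF group_freeprod _ _ _ w])
    show "snd \<circ> freeprod_lift W (dgen m) \<in> hom freeprod freeprod" by (rule Group.hom_compose[OF h sh])
    show "id \<in> hom freeprod freeprod" by (auto simp: hom_def reduced_mult)
    show "(snd \<circ> freeprod_lift W (dgen m)) [(s, False)] = id [(s, False)]" for s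
      using W.freeprod_lift_gen[of "dgen m" s, OF dgen_closed[OF m]] dgen_True[OF m]
      by (cases s) (simp_all add: dgen_def)
  qed
  then show "freeprod_lift W (dgen m) w = (D m w, w)" by (simp add: D_def prod_eq_iff)
qed

lemma D_base: "base m \<Longrightarrow> reduced w \<Longrightarrow> base (D m w)"
  using hom_in_carrier[OF lift_dgen(1), of m w] by (simp add: lift_dgen(2))

lemma D_mult:
  assumes "base m" "reduced v" "reduced w"
  shows "D m (word_act step v w) = sym_diff (D m v) (act v ` D m w)"
  using hom_mult[OF lift_dgen(1)[OF assms(1)], of v w] assms by (simp add: lift_dgen(2) reduced_mult)

lemma D_gen: "base m \<Longrightarrow> D m [] = {}" "base m \<Longrightarrow> D m [(False, False)] = {}"
  "base m \<Longrightarrow> D m [(True, False)] = sym_diff m (act [(True, False)] ` m)"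
proof -
  assume m: "base m"
  show "D m [] = {}" by (simp add: D_def freeprod_lift_def)
  show "D m [(False, False)] = {}"
    using W.freeprod_lift_gen[of "dgen m" False, OF dgen_closed[OF m]] by (simp add: D_def dgen_def)
  show "D m [(True, False)] = sym_diff m (act [(True, False)] ` m)"
    using W.freeprod_lift_gen[of "dgen m" True, OF dgen_closed[OF m]] dgen_True[OF m] by (simp add: D_def)
qed

lemma base_sym_diff: "base m \<Longrightarrow> base n \<Longrightarrow> base (sym_diff m n)"
  by auto

lemma base_act: "base m \<Longrightarrow> base (act w ` m)"
  using act_image_closed by simp

definition delta :: "(nat \<times> 'c) set \<Rightarrow> (nat \<times> 'c) set \<times> fword \<Rightarrow> (nat \<times> 'c) set \<times> fword" where
  "delta m = (\<lambda>x\<in>carrier W. (sym_diff (fst x) (D m (snd x)), snd x))"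

lemma delta_apply: "(n, w) \<in> carrier W \<Longrightarrow> delta m (n, w) = (sym_diff n (D m w), w)"
  by (simp add: delta_def)

text \<open>\<open>D m\<close> being a crossed homomorphism makes \<open>delta m\<close>
  multiplicative, and characteristic 2 makes \<open>delta m\<close> its own inverse.\<close>

lemma delta_auto:
  assumes m: "base m"
  shows "delta m \<in> auto W"
proof -
  have cl: "delta m x \<in> carrier W" if "x \<in> carrier W" for x
  proof -
    obtain n w where e: "x = (n, w)" by force
    then have "base (sym_diff n (D m w))" using that by (intro base_sym_diff D_base m) auto
    then show ?thesis using that by (simp add: e delta_apply)
  qed
  have inv: "delta m (delta m x) = x" if "x \<in> carrier W" for x
  proof -
    obtain n w where e: "x = (n, w)" by force
    have "(sym_diff n (D m w), w) \<in> carrier W" using cl[OF that] that e by (simp add: delta_apply)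
    moreover have "sym_diff (sym_diff n N) N = n" for N by blast
    ultimately show ?thesis using that unfolding e by (simp only: delta_apply)
  qed
  have "delta m \<in> hom W W"
  proof (rule homI)
    fix x y assume xy: "x \<in> carrier W" "y \<in> carrier W"
    show "delta m x \<in> carrier W" by (rule cl[OF xy(1)])
    obtain n v k w where e: "x = (n, v)" "y = (k, w)" by force
    have b: "base k" "base (D m w)" "reduced v" "reduced w" using D_base[OF m, of w] xy e by auto
    have 1: "x \<otimes>\<^bsub>W\<^esub> y = (sym_diff n (act v ` k), word_act step v w)" using e by simp
    have "x \<otimes>\<^bsub>W\<^esub> y \<in> carrier W" by (rule W.m_closed[OF xy])
    then have "delta m (x \<otimes>\<^bsub>W\<^esub> y) =
        (sym_diff (sym_diff n (act v ` k)) (sym_diff (D m v) (act v ` D m w)), word_act step v w)"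
      unfolding 1 D_mult[OF m b(3,4), symmetric] by (rule delta_apply)
    also have "\<dots> = (sym_diff (sym_diff n (D m v)) (act v ` sym_diff k (D m w)), word_act step v w)"
    proof -
      have "act v ` sym_diff k (D m w) = sym_diff (act v ` k) (act v ` D m w)"
        by (rule act_sym_diff) (use b in auto)
      moreover have "sym_diff (sym_diff n K) (sym_diff A B) = sym_diff (sym_diff n A) (sym_diff K B)" for K A B
        by blast
      ultimately show ?thesis by (simp only:)
    qed
    also have "\<dots> = delta m x \<otimes>\<^bsub>W\<^esub> delta m y"
      unfolding e delta_apply[OF xy(1)[unfolded e]] delta_apply[OF xy(2)[unfolded e]] mult_W ..
    finally show "delta m (x \<otimes>\<^bsub>W\<^esub> y) = delta m x \<otimes>\<^bsub>W\<^esub> delta m y" .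
  qed
  moreover have "bij_betw (delta m) (carrier W) (carrier W)"
    by (rule bij_betw_byWitness[where f' = "delta m"]) (use cl inv in blast)+
  ultimately show ?thesis by (simp add: auto_def Bij_def delta_def)
qed

lemma delta_em: "base m \<Longrightarrow> base n \<Longrightarrow> delta m (em n) = em n"
  by (simp add: delta_apply D_gen)

lemma delta_lw: "base m \<Longrightarrow> delta m (lw [(False, False)]) = lw [(False, False)]"
  "base m \<Longrightarrow> delta m (lw [(True, False)]) = (sym_diff m (act [(True, False)] ` m), [(True, False)])"
  by (simp_all add: delta_apply D_gen)

lemma delta_mult:
  assumes "base m" "base n"
  shows "delta (sym_diff m n) = delta m \<bullet> delta n"
proof (rule aut_eqI)
  let ?v = "[(True, False)]"
  note mn = base_sym_diff[OF assms]
  show "delta (sym_diff m n) \<in> auto W" by (rule delta_auto[OF mn])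
  show "delta m \<bullet> delta n \<in> auto W" by (intro A_closed delta_auto assms)
  have o: "base {(0, \<one>)}" by (simp add: in_X)
  show "delta (sym_diff m n) (em {(0, \<one>)}) = (delta m \<bullet> delta n) (em {(0, \<one>)})"
    using A_apply[OF delta_auto[OF assms(1)] delta_auto[OF assms(2)], of "em {(0, \<one>)}"] o
    by (simp add: delta_em[OF mn o] delta_em[OF assms(1) o] delta_em[OF assms(2) o])
  fix s
  have "delta (sym_diff m n) (lw ?v) = (sym_diff (sym_diff m n) (act ?v ` sym_diff m n), ?v)"
    by (rule delta_lw(2)[OF mn])
  also have "act ?v ` sym_diff m n = sym_diff (act ?v ` m) (act ?v ` n)"
    by (rule act_sym_diff) (use assms in auto)
  also have "sym_diff (sym_diff m n) (sym_diff (act ?v ` m) (act ?v ` n)) =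
     sym_diff (sym_diff n (act ?v ` n)) (sym_diff m (act ?v ` m))" by blast
  also have "(\<dots>, ?v) = delta m (sym_diff n (act ?v ` n), ?v)"
    unfolding D_gen(3)[OF assms(1), symmetric]
    by (rule delta_apply[symmetric]) (use base_sym_diff[OF assms(2) base_act[OF assms(2), of ?v]] in simp)
  also have "\<dots> = (delta m \<bullet> delta n) (lw ?v)"
    using A_apply[OF delta_auto[OF assms(1)] delta_auto[OF assms(2)], of "lw ?v"] delta_lw(2)[OF assms(2)]
    by simp
  finally have "delta (sym_diff m n) (lw ?v) = (delta m \<bullet> delta n) (lw ?v)" .
  moreover have "delta (sym_diff m n) (lw [(False, False)]) = (delta m \<bullet> delta n) (lw [(False, False)])"
    using A_apply[OF delta_auto[OF assms(1)] delta_auto[OF assms(2)], of "lw [(False, False)]"]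
    by (simp add: delta_lw(1)[OF mn] delta_lw(1)[OF assms(1)] delta_lw(1)[OF assms(2)])
  ultimately show "delta (sym_diff m n) (lw [(s, False)]) = (delta m \<bullet> delta n) (lw [(s, False)])"
    by (cases s) simp_all
qed

text \<open>Conjugation by \<open>rho c\<close> translates \<open>m\<close>. This is why three
  \<open>delta\<close>s, one for each copy, suffice as generators.\<close>

lemma rho_delta:
  assumes c: "c \<in> carrier C" and m: "base m"
  shows "rho c \<bullet> delta m = delta (R c ` m) \<bullet> rho c"
proof (rule aut_eqI)
  let ?v = "[(True, False)]"
  have Rm: "base (R c ` m)" using m R_X[OF c] by auto
  note cl = rho_auto[OF c] delta_auto[OF m] delta_auto[OF Rm]
  show "rho c \<bullet> delta m \<in> auto W" "delta (R c ` m) \<bullet> rho c \<in> auto W"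
    by (intro A_closed cl)+
  have o: "base {(0, \<one>)}" "base {(0, inv c)}" using c by (simp_all add: in_X)
  then show "(rho c \<bullet> delta m) (em {(0, \<one>)}) = (delta (R c ` m) \<bullet> rho c) (em {(0, \<one>)})"
    by (simp add: A_apply cl delta_em m Rm rho_origin c)
  fix s
  have "rho c (sym_diff m (act ?v ` m), ?v) = (R c ` sym_diff m (act ?v ` m), ?v)"
    by (rule rho_apply) (use base_sym_diff[OF m base_act[OF m, of ?v]] in simp)
  also have "R c ` sym_diff m (act ?v ` m) = sym_diff (R c ` m) (act ?v ` R c ` m)"
    using R_sym_diff[OF c, of m "act ?v ` m"] R_act_image[OF c, of m ?v] m base_act[OF m, of ?v] by simp
  finally have "(rho c \<bullet> delta m) (lw ?v) = (delta (R c ` m) \<bullet> rho c) (lw ?v)"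
    using delta_lw(2)[OF m] delta_lw(2)[OF Rm] by (simp add: A_apply cl rho_lw)
  moreover have "(rho c \<bullet> delta m) (lw [(False, False)]) = (delta (R c ` m) \<bullet> rho c) (lw [(False, False)])"
    using delta_lw(1)[OF m] delta_lw(1)[OF Rm] by (simp add: A_apply cl rho_lw)
  ultimately show "(rho c \<bullet> delta m) (lw [(s, False)]) = (delta (R c ` m) \<bullet> rho c) (lw [(s, False)])"
    by (cases s) simp_all
qed

text \<open>The left order makes \<open>C\<close> a group with two unique products, hence its group ring over
  \<open>\<int>/2\<close> has only trivial units.\<close>

lemma ex_extremal:
  assumes "finite S" "S \<noteq> {}" "S \<subseteq> U"
    and tr: "\<And>x y z. \<lbrakk>x \<in> U; y \<in> U; z \<in> U; L x y; L y z\<rbrakk> \<Longrightarrow> L x z"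
    and tot: "\<And>x y. \<lbrakk>x \<in> U; y \<in> U\<rbrakk> \<Longrightarrow> x = y \<or> L x y \<or> L y x"
  shows "\<exists>x\<in>S. \<forall>y\<in>S. y = x \<or> L y x"
  using assms(1-3)
proof (induction S rule: finite_ne_induct)
  case (insert x S)
  then obtain z where z: "z \<in> S" "\<forall>y\<in>S. y = z \<or> L y z" by auto
  have U: "x \<in> U" "z \<in> U" using insert z by auto
  consider "x = z \<or> L x z" | "L z x" using tot[OF U] by blast
  then show ?case
  proof cases
    case 1
    then show ?thesis using z by (intro bexI[of _ z]) auto
  next
    case 2
    have "y = x \<or> L y x" if "y \<in> S" for y
    proof (cases "y = z")
      case False
      then have "L y z" using z(2) that by blast
      then show ?thesis using 2 tr[of y z x] U insert.prems that by auto
    qed (use 2 in simp)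
    then show ?thesis by (intro bexI[of _ x]) auto
  qed
qed auto

text \<open>Let \<open>y\<close> be greatest in \<open>T\<close> and \<open>x y\<close> greatest in
  \<open>S y\<close>; for \<open>y' \<noteq> y\<close> in \<open>T\<close>, left invariance gives
  \<open>x' y' < x' y \<le> x y\<close>. The order need not be right invariant, so \<open>x\<close>
  is chosen after multiplication by \<open>y\<close> and not as the greatest element of
  \<open>S\<close>.\<close>

lemma extremal_product:
  assumes "finite S" "S \<noteq> {}" "S \<subseteq> carrier C" "finite T" "T \<noteq> {}" "T \<subseteq> carrier C"
    and tr: "\<And>x y z. \<lbrakk>x \<in> carrier C; y \<in> carrier C; z \<in> carrier C; L x y; L y z\<rbrakk> \<Longrightarrow> L x z"
    and tot: "\<And>x y. \<lbrakk>x \<in> carrier C; y \<in> carrier C\<rbrakk> \<Longrightarrow> x = y \<or> L x y \<or> L y x"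
    and irr: "\<And>x. x \<in> carrier C \<Longrightarrow> \<not> L x x"
    and left: "\<And>x y z. \<lbrakk>x \<in> carrier C; y \<in> carrier C; z \<in> carrier C; L x y\<rbrakk> \<Longrightarrow> L (z \<otimes> x) (z \<otimes> y)"
  shows "\<exists>x\<in>S. \<exists>y\<in>T. (\<forall>z\<in>T. z = y \<or> L z y) \<and> (\<forall>x'\<in>S. \<forall>y'\<in>T. x' \<otimes> y' = x \<otimes> y \<longrightarrow> x' = x \<and> y' = y)"
proof -
  obtain y where y: "y \<in> T" "\<forall>z\<in>T. z = y \<or> L z y"
    using ex_extremal[OF assms(4-6), of L] tr tot by blast
  let ?Sy = "(\<lambda>x. x \<otimes> y) ` S"
  have "?Sy \<subseteq> carrier C" "finite ?Sy" "?Sy \<noteq> {}" using assms(1-3,6) y by auto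
  then obtain p where p: "p \<in> ?Sy" "\<forall>z\<in>?Sy. z = p \<or> L z p"
    using ex_extremal[of ?Sy "carrier C" L] tr tot by blast
  then obtain x where x: "x \<in> S" "p = x \<otimes> y" by blast
  have c: "x \<in> carrier C" "y \<in> carrier C" using x y assms(3,6) by auto
  have "x' = x \<and> y' = y" if xy: "x' \<in> S" "y' \<in> T" "x' \<otimes> y' = x \<otimes> y" for x' y'
  proof -
    have c': "x' \<in> carrier C" "y' \<in> carrier C" using xy assms(3,6) by auto
    have le: "x' \<otimes> y = x \<otimes> y \<or> L (x' \<otimes> y) (x \<otimes> y)" using p(2) x xy(1) by blast
    have "y' = y"
    proof (rule ccontr)
      assume "y' \<noteq> y"
      then have "L (x' \<otimes> y') (x' \<otimes> y)" using left[OF c'(2) c(2) c'(1)] y(2) xy(2) by blast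
      then have "L (x' \<otimes> y') (x \<otimes> y)"
        using le tr[OF m_closed[OF c'] m_closed[OF c'(1) c(2)] m_closed[OF c]] by auto
      then show False using irr[of "x \<otimes> y"] xy(3) c by simp
    qed
    then show ?thesis using xy(3) c c' by simp
  qed
  then show ?thesis using x y by blast
qed

text \<open>\<open>extremal_product\<close> for the order and for its reverse. The right factors of
  the two unique products are the greatest and the least element of \<open>T\<close>, which coincide
  only if \<open>T\<close> is a singleton.\<close>

lemma unique_products:
  assumes "finite S" "S \<noteq> {}" "S \<subseteq> carrier C" "finite T" "T \<noteq> {}" "T \<subseteq> carrier C"
  shows "\<exists>x\<in>S. \<exists>y\<in>T. \<exists>x0\<in>S. \<exists>y0\<in>T.
    (\<forall>x'\<in>S. \<forall>y'\<in>T. x' \<otimes> y' = x \<otimes> y \<longrightarrow> x' = x \<and> y' = y) \<and>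
    (\<forall>x'\<in>S. \<forall>y'\<in>T. x' \<otimes> y' = x0 \<otimes> y0 \<longrightarrow> x' = x0 \<and> y' = y0) \<and> (y = y0 \<longrightarrow> T = {y})"
proof -
  define L where "L x y \<longleftrightarrow> inv x \<otimes> y \<in> P" for x y
  have tr: "L x z" if "x \<in> carrier C" "y \<in> carrier C" "z \<in> carrier C" "L x y" "L y z" for x y z
  proof -
    have "(inv x \<otimes> y) \<otimes> (inv y \<otimes> z) = inv x \<otimes> (y \<otimes> (inv y \<otimes> z))" using that by (simp add: m_assoc)
    also have "y \<otimes> (inv y \<otimes> z) = z" using that by (simp flip: m_assoc)
    finally show ?thesis using P_mult that(4,5) unfolding L_def by metis
  qed
  have tot: "x = y \<or> L x y \<or> L y x" if "x \<in> carrier C" "y \<in> carrier C" for x y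
  proof -
    have "inv (inv x \<otimes> y) = inv y \<otimes> x" using that by (simp add: inv_mult_group)
    moreover have "inv x \<otimes> y = \<one> \<Longrightarrow> x = y" using that by (metis inv_closed inv_equality inv_inv)
    ultimately show ?thesis using P_total[of "inv x \<otimes> y"] that unfolding L_def by auto
  qed
  have irr: "\<not> L x x" if "x \<in> carrier C" for x
    using that P_one by (simp add: L_def)
  have left: "L (z \<otimes> x) (z \<otimes> y)" if "x \<in> carrier C" "y \<in> carrier C" "z \<in> carrier C" "L x y" for x y z
  proof -
    have "inv (z \<otimes> x) \<otimes> (z \<otimes> y) = inv x \<otimes> (inv z \<otimes> (z \<otimes> y))" using that by (simp add: inv_mult_group m_assoc)
    also have "inv z \<otimes> (z \<otimes> y) = y" using that by (simp flip: m_assoc)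
    finally show ?thesis using that(4) unfolding L_def by simp
  qed
  obtain x y where xy: "x \<in> S" "y \<in> T" "\<forall>z\<in>T. z = y \<or> L z y"
    "\<forall>x'\<in>S. \<forall>y'\<in>T. x' \<otimes> y' = x \<otimes> y \<longrightarrow> x' = x \<and> y' = y"
    using extremal_product[OF assms, of L] tr tot irr left by blast
  have "\<exists>x\<in>S. \<exists>y\<in>T. (\<forall>z\<in>T. z = y \<or> L y z) \<and> (\<forall>x'\<in>S. \<forall>y'\<in>T. x' \<otimes> y' = x \<otimes> y \<longrightarrow> x' = x \<and> y' = y)"
  proof (rule extremal_product[OF assms, of "\<lambda>x y. L y x"])
    show "L z x" if "x \<in> carrier C" "y \<in> carrier C" "z \<in> carrier C" "L y x" "L z y" for x y z
      by (rule tr[OF that(3,2,1,5,4)])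
    show "x = y \<or> L y x \<or> L x y" if "x \<in> carrier C" "y \<in> carrier C" for x y
      using tot[OF that] by blast
    show "\<not> L x x" if "x \<in> carrier C" for x by (rule irr[OF that])
    show "L (z \<otimes> y) (z \<otimes> x)" if "x \<in> carrier C" "y \<in> carrier C" "z \<in> carrier C" "L y x" for x y z
      by (rule left[OF that(2,1,3,4)])
  qed
  then obtain x0 y0 where xy0: "x0 \<in> S" "y0 \<in> T" "\<forall>z\<in>T. z = y0 \<or> L y0 z"
    "\<forall>x'\<in>S. \<forall>y'\<in>T. x' \<otimes> y' = x0 \<otimes> y0 \<longrightarrow> x' = x0 \<and> y' = y0"
    by blast
  have "T = {y}" if "y = y0"
  proof -
    have "z = y" if z: "z \<in> T" for z
    proof (rule ccontr)
      assume "z \<noteq> y"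
      then have "L z y" "L y z" using xy(3) xy0(3) z \<open>y = y0\<close> by auto
      then show False using tr[of z y z] irr[of z] assms(6) xy(2) z by auto
    qed
    then show ?thesis using xy(2) by blast
  qed
  then show ?thesis using xy xy0 by blast
qed

text \<open>Powers of a positive element are positive. Consequently a word that acts on a copy by
  some \<open>c \<noteq> \<one>\<close> has only infinite orbits there.\<close>

lemma infinite_order:
  assumes "c \<in> carrier C" "c \<noteq> \<one>"
  shows "inj (\<lambda>n::nat. c [^] n)"
proof -
  have P: "x [^] (Suc n) \<in> P" if "x \<in> P" "x \<in> carrier C" for x and n :: nat
    by (induction n) (use that P_mult in auto)
  have ne: "c [^] (Suc n) \<noteq> \<one>" for n :: nat
  proof
    assume 1: "c [^] (Suc n) = \<one>"
    then have "inv c [^] (Suc n) = \<one>" using nat_pow_inv[OF assms(1), of "Suc n"] by simp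
    then show False using P_total[OF assms(1)] P[of c n] P[of "inv c" n] assms 1 P_one by auto
  qed
  have lt: "c [^] m \<noteq> c [^] n" if "m < n" for m n :: nat
  proof
    assume eq: "c [^] m = c [^] n"
    obtain k where k: "n = m + Suc k" using \<open>m < n\<close> by (metis add_Suc_right less_iff_Suc_add)
    have "c [^] m \<otimes> c [^] Suc k = c [^] m"
      unfolding nat_pow_mult[OF assms(1)] k[symmetric] by (rule eq[symmetric])
    then show False using ne[of k] assms(1) l_cancel_one nat_pow_closed by blast
  qed
  show ?thesis by (rule linorder_injI) (rule lt)
qed

section \<open>Module endomorphisms of the base\<close>

definition equivariant :: "((nat \<times> 'c) set \<Rightarrow> (nat \<times> 'c) set) \<Rightarrow> bool" where
  "equivariant f \<longleftrightarrow> (\<forall>m. base m \<longrightarrow> base (f m)) \<and>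
     (\<forall>m n. base m \<longrightarrow> base n \<longrightarrow> f (sym_diff m n) = sym_diff (f m) (f n)) \<and>
     (\<forall>w m. reduced w \<longrightarrow> base m \<longrightarrow> f (act w ` m) = act w ` f m)"

lemma equivariantD:
  assumes "equivariant f"
  shows "base m \<Longrightarrow> base (f m)"
    and "base m \<Longrightarrow> base n \<Longrightarrow> f (sym_diff m n) = sym_diff (f m) (f n)"
    and "reduced w \<Longrightarrow> base m \<Longrightarrow> f (act w ` m) = act w ` f m"
proof -
  note eq = assms[unfolded equivariant_def]
  show "base m \<Longrightarrow> base (f m)" by (rule eq[THEN conjunct1, rule_format])
  show "base m \<Longrightarrow> base n \<Longrightarrow> f (sym_diff m n) = sym_diff (f m) (f n)"
    by (rule eq[THEN conjunct2, THEN conjunct1, rule_format])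
  show "reduced w \<Longrightarrow> base m \<Longrightarrow> f (act w ` m) = act w ` f m"
    by (rule eq[THEN conjunct2, THEN conjunct2, rule_format])
qed

lemma base_origin: "base {(0, \<one>)}"
  by (simp add: in_X)

text \<open>The asymmetric word fixes the origin, hence preserves the finite set
  \<open>f {(0, \<one>)}\<close>. On copies 1 and 2 it has only infinite orbits, so this set lies in
  copy 0.\<close>

lemma equivariant_origin:
  assumes "equivariant f"
  shows "\<exists>S. finite S \<and> S \<subseteq> carrier C \<and> f {(0, \<one>)} = Pair 0 ` S"
proof -
  obtain w c1 c2 where w: "reduced w" "fixes_piece w 0 \<one>" "fixes_piece w 1 c1" "fixes_piece w 2 c2"
    and ne: "c1 \<noteq> \<one>" "c2 \<noteq> \<one>" using ex_asymmetric_word by blast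
  let ?f = "f {(0, \<one>)}"
  have b: "base ?f" by (rule equivariantD(1)[OF assms base_origin])
  have "act w ` {(0, \<one>)} = {(0, \<one>)}" using w(2) by (simp add: fixes_piece_def)
  then have inv: "act w ` ?f = ?f" using equivariantD(3)[OF assms w(1) base_origin] by simp
  have no: "(i, y) \<notin> ?f" if "fixes_piece w i c" "c \<noteq> \<one>" for i c y
  proof
    assume y: "(i, y) \<in> ?f"
    then have yc: "y \<in> carrier C" using b by (auto simp: X_def)
    have c: "c \<in> carrier C" using that by (simp add: fixes_piece_def)
    have "(i, c [^] n \<otimes> y) \<in> ?f" for n :: nat
    proof (induction n)
      case (Suc n)
      have "act w (i, c [^] n \<otimes> y) \<in> ?f" using Suc inv by blast
      moreover have "act w (i, c [^] n \<otimes> y) = (i, c [^] Suc n \<otimes> y)"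
        using that(1) yc c by (simp add: fixes_piece_def m_assoc[symmetric] nat_pow_Suc2[symmetric] del: nat_pow_Suc)
      ultimately show ?case by simp
    qed (use y yc in simp)
    then have "range (\<lambda>n::nat. (i, c [^] n \<otimes> y)) \<subseteq> ?f" by blast
    then have "finite (range (\<lambda>n::nat. (i, c [^] n \<otimes> y)))" using b finite_subset by blast
    moreover have "inj (\<lambda>n::nat. (i, c [^] n \<otimes> y))"
    proof (rule injI)
      fix k n :: nat assume "(i, c [^] k \<otimes> y) = (i, c [^] n \<otimes> y)"
      then have "c [^] k = c [^] n" using yc c by simp
      then show "k = n" using injD[OF infinite_order[OF c that(2)]] by blast
    qed
    ultimately show False using finite_imageD infinite_UNIV_nat by blast
  qed
  have "fst x = 0" if "x \<in> ?f" for x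
  proof -
    obtain i y where x: "x = (i, y)" by force
    then have "i = 0 \<or> i = 1 \<or> i = 2" using b that by (auto simp: X_def)
    then show ?thesis using no[OF w(3) ne(1), of y] no[OF w(4) ne(2), of y] that x by auto
  qed
  then have "?f = Pair 0 ` (snd ` ?f)" by (force simp: image_image)
  moreover have "snd ` ?f \<subseteq> carrier C" using b by (auto simp: X_def)
  ultimately show ?thesis using b by blast
qed

text \<open>So on single points, \<open>f\<close> is right multiplication by the group ring element
  with support \<open>S\<close>, the same one in all three copies.\<close>

lemma equivariant_point:
  assumes f: "equivariant f" "f {(0, \<one>)} = Pair 0 ` S" "S \<subseteq> carrier C" and x: "(i, c) \<in> X"
  shows "f {(i, c)} = (\<lambda>d. (i, c \<otimes> d)) ` S"
proof -
  obtain w where w: "reduced w" "\<forall>y\<in>carrier C. act w (0, y) = (i, c \<otimes> y)"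
    using ex_act_from_origin[OF x] by blast
  have "act w ` {(0, \<one>)} = {(i, c)}" using w(2) x by (simp add: in_X)
  then have "f {(i, c)} = act w ` Pair 0 ` S"
    using equivariantD(3)[OF f(1) w(1) base_origin] f(2) by simp
  also have "\<dots> = (\<lambda>d. (i, c \<otimes> d)) ` S"
    unfolding image_image by (rule image_cong) (use w(2) f(3) in auto)
  finally show ?thesis .
qed

lemma equivariant_parity:
  assumes g: "equivariant g" and m: "base m"
  shows "z \<in> g m \<longleftrightarrow> odd (card {x \<in> m. z \<in> g {x}})"
proof -
  have fin: "finite m" "m \<subseteq> X" using m by auto
  then show ?thesis
  proof (induction m rule: finite_induct)
    case empty
    have "g {} = {}" using equivariantD(2)[OF g, of "{}" "{}"] by simp
    then show ?case by simp
  next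
    case (insert x m)
    have e: "insert x m = sym_diff {x} m" using insert by auto
    have b: "base {x}" "base m" using insert by auto
    have "z \<in> g (insert x m) \<longleftrightarrow> (z \<in> g {x}) \<noteq> (z \<in> g m)"
      unfolding e equivariantD(2)[OF g b] by blast
    moreover have "{y \<in> insert x m. z \<in> g {y}} = (if z \<in> g {x} then insert x {y \<in> m. z \<in> g {y}} else {y \<in> m. z \<in> g {y}})"
      by auto
    moreover have "x \<notin> {y \<in> m. z \<in> g {y}}" "finite {y \<in> m. z \<in> g {y}}" using insert by auto
    ultimately show ?case using insert by (simp split: if_splits)
  qed
qed

text \<open>Let \<open>S\<close> and \<open>T\<close> be the supports of the group ring elements of
  \<open>f\<close> and \<open>g\<close>, whose product is 1. A unique product survives with
  coefficient 1, so both products from \<open>unique_products\<close> equal \<open>\<one>\<close>.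
  Uniqueness identifies them, hence \<open>T\<close> is a singleton, and then so is
  \<open>S\<close>.\<close>

lemma equivariant_unit:
  assumes f: "equivariant f" and g: "equivariant g" and gf: "g (f {(0, \<one>)}) = {(0, \<one>)}"
  shows "\<exists>c\<in>carrier C. f {(0, \<one>)} = {(0, inv c)}"
proof -
  obtain S where S: "finite S" "S \<subseteq> carrier C" "f {(0, \<one>)} = Pair 0 ` S"
    using equivariant_origin[OF f] by blast
  obtain T where T: "finite T" "T \<subseteq> carrier C" "g {(0, \<one>)} = Pair 0 ` T"
    using equivariant_origin[OF g] by blast
  have bS: "base (Pair 0 ` S)" using S by (auto simp: in_X)
  have gpt: "g {(0, c)} = (\<lambda>d. (0, c \<otimes> d)) ` T" if "c \<in> carrier C" for c
    using equivariant_point[OF g T(3,2), of 0 c] that by (simp add: in_X)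
  \<comment> \<open>The coefficient of \<open>z\<close> in the product over Z/2. Counting
    \<open>c\<close> amounts to counting pairs, since \<open>c\<close> and \<open>z\<close>
    determine the right factor.\<close>
  have par: "(0, z) \<in> g (f {(0, \<one>)}) \<longleftrightarrow> odd (card {c \<in> S. z \<in> (\<otimes>) c ` T})" for z
  proof -
    have "{x \<in> Pair 0 ` S. (0, z) \<in> g {x}} = Pair 0 ` {c \<in> S. z \<in> (\<otimes>) c ` T}"
      using gpt S(2) by (auto simp: image_iff)
    then show ?thesis
      unfolding S(3) equivariant_parity[OF g bS] by (simp add: card_image inj_on_def)
  qed
  have "S \<noteq> {}" "T \<noteq> {}"
  proof -
    have "odd (card {c \<in> S. \<one> \<in> (\<otimes>) c ` T})" using par[of \<one>] gf by simp
    then have "{c \<in> S. \<one> \<in> (\<otimes>) c ` T} \<noteq> {}" by (metis card.empty even_zero)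
    then show "S \<noteq> {}" "T \<noteq> {}" by blast+
  qed
  from unique_products[OF S(1) this(1) S(2) T(1) this(2) T(2)]
  obtain x y x0 y0 where xy: "x \<in> S" "y \<in> T" "x0 \<in> S" "y0 \<in> T"
    "\<forall>x'\<in>S. \<forall>y'\<in>T. x' \<otimes> y' = x \<otimes> y \<longrightarrow> x' = x \<and> y' = y"
    "\<forall>x'\<in>S. \<forall>y'\<in>T. x' \<otimes> y' = x0 \<otimes> y0 \<longrightarrow> x' = x0 \<and> y' = y0" "y = y0 \<longrightarrow> T = {y}"
    by blast
  have uniq: "x \<otimes> y = \<one>" if "x \<in> S" "y \<in> T"
    "\<forall>x'\<in>S. \<forall>y'\<in>T. x' \<otimes> y' = x \<otimes> y \<longrightarrow> x' = x \<and> y' = y" for x y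
  proof -
    have "c = x" if c: "c \<in> S" "x \<otimes> y \<in> (\<otimes>) c ` T" for c
    proof -
      obtain d where "d \<in> T" "c \<otimes> d = x \<otimes> y" using c(2) by (elim imageE) simp
      then show ?thesis using c(1) \<open>\<forall>x'\<in>S. \<forall>y'\<in>T. x' \<otimes> y' = x \<otimes> y \<longrightarrow> x' = x \<and> y' = y\<close> by blast
    qed
    then have "{c \<in> S. x \<otimes> y \<in> (\<otimes>) c ` T} = {x}" using \<open>x \<in> S\<close> \<open>y \<in> T\<close> by blast
    then have "(0, x \<otimes> y) \<in> g (f {(0, \<one>)})" unfolding par by simp
    then show ?thesis using gf by simp
  qed
  have one: "x \<otimes> y = \<one>" "x0 \<otimes> y0 = \<one>" using uniq xy by blast+
  then have "x0 = x \<and> y0 = y" using xy(3-5) by simp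
  then have Ty: "T = {y}" using xy(7) by simp
  have yc: "y \<in> carrier C" using xy(2) T(2) by blast
  have "c = inv y" if c: "c \<in> S" for c
  proof -
    have cc: "c \<in> carrier C" using c S(2) by blast
    have "{d \<in> S. c \<otimes> y \<in> (\<otimes>) d ` T} = {c}" using c cc yc S(2) unfolding Ty by auto
    then have "(0, c \<otimes> y) \<in> g (f {(0, \<one>)})" unfolding par by simp
    then have "c \<otimes> y = \<one>" using gf by simp
    then show ?thesis using cc yc inv_equality by simp
  qed
  then have "S = {inv y}" using \<open>S \<noteq> {}\<close> by blast
  then show ?thesis using S(3) yc by (intro bexI[of _ y]) simp_all
qed

text \<open>\<open>\<phi>\<close> sends \<open>lw w\<close> to some \<open>(k, w)\<close>, and both
  act on \<open>M\<close> by conjugation as \<open>w\<close>, because \<open>M\<close> is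
  abelian.\<close>

lemma fm_equivariant:
  assumes \<phi>: "\<phi> \<in> auto W" and pr: "\<And>s. pr \<phi> [(s, False)] = [(s, False)]"
  shows "equivariant (fm \<phi>)"
  unfolding equivariant_def
proof (intro conjI allI impI)
  fix m w assume m: "base m"
  show "finite (fm \<phi> m)" "fm \<phi> m \<subseteq> X" using auto_em(2)[OF \<phi> m] by auto
  fix n assume n: "base n"
  have "\<phi> (em (sym_diff m n)) = \<phi> (em m) \<otimes>\<^bsub>W\<^esub> \<phi> (em n)"
    using auto_mult[OF \<phi>, of "em m" "em n"] m n by simp
  then have "em (fm \<phi> (sym_diff m n)) = em (sym_diff (fm \<phi> m) (fm \<phi> n))"
    unfolding auto_em(1)[OF \<phi> base_sym_diff[OF m n]] auto_em(1)[OF \<phi> m] auto_em(1)[OF \<phi> n] by simp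
  then show "fm \<phi> (sym_diff m n) = sym_diff (fm \<phi> m) (fm \<phi> n)" by simp
next
  fix w m assume w: "reduced w" and m: "base m"
  have "pr \<phi> w = id w"
  proof (rule hom_freeprod_eq[OF group_freeprod pr_hom[OF \<phi>] _ _ w])
    show "id \<in> hom freeprod freeprod" by (auto simp: hom_def reduced_mult)
  qed (simp add: pr)
  then obtain k where k: "\<phi> (lw w) = (k, w)" "base k" using auto_lw(1)[OF \<phi> w] by auto
  have c: "lw w \<in> carrier W" "em m \<in> carrier W" "(k, w) \<in> carrier W" using w m k by auto
  have "\<phi> (em (act w ` m)) = \<phi> (lw w \<otimes>\<^bsub>W\<^esub> em m \<otimes>\<^bsub>W\<^esub> inv\<^bsub>W\<^esub> lw w)"
    unfolding lw_conj_em[OF w m] ..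
  also have "\<dots> = (k, w) \<otimes>\<^bsub>W\<^esub> em (fm \<phi> m) \<otimes>\<^bsub>W\<^esub> inv\<^bsub>W\<^esub> (k, w)"
    unfolding auto_mult[OF \<phi> W.m_closed[OF c(1,2)] W.inv_closed[OF c(1)]] auto_mult[OF \<phi> c(1,2)]
      auto_inv[OF \<phi> c(1)] k(1) auto_em(1)[OF \<phi> m] ..
  also have "\<dots> = em (act w ` fm \<phi> m)"
    by (rule conj_em[OF c(3) auto_em(2)[OF \<phi> m]])
  finally show "fm \<phi> (act w ` m) = act w ` fm \<phi> m" by (simp add: fm_def)
qed

section \<open>Generators of the outer automorphism group\<close>

definition gens :: "((nat \<times> 'c) set \<times> fword \<Rightarrow> (nat \<times> 'c) set \<times> fword) set" where
  "gens = {rho a, rho t, delta {(0, \<one>)}, delta {(1, \<one>)}, delta {(2, \<one>)}}"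

lemma gens_auto: "finite gens" "gens \<subseteq> auto W"
  using rho_auto at delta_auto by (auto simp: gens_def in_X)

text \<open>The preimage of the subgroup of \<open>Out W\<close> generated by the classes of
  \<open>gens\<close>. Automorphisms of the same type turn out to differ by an element of
  \<open>B\<close>, so its index is finite.\<close>

definition B :: "((nat \<times> 'c) set \<times> fword \<Rightarrow> (nat \<times> 'c) set \<times> fword) set" where
  "B = generate (AutoGroup W) (gens \<union> inner_auto W)"

lemma inner_auto_W: "inner_auto W \<subseteq> auto W"
  using W.conj_in_auto by (auto simp: inner_auto_def)

lemma subgroup_B: "subgroup B (AutoGroup W)"
  unfolding B_def
  by (rule A.generate_is_subgroup) (use gens_auto inner_auto_W in \<open>auto simp: W.carrier_AutoGroup\<close>)

lemma B_cancel:
  assumes "\<beta> \<in> B" "\<psi> \<in> auto W" "\<beta> \<bullet> \<psi> \<in> B"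
  shows "\<psi> \<in> B"
proof -
  have c: "\<beta> \<in> carrier (AutoGroup W)" "\<psi> \<in> carrier (AutoGroup W)"
    using assms subgroup.mem_carrier[OF subgroup_B] by (auto simp: W.carrier_AutoGroup)
  have "inv\<^bsub>AutoGroup W\<^esub> \<beta> \<bullet> (\<beta> \<bullet> \<psi>) \<in> B"
    by (rule subgroup.m_closed[OF subgroup_B subgroup.m_inv_closed[OF subgroup_B assms(1)] assms(3)])
  then show ?thesis using c by (simp flip: A.m_assoc)
qed

lemma B_inner: "g \<in> carrier W \<Longrightarrow> (\<lambda>x\<in>carrier W. g \<otimes>\<^bsub>W\<^esub> x \<otimes>\<^bsub>W\<^esub> inv\<^bsub>W\<^esub> g) \<in> B"
  unfolding B_def by (rule generate.incl) (auto simp: inner_auto_def)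

text \<open>The device for normalising \<open>\<psi>\<close> step by step: it may be replaced by its
  composition with an inner automorphism, which is then known by its values alone.\<close>

lemma B_conj:
  assumes g: "g \<in> carrier W" and \<psi>: "\<psi> \<in> auto W"
    and "\<And>\<chi>. \<chi> \<in> auto W \<Longrightarrow> (\<And>x. x \<in> carrier W \<Longrightarrow> \<chi> x = g \<otimes>\<^bsub>W\<^esub> \<psi> x \<otimes>\<^bsub>W\<^esub> inv\<^bsub>W\<^esub> g) \<Longrightarrow> \<chi> \<in> B"
  shows "\<psi> \<in> B"
proof (rule B_cancel[OF B_inner[OF g] \<psi>], rule assms(3))
  note c = W.conj_in_auto[OF g]
  show "(\<lambda>x\<in>carrier W. g \<otimes>\<^bsub>W\<^esub> x \<otimes>\<^bsub>W\<^esub> inv\<^bsub>W\<^esub> g) \<bullet> \<psi> \<in> auto W"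
    by (rule A_closed[OF c \<psi>])
  fix x assume x: "x \<in> carrier W"
  show "((\<lambda>x\<in>carrier W. g \<otimes>\<^bsub>W\<^esub> x \<otimes>\<^bsub>W\<^esub> inv\<^bsub>W\<^esub> g) \<bullet> \<psi>) x = g \<otimes>\<^bsub>W\<^esub> \<psi> x \<otimes>\<^bsub>W\<^esub> inv\<^bsub>W\<^esub> g"
    unfolding A_apply[OF c \<psi> x] by (rule restrict_apply'[OF auto_closed[OF \<psi> x]])
qed

lemma B_rho:
  assumes "c \<in> carrier C"
  shows "rho c \<in> B"
proof -
  interpret r: group_hom C "AutoGroup W" rho
    using rho_hom A.is_group is_group by (simp add: group_hom_def group_hom_axioms_def)
  have "rho ` generate C {a, t} = generate (AutoGroup W) (rho ` {a, t})"
    using r.generate_img[of "{a, t}"] at by simp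
  also have "\<dots> \<subseteq> B"
    unfolding B_def by (rule A.mono_generate) (auto simp: gens_def)
  finally show ?thesis using assms gen by blast
qed

text \<open>Additivity reduces this to single points, and conjugation by \<open>rho\<close> reduces
  a point to the point \<open>(i, \<one>)\<close> of its copy.\<close>

lemma B_delta:
  assumes "base m"
  shows "delta m \<in> B"
proof -
  have one: "delta {} \<in> B"
  proof -
    have "delta {} \<bullet> delta {} = delta {}" using delta_mult[of "{}" "{}"] by simp
    moreover have c: "delta {} \<in> carrier (AutoGroup W)"
      using delta_auto[of "{}"] by (simp add: W.carrier_AutoGroup)
    ultimately have "delta {} = \<one>\<^bsub>AutoGroup W\<^esub>"
      using A.l_cancel_one[OF c c] by blast
    then show ?thesis using subgroup.one_closed[OF subgroup_B] by simp
  qed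
  have pt: "delta {(i, c)} \<in> B" if ic: "(i, c) \<in> X" for i c
  proof -
    have c: "inv c \<in> carrier C" "c \<in> carrier C" using ic by (auto simp: in_X)
    have i1: "base {(i, \<one>)}" using ic by (simp add: in_X)
    have "delta {(i, \<one>)} \<in> B"
      unfolding B_def by (rule generate.incl) (use ic in \<open>auto simp: gens_def in_X\<close>)
    then have 1: "rho (inv c) \<bullet> delta {(i, \<one>)} \<in> B"
      by (rule subgroup.m_closed[OF subgroup_B B_rho[OF c(1)]])
    have e: "R (inv c) ` {(i, \<one>)} = {(i, c)}" using c by (simp add: R_def)
    have "delta {(i, c)} \<bullet> rho (inv c) \<in> B"
      using 1 unfolding rho_delta[OF c(1) i1] e .
    then have "(delta {(i, c)} \<bullet> rho (inv c)) \<bullet> inv\<^bsub>AutoGroup W\<^esub> rho (inv c) \<in> B"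
      by (rule subgroup.m_closed[OF subgroup_B _ subgroup.m_inv_closed[OF subgroup_B B_rho[OF c(1)]]])
    moreover have "delta {(i, c)} \<in> carrier (AutoGroup W)" "rho (inv c) \<in> carrier (AutoGroup W)"
      using delta_auto[of "{(i, c)}"] rho_auto[OF c(1)] ic by (simp_all add: W.carrier_AutoGroup)
    ultimately show ?thesis by (simp add: A.m_assoc)
  qed
  have "finite m" "m \<subseteq> X" using assms by auto
  then show ?thesis
  proof (induction m rule: finite_induct)
    case (insert x m)
    have b: "base {x}" "base m" using insert by auto
    have e: "insert x m = sym_diff {x} m" using insert by auto
    show ?case unfolding e delta_mult[OF b]
      by (rule subgroup.m_closed[OF subgroup_B]) (use insert pt[of "fst x" "snd x"] in auto)
  qed (rule one)
qed

text \<open>The derivation given by \<open>d\<close> is inner because \<open>3\<close> is odd.\<close>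

lemma order3_conj:
  assumes d: "(d, [(s, False)]) \<in> carrier W"
    and cube: "(d, [(s, False)]) \<otimes>\<^bsub>W\<^esub> (d, [(s, False)]) \<otimes>\<^bsub>W\<^esub> (d, [(s, False)]) = \<one>\<^bsub>W\<^esub>"
  shows "\<exists>m. base m \<and> (d, [(s, False)]) = em m \<otimes>\<^bsub>W\<^esub> lw [(s, False)] \<otimes>\<^bsub>W\<^esub> inv\<^bsub>W\<^esub> em m"
proof -
  let ?l = "[(s, False)]"
  \<comment> \<open>The cube relation reads \<open>d + l d + l^2 d = 0\<close>, so for
    \<open>m = l d\<close> the coboundary \<open>m + l m\<close> equals \<open>d\<close>.\<close>
  define m where "m = act ?l ` d"
  have b: "base d" using d by simp
  have m: "base m" unfolding m_def by (rule base_act[OF b])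
  have sq: "word_act step ?l ?l = [(s, True)]" by (simp add: letter_act_def)
  have "(d, ?l) \<otimes>\<^bsub>W\<^esub> (d, ?l) \<otimes>\<^bsub>W\<^esub> (d, ?l) = (sym_diff (sym_diff d m) (act (word_act step ?l ?l) ` d), word_act step (word_act step ?l ?l) ?l)"
    unfolding mult_W m_def ..
  also have "act (word_act step ?l ?l) ` d = act ?l ` m"
    unfolding m_def by (rule act_image_mult) (use b in simp)
  finally have "sym_diff (sym_diff d m) (act ?l ` m) = {}" using cube by simp
  then have "d = sym_diff m (act ?l ` m)" by blast
  moreover have "em m \<otimes>\<^bsub>W\<^esub> lw ?l \<otimes>\<^bsub>W\<^esub> inv\<^bsub>W\<^esub> em m = (sym_diff m (act ?l ` m), ?l)"
  proof -
    have "word_act step ?l [] = ?l" by (simp add: letter_act_def)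
    then show ?thesis unfolding inv_em[OF m] em_mult_lw mult_W by simp
  qed
  ultimately show ?thesis using m by auto
qed

lemma auto_cube:
  assumes "\<psi> \<in> auto W"
  shows "\<psi> (lw [(s, False)]) \<otimes>\<^bsub>W\<^esub> \<psi> (lw [(s, False)]) \<otimes>\<^bsub>W\<^esub> \<psi> (lw [(s, False)]) = \<one>\<^bsub>W\<^esub>"
proof -
  let ?l = "lw [(s, False)]"
  have l: "?l \<in> carrier W" by simp
  have "?l \<otimes>\<^bsub>W\<^esub> ?l \<otimes>\<^bsub>W\<^esub> ?l = \<one>\<^bsub>W\<^esub>" by (simp add: letter_act_def)
  then show ?thesis
    unfolding auto_mult[OF assms l l, symmetric] auto_mult[OF assms W.m_closed[OF l l] l, symmetric]
    using auto_one[OF assms] by simp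
qed

lemma ex_conj_generator:
  assumes \<psi>: "\<psi> \<in> auto W" and pr: "pr \<psi> [(s, False)] = [(s, False)]"
  shows "\<exists>m. base m \<and> \<psi> (lw [(s, False)]) = em m \<otimes>\<^bsub>W\<^esub> lw [(s, False)] \<otimes>\<^bsub>W\<^esub> inv\<^bsub>W\<^esub> em m"
proof -
  obtain d where d: "\<psi> (lw [(s, False)]) = (d, [(s, False)])"
    using auto_lw(1)[OF \<psi>, of "[(s, False)]"] pr by auto
  have "(d, [(s, False)]) \<in> carrier W" using auto_closed[OF \<psi>, of "lw [(s, False)]"] d by simp
  then show ?thesis using order3_conj auto_cube[OF \<psi>, of s] unfolding d by blast
qed

text \<open>The image of \<open>v\<close> has cube 1 and projects to \<open>v\<close>, so it is the
  conjugate of \<open>v\<close> by some \<open>m\<close> in the base. Then \<open>\<psi>\<close>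
  agrees with \<open>delta m\<close> on generators.\<close>

lemma B_fixing_u:
  assumes \<psi>: "\<psi> \<in> auto W" and o: "\<psi> (em {(0, \<one>)}) = em {(0, \<one>)}"
    and u: "\<psi> (lw [(False, False)]) = lw [(False, False)]" and v: "pr \<psi> [(True, False)] = [(True, False)]"
  shows "\<psi> \<in> B"
proof -
  obtain m where m: "base m"
    "\<psi> (lw [(True, False)]) = em m \<otimes>\<^bsub>W\<^esub> lw [(True, False)] \<otimes>\<^bsub>W\<^esub> inv\<^bsub>W\<^esub> em m"
    using ex_conj_generator[OF \<psi> v] by blast
  have "\<psi> = delta m"
  proof (rule aut_eqI[OF \<psi> delta_auto[OF m(1)]])
    show "\<psi> (em {(0, \<one>)}) = delta m (em {(0, \<one>)})"
      unfolding o delta_em[OF m(1) base_origin] ..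
    fix s
    have "\<psi> (lw [(True, False)]) = delta m (lw [(True, False)])"
      unfolding m(2) delta_lw(2)[OF m(1)] dgen_True[OF m(1), symmetric] dgen_def by simp
    moreover have "\<psi> (lw [(False, False)]) = delta m (lw [(False, False)])"
      unfolding u delta_lw(1)[OF m(1)] ..
    ultimately show "\<psi> (lw [(s, False)]) = delta m (lw [(s, False)])" by (cases s) simp_all
  qed
  then show ?thesis using B_delta[OF m(1)] by simp
qed

text \<open>The image of \<open>u\<close> is the conjugate of \<open>u\<close> by some
  \<open>m\<close> in the base. Conjugating by \<open>m\<close> once more restores \<open>u\<close>,
  and it leaves the origin and the induced map on generators unchanged.\<close>

lemma B_fixing_origin:
  assumes \<psi>: "\<psi> \<in> auto W" and o: "\<psi> (em {(0, \<one>)}) = em {(0, \<one>)}"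
    and pr: "\<And>s. pr \<psi> [(s, False)] = [(s, False)]"
  shows "\<psi> \<in> B"
proof -
  let ?u = "lw [(False, False)]"
  obtain m where m: "base m" "\<psi> ?u = em m \<otimes>\<^bsub>W\<^esub> ?u \<otimes>\<^bsub>W\<^esub> inv\<^bsub>W\<^esub> em m"
    using ex_conj_generator[OF \<psi> pr] by blast
  have c: "em m \<in> carrier W" "?u \<in> carrier W" "em {(0, \<one>)} \<in> carrier W" using m(1) base_origin by auto
  show ?thesis
  proof (rule B_conj[OF c(1) \<psi>])
    fix \<chi> assume \<chi>: "\<chi> \<in> auto W"
      and \<chi>x: "\<And>x. x \<in> carrier W \<Longrightarrow> \<chi> x = em m \<otimes>\<^bsub>W\<^esub> \<psi> x \<otimes>\<^bsub>W\<^esub> inv\<^bsub>W\<^esub> em m"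
    show "\<chi> \<in> B"
    proof (rule B_fixing_u[OF \<chi>])
      show "\<chi> (em {(0, \<one>)}) = em {(0, \<one>)}"
        unfolding \<chi>x[OF c(3)] o using conj_em[OF c(1) base_origin] by simp
      have "em m \<otimes>\<^bsub>W\<^esub> em m = \<one>\<^bsub>W\<^esub>" by simp
      then show "\<chi> ?u = ?u"
        unfolding \<chi>x[OF c(2)] m(2) W.conj_conj[OF c(1,2,1)]
        by (simp only: W.inv_one W.l_one[OF c(2)] W.r_one[OF c(2)])
      have v: "lw [(True, False)] \<in> carrier W" by simp
      obtain k where k: "\<psi> (lw [(True, False)]) = (k, [(True, False)])"
        using auto_lw(1)[OF \<psi>, of "[(True, False)]"] pr by auto
      have "word_act step [(True, False)] [] = [(True, False)]" by (simp add: letter_act_def)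
      then show "pr \<chi> [(True, False)] = [(True, False)]"
        unfolding pr_def \<chi>x[OF v] k inv_em[OF m(1)] mult_W by simp
    qed
  qed
qed

text \<open>\<open>\<psi>\<close> and its inverse both restrict to module endomorphisms of
  \<open>M\<close>. By \<open>equivariant_unit\<close> the origin goes to a single point
  \<open>(0, inv c)\<close>, which \<open>rho (inv c)\<close> sends back.\<close>

lemma B_fixing_generators:
  assumes \<psi>: "\<psi> \<in> auto W" and pr: "\<And>s. pr \<psi> [(s, False)] = [(s, False)]"
  shows "\<psi> \<in> B"
proof -
  let ?i = "inv\<^bsub>AutoGroup W\<^esub> \<psi>"
  note i = A_inv_closed[OF \<psi>]
  have pri: "pr ?i [(s, False)] = [(s, False)]" for s
    using pr_inv[OF \<psi>, of "[(s, False)]"] unfolding pr by simp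
  have f: "\<psi> (em {(0, \<one>)}) = em (fm \<psi> {(0, \<one>)})" by (rule auto_em(1)[OF \<psi> base_origin])
  have o: "em {(0, \<one>)} \<in> carrier W" using base_origin by simp
  have "?i (em (fm \<psi> {(0, \<one>)})) = em {(0, \<one>)}"
    using A_inv_apply[OF \<psi> o] unfolding f .
  then have "fm ?i (fm \<psi> {(0, \<one>)}) = {(0, \<one>)}" by (simp add: fm_def[of ?i])
  then obtain c where c: "c \<in> carrier C" "fm \<psi> {(0, \<one>)} = {(0, inv c)}"
    using equivariant_unit[OF fm_equivariant[OF \<psi> pr] fm_equivariant[OF i pri]] by blast
  have ic: "inv c \<in> carrier C" using c by simp
  show ?thesis
  proof (rule B_cancel[OF B_rho[OF ic] \<psi>])
    show "rho (inv c) \<bullet> \<psi> \<in> B"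
    proof (rule B_fixing_origin)
      show "rho (inv c) \<bullet> \<psi> \<in> auto W" by (rule A_closed[OF rho_auto[OF ic] \<psi>])
      show "(rho (inv c) \<bullet> \<psi>) (em {(0, \<one>)}) = em {(0, \<one>)}"
        unfolding A_apply[OF rho_auto[OF ic] \<psi> o] f c(2) rho_origin[OF c(1), symmetric]
        by (rule rho_inverse[OF c(1) o])
      show "pr (rho (inv c) \<bullet> \<psi>) [(s, False)] = [(s, False)]" for s
        using pr_mult[OF rho_auto[OF ic] \<psi>, of "[(s, False)]"] unfolding pr by (simp add: pr_def rho_lw)
    qed
  qed
qed

lemma pr_conj:
  assumes \<psi>: "\<psi> \<in> auto W" and g: "reduced g" and w: "reduced w"
    and \<chi>: "\<And>x. x \<in> carrier W \<Longrightarrow> \<chi> x = lw g \<otimes>\<^bsub>W\<^esub> \<psi> x \<otimes>\<^bsub>W\<^esub> inv\<^bsub>W\<^esub> lw g"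
  shows "pr \<chi> w = g \<cdot> pr \<psi> w \<cdot> finv g"
proof -
  obtain k where k: "\<psi> (lw w) = (k, pr \<psi> w)" using auto_lw(1)[OF \<psi> w] by auto
  have l: "lw w \<in> carrier W" using w by simp
  show ?thesis
    unfolding pr_def[of \<chi>] \<chi>[OF l] k inv_lw[OF g] inv_freeprod[OF g] by simp
qed

text \<open>Conjugation by \<open>g^-1\<close> makes the induced map fix \<open>u\<close>. By
  \<open>freeprod_conj_surj\<close> it then sends \<open>v\<close> to the conjugate of
  \<open>v\<close> by some \<open>b\<close> that commutes with \<open>u\<close>, and conjugation by
  \<open>b^-1\<close> fixes both generators at once.\<close>

lemma B_conj_generators:
  assumes \<psi>: "\<psi> \<in> auto W"
    and pr: "\<And>s. \<exists>g. reduced g \<and> pr \<psi> [(s, False)] = g \<cdot> [(s, False)] \<cdot> finv g"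
  shows "\<psi> \<in> B"
proof -
  let ?u = "[(False, False)]" and ?v = "[(True, False)]"
  have uv: "?u \<in> carrier freeprod" "?v \<in> carrier freeprod" by simp_all
  obtain g where g: "reduced g" "pr \<psi> ?u = g \<cdot> ?u \<cdot> finv g"
    using pr by blast
  obtain h where h: "reduced h" "pr \<psi> ?v = h \<cdot> ?v \<cdot> finv h"
    using pr by blast
  have gc: "g \<in> carrier freeprod" "h \<in> carrier freeprod" using g h by auto
  have ig: "winv g = finv g" "reduced (winv g)" using g(1) by (simp_all add: inv_freeprod)
  have igc: "finv g \<in> carrier freeprod" by (rule F.inv_closed[OF gc(1)])
  have lg: "lw (winv g) \<in> carrier W" using ig by simp
  show ?thesis
  proof (rule B_conj[OF lg \<psi>])
    fix \<chi> assume \<chi>: "\<chi> \<in> auto W"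
      and \<chi>x: "\<And>x. x \<in> carrier W \<Longrightarrow> \<chi> x = lw (winv g) \<otimes>\<^bsub>W\<^esub> \<psi> x \<otimes>\<^bsub>W\<^esub> inv\<^bsub>W\<^esub> lw (winv g)"
    note pr\<chi> = pr_conj[OF \<psi> ig(2) _ \<chi>x, unfolded ig(1)]
    have \<chi>u: "pr \<chi> ?u = ?u"
    proof -
      have "pr \<chi> ?u = (finv g \<cdot> g) \<cdot> ?u \<cdot> finv (finv g \<cdot> g)"
        using pr\<chi>[of ?u] unfolding g(2) F.conj_conj[OF igc uv(1) gc(1)] by simp
      then show ?thesis unfolding F.l_inv[OF gc(1)] F.inv_one F.l_one[OF uv(1)] F.r_one[OF uv(1)] .
    qed
    define p where "p = finv g \<cdot> h"
    have p: "p \<in> carrier freeprod" unfolding p_def by (rule F.m_closed[OF igc gc(2)])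
    then have pred: "reduced p" by (rule freeprod_simps(1)[THEN iffD1])
    have \<chi>v: "pr \<chi> ?v = p \<cdot> ?v \<cdot> finv p"
      using pr\<chi>[of ?v] unfolding h(2) F.conj_conj[OF igc uv(2) gc(2)] p_def by simp
    obtain b where b: "reduced b" "b \<cdot> ?u = ?u \<cdot> b"
      "pr \<chi> ?v = b \<cdot> ?v \<cdot> finv b"
      using freeprod_conj_surj[OF pred pr_hom[OF \<chi>] \<chi>u \<chi>v pr_surj[OF \<chi>]] by (elim exE conjE) (rule that)
    have bc: "b \<in> carrier freeprod" using b(1) by simp
    have ib: "winv b = finv b" "reduced (winv b)" using b(1) by (simp_all add: inv_freeprod)
    have ibc: "finv b \<in> carrier freeprod" by (rule F.inv_closed[OF bc])
    have lb: "lw (winv b) \<in> carrier W" using ib by simp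
    have bu: "?u = b \<cdot> ?u \<cdot> finv b"
      unfolding b(2) by (rule F.inv_solve_right[THEN iffD2, OF uv(1) F.m_closed[OF uv(1) bc] bc refl])
    have cancel: "finv b \<cdot> (b \<cdot> x \<cdot> finv b) \<cdot> finv (finv b) = x"
      if x: "x \<in> carrier freeprod" for x
      unfolding F.conj_conj[OF ibc x bc] F.l_inv[OF bc] F.inv_one F.l_one[OF x] F.r_one[OF x] ..
    show "\<chi> \<in> B"
    proof (rule B_conj[OF lb \<chi>])
      fix \<xi> assume \<xi>: "\<xi> \<in> auto W"
        and \<xi>x: "\<And>x. x \<in> carrier W \<Longrightarrow> \<xi> x = lw (winv b) \<otimes>\<^bsub>W\<^esub> \<chi> x \<otimes>\<^bsub>W\<^esub> inv\<^bsub>W\<^esub> lw (winv b)"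
      note pr\<xi> = pr_conj[OF \<chi> ib(2) _ \<xi>x, unfolded ib(1)]
      have "pr \<xi> ?u = ?u"
      proof -
        have "pr \<xi> ?u = finv b \<cdot> pr \<chi> ?u \<cdot> finv (finv b)"
          by (rule pr\<xi>) simp_all
        also have "pr \<chi> ?u = b \<cdot> ?u \<cdot> finv b" using \<chi>u bu by (rule trans)
        also note cancel[OF uv(1)]
        finally show ?thesis .
      qed
      moreover have "pr \<xi> ?v = ?v"
      proof -
        have "pr \<xi> ?v = finv b \<cdot> pr \<chi> ?v \<cdot> finv (finv b)"
          by (rule pr\<xi>) simp_all
        also note b(3)
        also note cancel[OF uv(2)]
        finally show ?thesis .
      qed
      ultimately have "pr \<xi> [(s, False)] = [(s, False)]" for s by (cases s) simp_all
      then show "\<xi> \<in> B" by (rule B_fixing_generators[OF \<xi>])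
    qed
  qed
qed

lemma ex_conj_letter:
  assumes \<phi>: "\<phi> \<in> auto W"
  shows "\<exists>l g. reduced g \<and> pr \<phi> [(s, False)] = g \<cdot> [l] \<cdot> finv g"
proof -
  let ?l = "[(s, False)]"
  have l: "?l \<in> carrier freeprod" by simp
  note hom = pr_hom[OF \<phi>]
  have red: "reduced (pr \<phi> ?l)" using auto_lw(2)[OF \<phi>] by simp
  have "pr \<phi> ?l \<noteq> []"
  proof
    assume "pr \<phi> ?l = []"
    then have "pr (inv\<^bsub>AutoGroup W\<^esub> \<phi>) [] = ?l" using pr_inv[OF \<phi>, of ?l] by simp
    moreover have "pr (inv\<^bsub>AutoGroup W\<^esub> \<phi>) [] = []"
      using hom_one[OF pr_hom[OF A_inv_closed[OF \<phi>]] group_freeprod group_freeprod] by simp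
    ultimately show False by simp
  qed
  moreover have "pr \<phi> ?l \<cdot> pr \<phi> ?l \<cdot> pr \<phi> ?l = []"
  proof -
    have "?l \<cdot> ?l \<cdot> ?l = \<one>\<^bsub>freeprod\<^esub>" by (simp add: letter_act_def)
    then show ?thesis
      unfolding hom_mult[OF hom l l, symmetric] hom_mult[OF hom F.m_closed[OF l l] l, symmetric]
      using hom_one[OF hom group_freeprod group_freeprod] by simp
  qed
  ultimately show ?thesis using freeprod_order3[OF red] by blast
qed

text \<open>A letter conjugate to the image of the generator, picked by choice. What matters is that
  there are finitely many types and that automorphisms of the same type lie in one coset of
  \<open>B\<close>.\<close>

definition type_of :: "((nat \<times> 'c) set \<times> fword \<Rightarrow> (nat \<times> 'c) set \<times> fword) \<Rightarrow> bool \<Rightarrow> bool \<times> bool" where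
  "type_of \<phi> s = (SOME l. \<exists>g. reduced g \<and> pr \<phi> [(s, False)] = g \<cdot> [l] \<cdot> finv g)"

lemma type_of:
  "\<phi> \<in> auto W \<Longrightarrow> \<exists>g. reduced g \<and> pr \<phi> [(s, False)] = g \<cdot> [type_of \<phi> s] \<cdot> finv g"
  unfolding type_of_def by (rule someI_ex[OF ex_conj_letter])

text \<open>Both automorphisms send a generator to conjugates of one letter, so the two images are
  conjugate to each other. The inverse of \<open>r\<close> turns this into a conjugacy between the
  generator and its image under the quotient.\<close>

lemma same_type:
  assumes \<phi>: "\<phi> \<in> auto W" and r: "r \<in> auto W" and eq: "type_of r = type_of \<phi>"
  shows "inv\<^bsub>AutoGroup W\<^esub> r \<bullet> \<phi> \<in> B"
proof (rule B_conj_generators)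
  let ?i = "inv\<^bsub>AutoGroup W\<^esub> r"
  note i = A_inv_closed[OF r]
  show "?i \<bullet> \<phi> \<in> auto W" by (rule A_closed[OF i \<phi>])
  fix s
  let ?l = "[(s, False)]" and ?t = "[type_of \<phi> s]"
  obtain g where g: "reduced g" "pr \<phi> ?l = g \<cdot> ?t \<cdot> finv g"
    using type_of[OF \<phi>] by blast
  obtain h where h: "reduced h" "pr r ?l = h \<cdot> ?t \<cdot> finv h"
    using type_of[OF r, of s] unfolding eq by blast
  have c: "g \<in> carrier freeprod" "h \<in> carrier freeprod" "?t \<in> carrier freeprod" "finv h \<in> carrier freeprod"
    "pr r ?l \<in> carrier freeprod" "?l \<in> carrier freeprod"
    using g h F.inv_closed[of h] auto_lw(2)[OF r, of ?l] by auto
  define k where "k = g \<cdot> finv h"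
  have k: "k \<in> carrier freeprod" unfolding k_def by (rule F.m_closed[OF c(1,4)])
  have "finv h \<cdot> pr r ?l \<cdot> finv (finv h) = ?t"
    unfolding h(2) F.conj_conj[OF c(4,3,2)] F.l_inv[OF c(2)] F.inv_one F.l_one[OF c(3)] F.r_one[OF c(3)] ..
  then have "pr \<phi> ?l = g \<cdot> (finv h \<cdot> pr r ?l \<cdot> finv (finv h)) \<cdot> finv g"
    using g(2) by simp
  also have "\<dots> = k \<cdot> pr r ?l \<cdot> finv k"
    unfolding k_def by (rule F.conj_conj[OF c(1,5,4)])
  finally have 1: "pr \<phi> ?l = k \<cdot> pr r ?l \<cdot> finv k" .
  interpret p: group_hom freeprod freeprod "pr ?i"
    using pr_hom[OF i] group_freeprod by (simp add: group_hom_def group_hom_axioms_def)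
  have "pr (?i \<bullet> \<phi>) ?l = pr ?i (pr \<phi> ?l)" by (rule pr_mult[OF i \<phi>]) simp
  also have "\<dots> = pr ?i k \<cdot> pr ?i (pr r ?l) \<cdot> finv (pr ?i k)"
    unfolding 1 p.hom_mult[OF F.m_closed[OF k c(5)] F.inv_closed[OF k]] p.hom_mult[OF k c(5)] p.hom_inv[OF k] ..
  also have "pr ?i (pr r ?l) = ?l" by (rule pr_inv[OF r]) simp
  finally have "pr (?i \<bullet> \<phi>) ?l = pr ?i k \<cdot> ?l \<cdot> finv (pr ?i k)" .
  moreover have "reduced (pr ?i k)" using auto_lw(2)[OF i] k by simp
  ultimately show "\<exists>g. reduced g \<and> pr (?i \<bullet> \<phi>) ?l = g \<cdot> ?l \<cdot> finv g"
    by (intro exI[of _ "pr ?i k"] conjI)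
qed

theorem finitely_generated_Out_W: "finitely_generated (Out W)"
proof -
  define rep where "rep f = (SOME \<phi>. \<phi> \<in> auto W \<and> type_of \<phi> = f)" for f
  have rep: "rep (type_of \<phi>) \<in> auto W \<and> type_of (rep (type_of \<phi>)) = type_of \<phi>" if "\<phi> \<in> auto W" for \<phi>
    using someI[of "\<lambda>\<psi>. \<psi> \<in> auto W \<and> type_of \<psi> = type_of \<phi>" \<phi>] that by (simp add: rep_def)
  define S where "S = gens \<union> rep ` type_of ` auto W"
  have S: "S \<subseteq> auto W" using gens_auto(2) rep by (auto simp: S_def)
  let ?G = "generate (AutoGroup W) (S \<union> inner_auto W)"
  have sub: "subgroup ?G (AutoGroup W)"
    by (rule A.generate_is_subgroup) (use S inner_auto_W in \<open>auto simp: W.carrier_AutoGroup\<close>)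
  have "B \<subseteq> ?G" unfolding B_def by (rule A.mono_generate) (auto simp: S_def)
  show ?thesis
  proof (rule W.finitely_generated_OutI[OF _ S])
    \<comment> \<open>Types are functions \<open>bool \<Rightarrow> bool \<times> bool\<close>, so
      there are at most 16.\<close>
    show "finite S" using gens_auto(1) by (simp add: S_def finite_subset[OF subset_UNIV])
    show "auto W \<subseteq> ?G"
    proof
      fix \<phi> assume \<phi>: "\<phi> \<in> auto W"
      let ?r = "rep (type_of \<phi>)"
      have r: "?r \<in> auto W" "type_of ?r = type_of \<phi>" using rep[OF \<phi>] by auto
      have 1: "inv\<^bsub>AutoGroup W\<^esub> ?r \<bullet> \<phi> \<in> ?G"
        using same_type[OF \<phi> r] \<open>B \<subseteq> ?G\<close> by blast
      have "?r \<in> ?G" using \<phi> by (intro generate.incl) (simp add: S_def)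
      then have "?r \<bullet> (inv\<^bsub>AutoGroup W\<^esub> ?r \<bullet> \<phi>) \<in> ?G"
        by (rule subgroup.m_closed[OF sub _ 1])
      moreover have "?r \<bullet> (inv\<^bsub>AutoGroup W\<^esub> ?r \<bullet> \<phi>) = \<phi>"
        using r(1) \<phi> A_inv_closed[OF r(1)] by (simp add: W.carrier_AutoGroup flip: A.m_assoc)
      ultimately show "\<phi> \<in> ?G" by simp
    qed
  qed
qed

lemma rho_class_hom:
  "group_hom C (Out W) (\<lambda>c. inner_auto W #>\<^bsub>AutoGroup W\<^esub> rho c)"
  "inj_on (\<lambda>c. inner_auto W #>\<^bsub>AutoGroup W\<^esub> rho c) (carrier C)"
proof -
  interpret N: normal "inner_auto W" "AutoGroup W" by (rule W.inner_auto_normal)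
  let ?p = "\<lambda>x. inner_auto W #>\<^bsub>AutoGroup W\<^esub> x"
  have "?p \<in> hom (AutoGroup W) (Out W)" using N.r_coset_hom_Mod by (simp add: Out_def)
  from Group.hom_compose[OF rho_hom this]
  show h: "group_hom C (Out W) (\<lambda>c. ?p (rho c))"
    using is_group W.group_Out by (simp add: group_hom_def group_hom_axioms_def comp_def)
  interpret q: group_hom C "Out W" "\<lambda>c. ?p (rho c)" by (rule h)
  have "c = \<one>" if "c \<in> carrier C" "?p (rho c) = inner_auto W" for c
  proof (rule rho_inner[OF that(1)])
    have "rho c \<in> carrier (AutoGroup W)" using rho_auto[OF that(1)] by (simp add: W.carrier_AutoGroup)
    then show "rho c \<in> inner_auto W" using A.rcos_self[OF _ N.subgroup_axioms] that(2) by blast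
  qed
  then have "kernel C (Out W) (\<lambda>c. ?p (rho c)) = {\<one>}"
    using q.hom_one by (auto simp: kernel_def Out_def)
  then show "inj_on (\<lambda>c. ?p (rho c)) (carrier C)" using q.trivial_ker_imp_inj by blast
qed

end

section \<open>Hall groups\<close>

type_synonym laurent = "int \<Rightarrow>\<^sub>0 int"

definition weighted_sum :: "(int \<Rightarrow> int) \<Rightarrow> laurent \<Rightarrow> int" where
  "weighted_sum \<chi> p = (\<Sum>k\<in>Poly_Mapping.keys p. Poly_Mapping.lookup p k * \<chi> k)"

lemma weighted_sum_superset:
  assumes "finite S" "Poly_Mapping.keys p \<subseteq> S"
  shows "weighted_sum \<chi> p = (\<Sum>k\<in>S. Poly_Mapping.lookup p k * \<chi> k)"
  unfolding weighted_sum_def using assms by (intro sum.mono_neutral_left) (auto simp: in_keys_iff)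

lemma weighted_sum_diff: "weighted_sum \<chi> (p - q) = weighted_sum \<chi> p - weighted_sum \<chi> q"
proof -
  let ?S = "Poly_Mapping.keys p \<union> Poly_Mapping.keys q"
  have "Poly_Mapping.keys (p - q) \<subseteq> ?S" by (rule keys_diff)
  then show ?thesis
    using weighted_sum_superset[of ?S p \<chi>] weighted_sum_superset[of ?S q \<chi>] weighted_sum_superset[of ?S "p - q" \<chi>]
    by (simp add: lookup_minus left_diff_distrib sum_subtractf)
qed

lemma weighted_sum_zero [simp]: "weighted_sum \<chi> 0 = 0"
  by (simp add: weighted_sum_def)

lemma weighted_sum_uminus: "weighted_sum \<chi> (- p) = - weighted_sum \<chi> p"
  using weighted_sum_diff[of \<chi> 0 p] by simp

lemma weighted_sum_add: "weighted_sum \<chi> (p + q) = weighted_sum \<chi> p + weighted_sum \<chi> q"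
  using weighted_sum_diff[of \<chi> p "- q"] by (simp add: weighted_sum_uminus)

abbreviation mon :: "int \<Rightarrow> laurent" where
  "mon k \<equiv> Poly_Mapping.single k 1"

lemma weighted_sum_mono [simp]: "weighted_sum \<chi> (mon k) = \<chi> k"
  by (simp add: weighted_sum_def)

text \<open>Laurent polynomials are the free abelian group on the monomials, so additive identities
  need checking on these only.\<close>

lemma laurent_induct [case_names zero mon diff]:
  assumes "Q 0" "\<And>k. Q (mon k)" "\<And>p q. Q p \<Longrightarrow> Q q \<Longrightarrow> Q (p - q)"
  shows "Q (p :: laurent)"
  using frag_induction[of p UNIV Q] assms by simp

lemma weighted_sum_mono_mult: "weighted_sum \<chi> (mon i * p) = weighted_sum (\<lambda>k. \<chi> (i + k)) p"
  by (induction p rule: laurent_induct) (simp_all add: mult_single right_diff_distrib weighted_sum_diff)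

text \<open>The residue class contains none of 0, 1, -1, so that \<open>ha\<close> commutes with its
  conjugate by \<open>ht\<close>. It also differs from its negative; with 2 in place of 3 the two
  would coincide.\<close>

definition chi :: "nat \<Rightarrow> int \<Rightarrow> int" where
  "chi j k = (if k mod 3 ^ (j + 2) = 3 ^ (j + 1) then 1 else 0)"

type_synonym hall = "int \<times> laurent \<times> laurent \<times> (nat \<Rightarrow> int)"

text \<open>The matrices with rows \<open>(1, b, z)\<close>, \<open>(0, x\<^sup>k, n)\<close>, \<open>(0, 0, 1)\<close> over the Laurent polynomials, with the
  central entry \<open>z\<close> replaced by the integers \<open>weighted_sum (chi j) z\<close> for \<open>j \<in> T\<close>.\<close>

fun hmult :: "nat set \<Rightarrow> hall \<Rightarrow> hall \<Rightarrow> hall" where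
  "hmult T (k, b, n, z) (k', b', n', z') =
     (k + k', b' + b * mon k', n + mon k * n',
      \<lambda>j. z j + z' j + of_bool (j \<in> T) * weighted_sum (chi j) (b * n'))"

fun hinv :: "nat set \<Rightarrow> hall \<Rightarrow> hall" where
  "hinv T (k, b, n, z) =
     (- k, - (b * mon (- k)), - (mon (- k) * n),
      \<lambda>j. - z j + of_bool (j \<in> T) * weighted_sum (chi j) (b * mon (- k) * n))"

definition hall :: "nat set \<Rightarrow> hall monoid" where
  "hall T = \<lparr>carrier = UNIV, mult = hmult T, one = (0, 0, 0, \<lambda>_. 0)\<rparr>"

lemma hall_simps [simp]: "carrier (hall T) = UNIV" "mult (hall T) = hmult T"
  "\<one>\<^bsub>hall T\<^esub> = (0, 0, 0, \<lambda>_. 0)"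
  by (simp_all add: hall_def)

lemma mono_mult [simp]: "mon k * mon l = mon (k + l)"
  by (simp add: mult_single)

lemma mono_cancel: "mon (- k) * (mon k * p) = p" "b * mon (- k) * mon k = b"
  "mon k * (mon l * p) = mon (k + l) * p" "b * mon k * mon l = b * mon (k + l)"
  by (simp_all add: mult.assoc flip: mult.assoc[of "mon _" "mon _"])

lemma hmult_assoc: "hmult T (hmult T x y) z = hmult T x (hmult T y z)"
  by (cases x; cases y; cases z) (auto simp: algebra_simps weighted_sum_add)

lemma group_hall: "group (hall T)"
proof (rule groupI)
  fix x :: hall
  obtain k b n z where "x = (k, b, n, z)" by (cases x)
  then have "hinv T x \<otimes>\<^bsub>hall T\<^esub> x = \<one>\<^bsub>hall T\<^esub>"
    by (auto simp: mono_cancel weighted_sum_uminus)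
  then show "\<exists>y\<in>carrier (hall T). y \<otimes>\<^bsub>hall T\<^esub> x = \<one>\<^bsub>hall T\<^esub>"
    by (intro bexI[of _ "hinv T x"]) auto
qed (auto simp: hmult_assoc)

lemma inv_hall [simp]: "inv\<^bsub>hall T\<^esub> x = hinv T x"
proof (rule group.inv_equality[OF group_hall])
  show "hinv T x \<otimes>\<^bsub>hall T\<^esub> x = \<one>\<^bsub>hall T\<^esub>"
    by (cases x) (auto simp: mono_cancel weighted_sum_uminus)
qed auto

text \<open>As \<open>ha\<close> has \<open>b = n = 1\<close>, the conjugate
  \<open>t^K a t^-K\<close> has \<open>b = x^-K\<close> and \<open>n = x^K\<close>. It commutes with
  \<open>ha\<close> up to the centre, where the two products differ by
  \<open>chi j K - chi j (- K)\<close> for \<open>j \<in> T\<close>.\<close>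

definition ha :: hall where "ha = (0, 1, 1, \<lambda>_. 0)"
definition ht :: hall where "ht = (1, 0, 0, \<lambda>_. 0)"

definition zpos :: "(nat \<Rightarrow> int) \<Rightarrow> bool" where
  "zpos z \<longleftrightarrow> (\<exists>j. z j > 0 \<and> (\<forall>i<j. z i = 0))"

lemma zpos_total: "z = (\<lambda>_. 0) \<or> zpos z \<or> zpos (\<lambda>j. - z j)"
proof (cases "z = (\<lambda>_. 0)")
  case False
  then obtain i where i: "z i \<noteq> 0" by auto
  define j where "j = (LEAST i. z i \<noteq> 0)"
  have "z j \<noteq> 0" unfolding j_def by (rule LeastI[of _ i]) (rule i)
  moreover have "\<forall>i<j. z i = 0" using not_less_Least unfolding j_def by blast
  ultimately show ?thesis unfolding zpos_def by (cases "z j > 0") (auto intro!: exI[of _ j])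
qed simp

lemma zpos_add: "zpos z \<Longrightarrow> zpos z' \<Longrightarrow> zpos (\<lambda>j. z j + z' j)"
proof -
  assume "zpos z" "zpos z'"
  then obtain j j' where "z j > 0" "\<forall>i<j. z i = 0" "z' j' > 0" "\<forall>i<j'. z' i = 0"
    by (auto simp: zpos_def)
  then show ?thesis unfolding zpos_def
    by (cases j j' rule: linorder_cases) (auto intro!: exI[of _ "min j j'"] simp: min_def)
qed

lemma zpos_zero: "\<not> zpos (\<lambda>_. 0)"
  by (simp add: zpos_def)

text \<open>A lexicographic positive cone. When a coordinate decides the sign of a product, the
  earlier coordinates of both factors vanish, so the twist by \<open>mon k\<close> and the central
  term \<open>b * n'\<close> do not interfere.\<close>

definition hpos :: "hall set" where
  "hpos = {(k, b, n, z). k > 0 \<or> k = 0 \<and> (b > 0 \<or> b = 0 \<and> (n > 0 \<or> n = 0 \<and> zpos z))}"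

lemma hpos_mult: "x \<in> hpos \<Longrightarrow> y \<in> hpos \<Longrightarrow> hmult T x y \<in> hpos"
  by (cases x; cases y) (auto simp: hpos_def zpos_add add_pos_pos)

lemma hpos_total: "x = (0, 0, 0, \<lambda>_. 0) \<or> x \<in> hpos \<or> hinv T x \<in> hpos"
proof -
  obtain k b n z where x: "x = (k, b, n, z)" by (cases x)
  show ?thesis
    using zpos_total[of z] by (auto simp: x hpos_def not_less_iff_gr_or_eq)
qed

lemma chi_one: "chi j 0 = 0" "chi j 1 = 0" "chi j (- 1) = 0"
proof -
  have p: "(3::int) ^ (j + 1) \<ge> 3" using power_increasing[of 1 "j + 1" "3::int"] by simp
  show "chi j 0 = 0" by (simp add: chi_def)
  have "(1 :: int) mod 3 ^ (j + 2) = 1" by (rule mod_pos_pos_trivial) (simp, rule one_less_power, simp_all)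
  moreover have "(1 :: int) \<noteq> 3 ^ (j + 1)" using p by linarith
  ultimately show "chi j 1 = 0" by (simp only: chi_def if_False)
  have "(-1 :: int) mod 3 ^ (j + 2) = 3 ^ (j + 2) - 1"
    using p by (simp add: zmod_minus1)
  moreover have "(3::int) ^ (j + 2) = 3 * 3 ^ (j + 1)" by simp
  then have "(3::int) ^ (j + 2) - 1 \<noteq> 3 ^ (j + 1)" using p by linarith
  ultimately show "chi j (- 1) = 0" by (simp only: chi_def if_False)
qed

text \<open>For \<open>i = j\<close> the number \<open>- (3^(j+1))\<close> has residue
  \<open>2 * 3^(j+1)\<close>. For \<open>i < j\<close> both numbers are multiples of the modulus
  \<open>3^(i+2)\<close>; for \<open>i > j\<close> they are closer to 0 than
  \<open>3^(i+1)\<close>.\<close>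

lemma chi_pow3: "chi i (3 ^ (j + 1)) - chi i (- (3 ^ (j + 1))) = (if i = j then 1 else 0)"
proof -
  consider "i = j" | "i < j" | "j < i" by linarith
  then show ?thesis
  proof cases
    case 1
    have "(- (3 * 3 ^ j)) mod (9 * 3 ^ j) = (9 * 3 ^ j - 3 * 3 ^ j :: int)"
      by (simp add: zmod_zminus1_eq_if)
    then show ?thesis using 1 by (simp add: chi_def)
  next
    case 2
    then have "(3::int) ^ (i + 2) dvd 3 ^ (j + 1)" by (intro le_imp_power_dvd) simp
    then have "(3::int) ^ (j + 1) mod 3 ^ (i + 2) = 0" "(- ((3::int) ^ (j + 1))) mod 3 ^ (i + 2) = 0"
      by (auto simp: dvd_eq_mod_eq_0 zmod_zminus1_eq_if)
    then show ?thesis using 2 by (simp add: chi_def)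
  next
    case 3
    then have l: "(3::int) ^ (j + 1) < 3 ^ (i + 1)" by (intro power_strict_increasing) auto
    have "(3::int) ^ (j + 1) < 3 ^ (i + 2)" using 3 by (intro power_strict_increasing) auto
    then have m: "(3::int) ^ (j + 1) mod 3 ^ (i + 2) = 3 ^ (j + 1)" by (intro mod_pos_pos_trivial) auto
    moreover have "(3::int) ^ (j + 1) \<noteq> 0" by simp
    ultimately have m': "(- ((3::int) ^ (j + 1))) mod 3 ^ (i + 2) = 3 ^ (i + 2) - 3 ^ (j + 1)"
      by (simp only: zmod_zminus1_eq_if if_False)
    have "(3::int) ^ (i + 2) = 3 * 3 ^ (i + 1)" "(0::int) < 3 ^ (i + 1)" by simp_all
    then have ne: "(3::int) ^ (j + 1) \<noteq> 3 ^ (i + 1)" "(3::int) ^ (i + 2) - 3 ^ (j + 1) \<noteq> 3 ^ (i + 1)"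
      using l by linarith+
    show ?thesis unfolding chi_def m m' if_not_P[OF ne(1)] if_not_P[OF ne(2)] using 3 by simp
  qed
qed

lemma hall_comm: "hmult T ha (hmult T (hmult T ht ha) (hinv T ht)) = hmult T (hmult T (hmult T ht ha) (hinv T ht)) ha"
  by (simp add: ha_def ht_def fun_eq_iff chi_one add.commute)

text \<open>The \<open>b\<close> coordinates \<open>1 - x\<close> and \<open>(1 - x) x\<close>
  already differ at \<open>x^0\<close>.\<close>

lemma hall_noncomm1:
  fixes T defines "s \<equiv> hinv T (hmult T ht ha)"
  shows "hmult T ht (hmult T (hmult T s ht) (hinv T s)) \<noteq> hmult T (hmult T (hmult T s ht) (hinv T s)) ht"
proof
  assume "hmult T ht (hmult T (hmult T s ht) (hinv T s)) = hmult T (hmult T (hmult T s ht) (hinv T s)) ht"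
  then have "fst (snd (hmult T ht (hmult T (hmult T s ht) (hinv T s)))) =
      fst (snd (hmult T (hmult T (hmult T s ht) (hinv T s)) ht))" by simp
  then have "Poly_Mapping.lookup (1 - mon 1) (0::int) = Poly_Mapping.lookup ((1 - mon 1) * mon 1) 0"
    by (simp add: s_def ha_def ht_def)
  then show False by (simp add: left_diff_distrib lookup_minus lookup_single lookup_one)
qed

lemma hall_noncomm2:
  fixes T defines "s \<equiv> hinv T (hmult T ht ha)"
  shows "hmult T s (hmult T (hmult T ha s) (hinv T ha)) \<noteq> hmult T (hmult T (hmult T ha s) (hinv T ha)) s"
proof
  assume "hmult T s (hmult T (hmult T ha s) (hinv T ha)) = hmult T (hmult T (hmult T ha s) (hinv T ha)) s"
  then have "fst (snd (hmult T s (hmult T (hmult T ha s) (hinv T ha)))) =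
      fst (snd (hmult T (hmult T (hmult T ha s) (hinv T ha)) s))" by simp
  then have "Poly_Mapping.lookup (- 1 - mon (- 2)) (0::int) = Poly_Mapping.lookup (- mon (- 1) - mon (- 1)) 0"
    by (simp add: s_def ha_def ht_def)
  then show False unfolding lookup_minus lookup_uminus lookup_single lookup_one by simp
qed

section \<open>Residual finiteness of Hall groups\<close>

definition periodic :: "int \<Rightarrow> (int \<Rightarrow> int) \<Rightarrow> bool" where
  "periodic q \<chi> \<longleftrightarrow> (\<forall>k. \<chi> (k mod q) = \<chi> k)"

definition residue_ind :: "int \<Rightarrow> int \<Rightarrow> int \<Rightarrow> int" where
  "residue_ind q r k = (if k mod q = r then 1 else 0)"

text \<open>For \<open>q > 0\<close> this says that \<open>p\<close> lies in the ideal generated by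
  \<open>q\<close> and \<open>x^q - 1\<close>, so it dies in the group ring of Z/q over Z/q. The
  form with functionals applies directly to \<open>chi j\<close>.\<close>

definition vanishes :: "int \<Rightarrow> laurent \<Rightarrow> bool" where
  "vanishes q p \<longleftrightarrow> (\<forall>\<chi>. periodic q \<chi> \<longrightarrow> q dvd weighted_sum \<chi> p)"

lemma weighted_sum_periodic:
  assumes "q > 0" "periodic q \<chi>"
  shows "weighted_sum \<chi> p = (\<Sum>r\<in>{0..<q}. \<chi> r * weighted_sum (residue_ind q r) p)"
proof (induction p rule: laurent_induct)
  case (mon k)
  have "(\<Sum>r\<in>{0..<q}. \<chi> r * residue_ind q r k) = (\<Sum>r\<in>{0..<q}. if k mod q = r then \<chi> r else 0)"
    by (rule sum.cong) (auto simp: residue_ind_def)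
  also have "\<dots> = \<chi> k" using assms by (simp add: periodic_def)
  finally show ?case by simp
qed (simp_all add: weighted_sum_diff right_diff_distrib sum_subtractf)

lemma vanishesI:
  assumes "q > 0" "\<And>r. r \<in> {0..<q} \<Longrightarrow> q dvd weighted_sum (residue_ind q r) p"
  shows "vanishes q p"
  unfolding vanishes_def using assms by (auto simp: weighted_sum_periodic intro!: dvd_sum)

lemma vanishes_add: "vanishes q x \<Longrightarrow> vanishes q y \<Longrightarrow> vanishes q (x + y)"
  by (simp add: vanishes_def weighted_sum_add)

lemma periodic_shift: "periodic q \<chi> \<Longrightarrow> periodic q (\<lambda>k. \<chi> (i + k))"
  unfolding periodic_def by (metis mod_add_right_eq)

lemma vanishes_mult: "vanishes q p \<Longrightarrow> vanishes q (g * p)"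
proof (induction g rule: laurent_induct)
  case (mon k)
  then show ?case by (auto simp: vanishes_def weighted_sum_mono_mult periodic_shift)
qed (auto simp: vanishes_def weighted_sum_diff left_diff_distrib)

lemma vanishes_mono: "k mod q = l mod q \<Longrightarrow> vanishes q (mon k - mon l)"
  unfolding vanishes_def periodic_def by (metis dvd_0_right weighted_sum_diff weighted_sum_mono right_minus_eq)

definition fold_list :: "int \<Rightarrow> laurent \<Rightarrow> int list" where
  "fold_list q p = map (\<lambda>r. weighted_sum (residue_ind q r) p mod q) [0..q - 1]"

lemma fold_list_eq_iff: "q > 0 \<Longrightarrow> fold_list q p = fold_list q p' \<longleftrightarrow> vanishes q (p - p')"
proof
  assume q: "q > 0" and "fold_list q p = fold_list q p'"
  then have "\<forall>r\<in>{0..<q}. weighted_sum (residue_ind q r) p mod q = weighted_sum (residue_ind q r) p' mod q"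
    by (auto simp: fold_list_def)
  then show "vanishes q (p - p')"
    by (intro vanishesI q) (simp add: weighted_sum_diff mod_eq_dvd_iff)
next
  assume "vanishes q (p - p')"
  then have "weighted_sum (residue_ind q r) p mod q = weighted_sum (residue_ind q r) p' mod q" for r
    by (auto simp: vanishes_def weighted_sum_diff mod_eq_dvd_iff periodic_def residue_ind_def)
  then show "fold_list q p = fold_list q p'" by (simp add: fold_list_def)
qed

text \<open>With \<open>q = 3^(J+1)\<close> throughout: the exponent mod \<open>q\<close>, the
  polynomials in the group ring of Z/q over Z/q, and the first \<open>J\<close> central coordinates
  mod \<open>q\<close>. For \<open>j < J\<close> the function \<open>chi j\<close> has period
  \<open>q\<close>, so these central coordinates depend on the reduced polynomials only.\<close>

definition level :: "nat \<Rightarrow> hall \<Rightarrow> nat" where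
  "level J = (\<lambda>(k, b, n, z). to_nat (k mod 3 ^ (J + 1), fold_list (3 ^ (J + 1)) b, fold_list (3 ^ (J + 1)) n,
      map (\<lambda>j. z j mod 3 ^ (J + 1)) [0..<J]))"

lemma level_eq_iff: "level J (k, b, n, z) = level J (k', b', n', z') \<longleftrightarrow>
   k mod 3 ^ (J + 1) = k' mod 3 ^ (J + 1) \<and> vanishes (3 ^ (J + 1)) (b - b') \<and> vanishes (3 ^ (J + 1)) (n - n') \<and>
   (\<forall>j<J. 3 ^ (J + 1) dvd z j - z' j)"
  unfolding level_def by (auto simp: fold_list_eq_iff mod_eq_dvd_iff simp del: power_Suc)

lemma chi_periodic:
  assumes "j < J"
  shows "periodic (3 ^ (J + 1)) (chi j)"
proof -
  have "(3::int) ^ (j + 2) dvd 3 ^ (J + 1)" using assms by (intro le_imp_power_dvd) simp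
  then show ?thesis by (simp add: periodic_def chi_def mod_mod_cancel)
qed

text \<open>The polynomials with \<open>vanishes q\<close> form an ideal that contains
  \<open>x^k - x^l\<close> for congruent \<open>k\<close>, \<open>l\<close> and on which
  \<open>chi j\<close> takes multiples of \<open>q\<close>.\<close>

lemma level_cong:
  assumes "level J x = level J y"
  shows "level J (hmult T g x) = level J (hmult T g y)"
proof -
  obtain k b n z k' b' n' z' where xy: "x = (k, b, n, z)" "y = (k', b', n', z')" by (cases x; cases y)
  obtain k0 b0 n0 z0 where g: "g = (k0, b0, n0, z0)" by (cases g)
  let ?q = "(3::int) ^ (J + 1)"
  have h: "k mod ?q = k' mod ?q" "vanishes ?q (b - b')" "vanishes ?q (n - n')" "\<forall>j<J. ?q dvd z j - z' j"
    using assms unfolding xy level_eq_iff by auto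
  have "(k0 + k) mod ?q = (k0 + k') mod ?q" using h(1) by (metis mod_add_right_eq)
  moreover have "vanishes ?q ((b + b0 * mon k) - (b' + b0 * mon k'))"
  proof -
    have "(b + b0 * mon k) - (b' + b0 * mon k') = (b - b') + b0 * (mon k - mon k')"
      by (simp add: algebra_simps)
    then show ?thesis using h(1,2) by (simp only: vanishes_add vanishes_mult vanishes_mono)
  qed
  moreover have "vanishes ?q ((n0 + mon k0 * n) - (n0 + mon k0 * n'))"
  proof -
    have "(n0 + mon k0 * n) - (n0 + mon k0 * n') = mon k0 * (n - n')" by (simp add: algebra_simps)
    then show ?thesis using h(3) by (simp only: vanishes_mult)
  qed
  moreover have "?q dvd (z0 j + z j + of_bool (j \<in> T) * weighted_sum (chi j) (b0 * n)) -
      (z0 j + z' j + of_bool (j \<in> T) * weighted_sum (chi j) (b0 * n'))" if "j < J" for j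
  proof -
    have "?q dvd weighted_sum (chi j) (b0 * (n - n'))"
      using vanishes_mult[OF h(3)] chi_periodic[OF that] unfolding vanishes_def by blast
    then have "?q dvd (z j - z' j) + (weighted_sum (chi j) (b0 * n) - weighted_sum (chi j) (b0 * n'))"
      using h(4) that by (intro dvd_add) (simp_all add: right_diff_distrib weighted_sum_diff)
    moreover have "?q dvd z j - z' j" using h(4) that by blast
    ultimately show ?thesis by (auto simp: algebra_simps)
  qed
  ultimately show ?thesis unfolding xy g hmult.simps level_eq_iff by blast
qed

lemma finite_level: "finite (range (level J))"
proof -
  let ?q = "(3::int) ^ (J + 1)"
  let ?L = "\<lambda>n. {xs. set xs \<subseteq> {0..<?q} \<and> length xs = n}"
  have "range (level J) \<subseteq> to_nat ` ({0..<?q} \<times> ?L (nat ?q) \<times> ?L (nat ?q) \<times> ?L J)"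
    by (auto simp: level_def fold_list_def simp del: power_Suc intro!: imageI)
  moreover have "finite (?L n)" for n by (rule finite_lists_length_eq) simp
  ultimately show ?thesis by (elim finite_subset) (intro finite_imageI finite_cartesian_product; simp)
qed

lemma not_dvd_power3:
  assumes "c \<noteq> 0" "nat \<bar>c\<bar> \<le> J"
  shows "\<not> 3 ^ (J + 1) dvd (c :: int)"
proof
  assume "3 ^ (J + 1) dvd c"
  then have "3 ^ (J + 1) \<le> \<bar>c\<bar>" using assms(1) by (metis abs_ge_zero abs_dvd_iff dvd_abs_iff dvd_imp_le_int abs_of_nonneg zero_le_numeral zero_le_power)
  moreover have "int J < 3 ^ J"
  proof (induction J)
    case (Suc J)
    moreover have "(1::int) \<le> 3 ^ J" by simp
    ultimately show ?case by (simp only: power_Suc of_nat_Suc)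
  qed simp
  moreover have "(3::int) ^ (J + 1) = 3 * 3 ^ J" "\<bar>c\<bar> \<le> int J" using assms(2) by simp_all
  ultimately show False by linarith
qed

lemma eventually_not_vanishes:
  assumes "p \<noteq> 0"
  shows "\<forall>\<^sub>F J in sequentially. \<not> vanishes (3 ^ (J + 1)) p"
proof -
  obtain k where k: "Poly_Mapping.lookup p k \<noteq> 0" using assms by (metis lookup_zero poly_mapping_eqI)
  define N where "N = (\<Sum>l\<in>Poly_Mapping.keys p. nat \<bar>l\<bar>)"
  have N: "nat \<bar>l\<bar> \<le> N" if "l \<in> Poly_Mapping.keys p" for l
    unfolding N_def using that by (intro member_le_sum) auto
  \<comment> \<open>\<open>2 * N\<close> bounds the distance between exponents of \<open>p\<close>,
    so no other exponent falls into the class of \<open>k\<close>; the second summand ensures that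
    the coefficient at \<open>k\<close> is not divisible by \<open>q\<close>.\<close>
  have "\<not> vanishes (3 ^ (J + 1)) p" if J: "J \<ge> 2 * N + nat \<bar>Poly_Mapping.lookup p k\<bar>" for J
  proof
    let ?q = "(3::int) ^ (J + 1)"
    assume v: "vanishes ?q p"
    have per: "periodic ?q (residue_ind ?q (k mod ?q))" by (simp add: periodic_def residue_ind_def)
    have "l = k" if l: "l \<in> Poly_Mapping.keys p" "l mod ?q = k mod ?q" for l
    proof (rule ccontr)
      assume "l \<noteq> k"
      moreover have "?q dvd l - k" using l(2) by (simp add: mod_eq_dvd_iff)
      moreover have "nat \<bar>l - k\<bar> \<le> J" using N[OF l(1)] N[of k] k J by (simp add: in_keys_iff)
      ultimately show False using not_dvd_power3[of "l - k" J] by simp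
    qed
    then have "weighted_sum (residue_ind ?q (k mod ?q)) p = (\<Sum>l\<in>Poly_Mapping.keys p. if l = k then Poly_Mapping.lookup p k else 0)"
      unfolding weighted_sum_def by (intro sum.cong) (auto simp: residue_ind_def)
    also have "\<dots> = Poly_Mapping.lookup p k" using k by (simp add: in_keys_iff)
    finally have "?q dvd Poly_Mapping.lookup p k"
      using v per unfolding vanishes_def by force
    then show False using not_dvd_power3[OF k, of J] J by simp
  qed
  then show ?thesis unfolding eventually_sequentially by blast
qed

text \<open>Valid for all large \<open>J\<close>, so that one \<open>J\<close> serves finitely many
  elements, as \<open>separating\<close> demands.\<close>

lemma eventually_separated:
  assumes "x \<noteq> (0, 0, 0, \<lambda>_. 0)"
  shows "\<forall>\<^sub>F J in sequentially. level J x \<noteq> level J (0, 0, 0, \<lambda>_. 0)"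
proof -
  obtain k b n z where x: "x = (k, b, n, z)" by (cases x)
  consider "k \<noteq> 0" | "b \<noteq> 0" | "n \<noteq> 0" | j where "z j \<noteq> 0" using assms x by fastforce
  then show ?thesis
  proof cases
    case 1
    have "\<not> 3 ^ (J + 1) dvd k" if "J \<ge> nat \<bar>k\<bar>" for J using not_dvd_power3[OF 1 that] .
    then show ?thesis unfolding x level_eq_iff eventually_sequentially
      by (auto simp: dvd_eq_mod_eq_0 simp del: power_Suc intro!: exI[of _ "nat \<bar>k\<bar>"])
  next
    case 2
    show ?thesis using eventually_not_vanishes[OF 2] unfolding x level_eq_iff by (rule eventually_mono) simp
  next
    case 3
    show ?thesis using eventually_not_vanishes[OF 3] unfolding x level_eq_iff by (rule eventually_mono) simp
  next
    case 4
    have "\<not> 3 ^ (J + 1) dvd z j" if "J \<ge> nat \<bar>z j\<bar>" for J using not_dvd_power3[OF 4 that] .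
    then have "\<not> (\<forall>j<J. 3 ^ (J + 1) dvd z j - 0)" if "J \<ge> max (Suc j) (nat \<bar>z j\<bar>)" for J
      using that by (auto intro!: exI[of _ j] simp del: power_Suc)
    then show ?thesis unfolding x level_eq_iff eventually_sequentially by blast
  qed
qed

text \<open>The whole of \<open>hall T\<close> is uncountable, because its central coordinates are
  arbitrary integer sequences.\<close>

definition hall_sub :: "nat set \<Rightarrow> hall monoid" where
  "hall_sub T = (hall T)\<lparr>carrier := generate (hall T) {ha, ht}\<rparr>"

lemma subgroup_hall_sub: "subgroup (carrier (hall_sub T)) (hall T)"
  using group.generate_is_subgroup[OF group_hall, of "{ha, ht}" T] by (simp add: hall_sub_def)

lemma hall_sub_simps [simp]: "mult (hall_sub T) = hmult T" "\<one>\<^bsub>hall_sub T\<^esub> = (0, 0, 0, \<lambda>_. 0)"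
  by (simp_all add: hall_sub_def)

lemma group_hall_sub: "group (hall_sub T)"
  using group.subgroup_imp_group[OF group_hall subgroup_hall_sub] by (simp add: hall_sub_def)

lemma hall_sub_inv: "x \<in> carrier (hall_sub T) \<Longrightarrow> inv\<^bsub>hall_sub T\<^esub> x = hinv T x"
  using group.m_inv_consistent[OF group_hall subgroup_hall_sub, of x T] by (simp add: hall_sub_def)

lemma hall_sub_gens: "ha \<in> carrier (hall_sub T)" "ht \<in> carrier (hall_sub T)"
  by (auto simp: hall_sub_def intro: generate.incl)

lemma gain_group_hall_sub: "gain_group (hall_sub T) ha ht hpos"
proof (intro gain_group.intro gain_group_axioms.intro)
  interpret G: group "hall_sub T" by (rule group_hall_sub)
  show "group (hall_sub T)" by (rule group_hall_sub)
  show "ha \<in> carrier (hall_sub T)" "ht \<in> carrier (hall_sub T)" by (rule hall_sub_gens)+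
  show "carrier (hall_sub T) \<subseteq> generate (hall_sub T) {ha, ht}"
    using group.generate_consistent[OF group_hall _ subgroup_hall_sub, of "{ha, ht}" T] hall_sub_gens[of T]
    by (simp add: hall_sub_def)
  show "x \<otimes>\<^bsub>hall_sub T\<^esub> y \<in> hpos" if "x \<in> hpos" "y \<in> hpos" for x y
    using hpos_mult[OF that] by simp
  show "x = \<one>\<^bsub>hall_sub T\<^esub> \<or> x \<in> hpos \<or> inv\<^bsub>hall_sub T\<^esub> x \<in> hpos" if "x \<in> carrier (hall_sub T)" for x
    using hpos_total[of x T] hall_sub_inv[OF that] by simp
  show "\<one>\<^bsub>hall_sub T\<^esub> \<notin> hpos" by (simp add: hpos_def zpos_zero)
  have ta: "hmult T ht ha \<in> carrier (hall_sub T)"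
    using G.m_closed[OF hall_sub_gens(2,1)] by simp
  have s: "hinv T (hmult T ht ha) \<in> carrier (hall_sub T)"
    using G.inv_closed[OF ta] hall_sub_inv[OF ta] by simp
  note i = hall_sub_inv[OF hall_sub_gens(1)] hall_sub_inv[OF hall_sub_gens(2)] hall_sub_inv[OF ta] hall_sub_inv[OF s]
  show "ha \<otimes>\<^bsub>hall_sub T\<^esub> (ht \<otimes>\<^bsub>hall_sub T\<^esub> ha \<otimes>\<^bsub>hall_sub T\<^esub> inv\<^bsub>hall_sub T\<^esub> ht) =
    ht \<otimes>\<^bsub>hall_sub T\<^esub> ha \<otimes>\<^bsub>hall_sub T\<^esub> inv\<^bsub>hall_sub T\<^esub> ht \<otimes>\<^bsub>hall_sub T\<^esub> ha"
    unfolding hall_sub_simps i by (rule hall_comm)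
  show "ht \<otimes>\<^bsub>hall_sub T\<^esub> (inv\<^bsub>hall_sub T\<^esub> (ht \<otimes>\<^bsub>hall_sub T\<^esub> ha) \<otimes>\<^bsub>hall_sub T\<^esub> ht \<otimes>\<^bsub>hall_sub T\<^esub>
      inv\<^bsub>hall_sub T\<^esub> (inv\<^bsub>hall_sub T\<^esub> (ht \<otimes>\<^bsub>hall_sub T\<^esub> ha))) \<noteq>
    inv\<^bsub>hall_sub T\<^esub> (ht \<otimes>\<^bsub>hall_sub T\<^esub> ha) \<otimes>\<^bsub>hall_sub T\<^esub> ht \<otimes>\<^bsub>hall_sub T\<^esub>
      inv\<^bsub>hall_sub T\<^esub> (inv\<^bsub>hall_sub T\<^esub> (ht \<otimes>\<^bsub>hall_sub T\<^esub> ha)) \<otimes>\<^bsub>hall_sub T\<^esub> ht"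
    unfolding hall_sub_simps i by (rule hall_noncomm1)
  show "inv\<^bsub>hall_sub T\<^esub> (ht \<otimes>\<^bsub>hall_sub T\<^esub> ha) \<otimes>\<^bsub>hall_sub T\<^esub>
      (ha \<otimes>\<^bsub>hall_sub T\<^esub> inv\<^bsub>hall_sub T\<^esub> (ht \<otimes>\<^bsub>hall_sub T\<^esub> ha) \<otimes>\<^bsub>hall_sub T\<^esub> inv\<^bsub>hall_sub T\<^esub> ha) \<noteq>
    ha \<otimes>\<^bsub>hall_sub T\<^esub> inv\<^bsub>hall_sub T\<^esub> (ht \<otimes>\<^bsub>hall_sub T\<^esub> ha) \<otimes>\<^bsub>hall_sub T\<^esub> inv\<^bsub>hall_sub T\<^esub> ha \<otimes>\<^bsub>hall_sub T\<^esub>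
      inv\<^bsub>hall_sub T\<^esub> (ht \<otimes>\<^bsub>hall_sub T\<^esub> ha)"
    unfolding hall_sub_simps i by (rule hall_noncomm2)
  fix E assume E: "finite E" "E \<subseteq> carrier (hall_sub T)" "\<one>\<^bsub>hall_sub T\<^esub> \<notin> E"
  have "\<forall>x\<in>E. \<forall>\<^sub>F J in sequentially. level J x \<noteq> level J (0, 0, 0, \<lambda>_. 0)"
  proof
    fix x assume "x \<in> E"
    then have "x \<noteq> (0, 0, 0, \<lambda>_. 0)" using E(3) by auto
    then show "\<forall>\<^sub>F J in sequentially. level J x \<noteq> level J (0, 0, 0, \<lambda>_. 0)" by (rule eventually_separated)
  qed
  then have "\<forall>\<^sub>F J in sequentially. \<forall>x\<in>E. level J x \<noteq> level J (0, 0, 0, \<lambda>_. 0)"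
    using E(1) by (simp add: eventually_ball_finite_distrib)
  then obtain J where J: "\<forall>x\<in>E. level J x \<noteq> level J (0, 0, 0, \<lambda>_. 0)"
    by (auto simp: eventually_sequentially)
  show "\<exists>\<theta> :: hall \<Rightarrow> nat. finite (\<theta> ` carrier (hall_sub T)) \<and> (\<forall>x\<in>E. \<theta> x \<noteq> \<theta> \<one>\<^bsub>hall_sub T\<^esub>) \<and>
    (\<forall>g\<in>carrier (hall_sub T). \<forall>x\<in>carrier (hall_sub T). \<forall>y\<in>carrier (hall_sub T). \<theta> x = \<theta> y \<longrightarrow>
      \<theta> (g \<otimes>\<^bsub>hall_sub T\<^esub> x) = \<theta> (g \<otimes>\<^bsub>hall_sub T\<^esub> y))"
    unfolding hall_sub_simps
    by (intro exI[of _ "level J"] conjI ballI impI finite_subset[OF _ finite_level] level_cong)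
      (use J in auto)
qed

section \<open>The commutator relations that recover \<open>T\<close>\<close>

definition comm_word :: "('a, 'b) monoid_scheme \<Rightarrow> nat \<Rightarrow> 'a \<Rightarrow> 'a \<Rightarrow> bool" where
  "comm_word G j x y \<longleftrightarrow> x \<otimes>\<^bsub>G\<^esub> (y [^]\<^bsub>G\<^esub> ((3::nat) ^ (j + 1)) \<otimes>\<^bsub>G\<^esub> x \<otimes>\<^bsub>G\<^esub> inv\<^bsub>G\<^esub> (y [^]\<^bsub>G\<^esub> ((3::nat) ^ (j + 1)))) =
     y [^]\<^bsub>G\<^esub> ((3::nat) ^ (j + 1)) \<otimes>\<^bsub>G\<^esub> x \<otimes>\<^bsub>G\<^esub> inv\<^bsub>G\<^esub> (y [^]\<^bsub>G\<^esub> ((3::nat) ^ (j + 1))) \<otimes>\<^bsub>G\<^esub> x"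

lemma comm_word_inj_hom:
  assumes "group_hom G H h" "inj_on h (carrier G)" "x \<in> carrier G" "y \<in> carrier G"
  shows "comm_word H j (h x) (h y) \<longleftrightarrow> comm_word G j x y"
proof -
  interpret h: group_hom G H h by fact
  let ?c = "y [^]\<^bsub>G\<^esub> ((3::nat) ^ (j + 1)) \<otimes>\<^bsub>G\<^esub> x \<otimes>\<^bsub>G\<^esub> inv\<^bsub>G\<^esub> (y [^]\<^bsub>G\<^esub> ((3::nat) ^ (j + 1)))"
  have c: "?c \<in> carrier G" using assms(3,4) by simp
  have "comm_word H j (h x) (h y) \<longleftrightarrow> h (x \<otimes>\<^bsub>G\<^esub> ?c) = h (?c \<otimes>\<^bsub>G\<^esub> x)"
    using assms(3,4) by (simp add: comm_word_def h.hom_nat_pow)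
  also have "\<dots> \<longleftrightarrow> x \<otimes>\<^bsub>G\<^esub> ?c = ?c \<otimes>\<^bsub>G\<^esub> x"
    using assms(2,3) c by (intro inj_on_eq_iff) auto
  finally show ?thesis by (simp only: comm_word_def)
qed

text \<open>The two sides differ at most in the centre, and there \<open>chi_pow3\<close> isolates
  the coordinate \<open>j\<close>.\<close>

lemma comm_word_hall_sub: "comm_word (hall_sub T) j ha ht \<longleftrightarrow> j \<notin> T"
proof -
  interpret G: group "hall_sub T" by (rule group_hall_sub)
  have pow: "ht [^]\<^bsub>hall_sub T\<^esub> n = (int n, 0, 0, \<lambda>_. 0)" for n :: nat
    by (induction n) (auto simp: ht_def)
  define K where "K = (3::int) ^ (j + 1)"
  have tK: "ht [^]\<^bsub>hall_sub T\<^esub> ((3::nat) ^ (j + 1)) = (K, 0, 0, \<lambda>_. 0)"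
    unfolding pow K_def by simp
  have inv: "inv\<^bsub>hall_sub T\<^esub> (K, 0, 0, \<lambda>_. 0) = (- K, 0, 0, \<lambda>_. 0)"
    unfolding tK[symmetric] hall_sub_inv[OF G.nat_pow_closed[OF hall_sub_gens(2)]] unfolding tK by simp
  have "comm_word (hall_sub T) j ha ht \<longleftrightarrow> (\<forall>i. of_bool (i \<in> T) * chi i K = of_bool (i \<in> T) * chi i (- K))"
    unfolding comm_word_def tK inv by (simp add: ha_def fun_eq_iff add.commute)
  also have "\<dots> \<longleftrightarrow> (\<forall>i. i \<in> T \<longrightarrow> chi i K - chi i (- K) = 0)" by auto
  also have "\<dots> \<longleftrightarrow> j \<notin> T" unfolding K_def chi_pow3 by auto
  finally show ?thesis .
qed

section \<open>Counting isomorphism types\<close>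

definition encodes :: "('a, 'b) monoid_scheme \<Rightarrow> nat set \<Rightarrow> bool" where
  "encodes G T \<longleftrightarrow> (\<exists>x\<in>carrier G. \<exists>y\<in>carrier G. \<forall>j. comm_word G j x y \<longleftrightarrow> j \<notin> T)"

lemma encodes_inj_hom:
  assumes "group_hom G H h" "inj_on h (carrier G)" "encodes G T"
  shows "encodes H T"
proof -
  interpret h: group_hom G H h by fact
  show ?thesis
    using assms(3) comm_word_inj_hom[OF assms(1,2)] unfolding encodes_def by (meson h.hom_closed)
qed

lemma encodes_iso:
  assumes "group G" "group H" "G \<cong> H" "encodes G T"
  shows "encodes H T"
proof -
  obtain h where h: "h \<in> iso G H" using assms(3) by (auto simp: is_iso_def)
  have "group_hom G H h" using h assms by (auto simp: group_hom_def group_hom_axioms_def iso_def)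
  moreover have "inj_on h (carrier G)" using h by (auto simp: iso_def bij_betw_def)
  ultimately show ?thesis using assms(4) by (rule encodes_inj_hom)
qed

text \<open>A pair of elements determines the set that it encodes.\<close>

lemma countable_encodes:
  assumes "countable (carrier G)"
  shows "countable {T. encodes G T}"
proof -
  have "{T. encodes G T} \<subseteq> (\<lambda>(x, y). {j. \<not> comm_word G j x y}) ` (carrier G \<times> carrier G)"
    by (force simp: encodes_def)
  then show ?thesis using assms by (meson countable_SIGMA countable_image countable_subset)
qed

text \<open>\<open>W\<close> is countable, so it can be replaced by an isomorphic group on the
  natural numbers; \<open>Out_cong\<close> carries the properties of \<open>Out W\<close>
  along.\<close>

lemma ex_group_Out_encodes:
  "\<exists>G :: nat monoid. group G \<and> finitely_generated G \<and> residually_finite G \<and>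
     finitely_generated (Out G) \<and> encodes (Out G) T"
proof -
  interpret gain_group "hall_sub T" ha ht hpos by (rule gain_group_hall_sub)
  have "encodes (hall_sub T) T"
    unfolding encodes_def using comm_word_hall_sub hall_sub_gens by blast
  then have e: "encodes (Out W) T" by (rule encodes_inj_hom[OF rho_class_hom])
  obtain G :: "nat monoid" where G: "group G" "W \<cong> G"
    using nat_monoid_iso[OF group_W finitely_generated_countable[OF group_W finitely_generated_W]] by blast
  note iso = Out_cong[OF group_W G]
  have "group (Out G)" by (rule group.group_Out[OF G(1)])
  then show ?thesis
    using finitely_generated_iso[OF group_W G finitely_generated_W]
      residually_finite_iso[OF group_W G residually_finite_W]
      finitely_generated_iso[OF W.group_Out _ iso finitely_generated_Out_W]
      encodes_iso[OF W.group_Out _ iso e] G(1) by blast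
qed

instance recfun :: countable by countable_datatype

lemma inj_word_code: "inj word_code"
proof -
  have "inj (\<lambda>(i::nat, b). 2 * i + of_bool b :: nat)"
    by (rule inj_on_inverseI[where g = "\<lambda>n. (n div 2, odd n)"]) (auto split: prod.splits)
  then show ?thesis
    unfolding word_code_def by (intro injI) (simp add: inj_eq[OF inj_list_encode] inj_map_eq_map)
qed

text \<open>There are countably many programs, and since \<open>word_code\<close> is injective, a
  program whose domain is the set of codes of \<open>R\<close> determines \<open>R\<close>.\<close>

lemma countable_presentations:
  "countable {(n, R). R \<subseteq> words {..<n::nat} \<and> recursively_enumerable (word_code ` R)}"
proof -
  let ?f = "\<lambda>(n, f). (n, {w. \<exists>y. computes f [word_code w] y})"
  have eq: "R = {w. \<exists>y. computes f [word_code w] y}" if "word_code ` R = {x. \<exists>y. computes f [x] y}" for R f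
  proof (rule Set.set_eqI)
    show "w \<in> R \<longleftrightarrow> w \<in> {w. \<exists>y. computes f [word_code w] y}" for w
      using inj_image_mem_iff[OF inj_word_code, of w R] unfolding that by simp
  qed
  have "{(n, R). R \<subseteq> words {..<n::nat} \<and> recursively_enumerable (word_code ` R)} \<subseteq> range ?f"
  proof clarify
    fix n :: nat and R assume "recursively_enumerable (word_code ` R)"
    then obtain f where "word_code ` R = {x. \<exists>y. computes f [x] y}"
      by (auto simp: recursively_enumerable_def)
    from eq[OF this] have "(n, R) = ?f (n, f)" by simp
    then show "(n, R) \<in> range ?f" by (rule range_eqI)
  qed
  then show ?thesis by (rule countable_subset) (rule countable_image, rule countableI_type)
qed

lemma uncountable_nat_sets: "uncountable (UNIV :: nat set set)"
proof
  assume "countable (UNIV :: nat set set)"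
  then have "range (from_nat_into (UNIV :: nat set set)) = UNIV" by (simp add: range_from_nat_into)
  then show False using Cantors_theorem[of "UNIV :: nat set"] by (metis Pow_UNIV)
qed

text \<open>The cover has at most \<open>|D|\<close> times aleph_0 elements, which is
  \<open>|D|\<close> for infinite \<open>D\<close>. Uncountability of \<open>D\<close> alone would
  fix its cardinality only under the continuum hypothesis.\<close>

lemma eqpoll_countable_cover:
  includes cardinal_syntax
  assumes U: "uncountable U" and "D \<subseteq> U" and cover: "U \<subseteq> (\<Union>x\<in>D. A x) \<union> N"
    and A: "\<And>x. countable (A x)" and N: "countable N"
  shows "D \<approx> U"
proof -
  have inf: "infinite D"
  proof
    assume "finite D"
    then have "countable ((\<Union>x\<in>D. A x) \<union> N)"
      by (rule countable_Un[OF countable_UN[OF countable_finite] N]) (rule A)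
    then show False using U cover countable_subset by blast
  qed
  have le: "|S| \<le>o |D|" if "countable S" for S
  proof -
    have "|S| \<le>o |UNIV :: nat set|" using that by (simp add: countable_def flip: card_of_ordLeq)
    then show ?thesis using inf infinite_iff_card_of_nat ordLeq_transitive by blast
  qed
  have "|\<Union>x\<in>D. A x| \<le>o |D|"
    by (rule card_of_UNION_ordLeq_infinite[OF inf card_of_mono1]) (use le[OF A] in auto)
  then have "|(\<Union>x\<in>D. A x) \<union> N| \<le>o |D|"
    by (intro card_of_Un_ordLeq_infinite_Field le[OF N] card_of_Card_order) (simp_all add: Field_card_of inf)
  then have "|U| \<le>o |D|" by (rule ordLeq_transitive[OF card_of_mono1[OF cover]])
  then have "U \<lesssim> D" unfolding lepoll_def card_of_ordLeq .
  then show ?thesis by (rule lepoll_antisym[OF subset_imp_lepoll[OF \<open>D \<subseteq> U\<close>]])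
qed

theorem theorem1:
  shows "\<exists>\<G> :: nat monoid set.
    \<G> \<approx> (UNIV :: nat set set) \<and>
    (\<forall>G \<in> \<G>. group G \<and> finitely_generated G \<and> residually_finite G) \<and>
    (\<forall>G \<in> \<G>. finitely_generated (Out G) \<and> \<not> recursively_presentable (Out G)) \<and>
    (\<forall>G\<^sub>1 \<in> \<G>. \<forall>G\<^sub>2 \<in> \<G>. G\<^sub>1 \<noteq> G\<^sub>2 \<longrightarrow> \<not> Out G\<^sub>1 \<cong> Out G\<^sub>2)"
proof -
  obtain G :: "nat set \<Rightarrow> nat monoid" where
    G: "\<And>T. group (G T)" "\<And>T. finitely_generated (G T)" "\<And>T. residually_finite (G T)"
    and fgO: "\<And>T. finitely_generated (Out (G T))" and enc: "\<And>T. encodes (Out (G T)) T"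
    using ex_group_Out_encodes by metis
  have gO: "group (Out (G T))" for T by (rule group.group_Out[OF G(1)])
  define E where "E T = {T'. Out (G T) \<cong> Out (G T')}" for T
  have E_refl: "T \<in> E T" for T by (simp add: E_def iso_refl)
  have E_sym: "T' \<in> E T \<Longrightarrow> T \<in> E T'" for T T' using group.iso_sym[OF gO] by (simp add: E_def)
  have E_eq: "T' \<in> E T \<Longrightarrow> E T' = E T" for T T'
    using iso_trans group.iso_sym[OF gO] unfolding E_def by blast
  \<comment> \<open>Every index in the class of \<open>T\<close> is encoded by a pair in the one
    countable group \<open>Out (G T)\<close>.\<close>
  have E_countable: "countable (E T)" for T
  proof -
    have "E T \<subseteq> {T'. encodes (Out (G T)) T'}"
      using encodes_iso[OF gO gO group.iso_sym[OF gO] enc] by (auto simp: E_def)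
    then show ?thesis
      by (rule countable_subset) (rule countable_encodes[OF finitely_generated_countable[OF gO fgO]])
  qed
  define bad where "bad = {T. recursively_presentable (Out (G T))}"
  have "countable bad"
  proof -
    let ?P = "{(n, R). R \<subseteq> words {..<n::nat} \<and> recursively_enumerable (word_code ` R)}"
    let ?S = "\<lambda>(n, R). {T. Out (G T) \<cong> presented_group {..<n} R}"
    \<comment> \<open>Indices that share a presentation have isomorphic outer automorphism groups,
      so they lie in one countable class.\<close>
    have "countable (?S p)" if "p \<in> ?P" for p
    proof (cases "?S p = {}")
      case False
      obtain n R where p: "p = (n, R)" by force
      obtain T where T: "Out (G T) \<cong> presented_group {..<n} R" using False p by auto
      have "?S p \<subseteq> E T"
        using p T iso_trans[OF T group.iso_sym[OF gO]] by (auto simp: E_def)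
      then show ?thesis using E_countable countable_subset by blast
    qed simp
    then have "countable (\<Union>p\<in>?P. ?S p)" by (rule countable_UN[OF countable_presentations])
    moreover have "bad \<subseteq> (\<Union>p\<in>?P. ?S p)"
      by (auto simp: bad_def recursively_presentable_def)
    ultimately show ?thesis by (rule countable_subset[rotated])
  qed
  \<comment> \<open>The condition depends on \<open>T\<close> only through the class
    \<open>E T\<close>, so all indices of a class get the same representative, and \<open>D\<close>
    is a transversal of the classes that are not contained in \<open>bad\<close>.\<close>
  define rep where "rep T = (SOME T'. T' \<in> E T \<and> T' \<notin> bad)" for T
  have rep: "rep T \<in> E T \<and> rep T \<notin> bad" if "T \<notin> bad" for T
    unfolding rep_def by (rule someI[of _ T]) (use E_refl that in simp)
  define D where "D = rep ` (- bad)"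
  have D_bad: "T \<notin> bad" if "T \<in> D" for T using that rep by (auto simp: D_def)
  have D_eq: "T = T'" if TD: "T \<in> D" "T' \<in> D" and "T' \<in> E T" for T T'
  proof -
    obtain S S' where S: "S \<notin> bad" "T = rep S" "S' \<notin> bad" "T' = rep S'" using TD by (auto simp: D_def)
    have "E S = E S'" using E_eq rep[OF S(1)] rep[OF S(3)] \<open>T' \<in> E T\<close> S by metis
    then show ?thesis using S by (simp add: rep_def)
  qed
  have cover: "(UNIV :: nat set set) = (\<Union>T\<in>D. E T) \<union> bad"
  proof -
    have "T \<in> (\<Union>T\<in>D. E T)" if "T \<notin> bad" for T
      using rep[OF that] E_sym that by (auto simp: D_def)
    then show ?thesis by blast
  qed
  have "D \<approx> (UNIV :: nat set set)"
    by (rule eqpoll_countable_cover[OF uncountable_nat_sets _ _ E_countable \<open>countable bad\<close>]) (use cover in auto)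
  moreover have "inj_on G D"
  proof (rule inj_onI)
    fix T T' assume "T \<in> D" "T' \<in> D" "G T = G T'"
    then show "T = T'" using D_eq[of T T'] by (simp add: E_def iso_refl)
  qed
  ultimately have "G ` D \<approx> (UNIV :: nat set set)"
    using inj_on_image_eqpoll_self eqpoll_trans by blast
  moreover have "\<not> Out (G T) \<cong> Out (G T')" if "T \<in> D" "T' \<in> D" "G T \<noteq> G T'" for T T'
    using D_eq[OF that(1,2)] that(3) by (auto simp: E_def)
  ultimately show ?thesis
    using G fgO D_bad by (intro exI[of _ "G ` D"]) (auto simp: bad_def)
qed

end
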